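(* Let $(M,\tau)$ be a tracial von Neumann algebra generated by a finite tuple $\mathbf{X}=(x_1,\dots,x_d)$ of self-adjoint elements, $M=W^*(\mathbf{X})$, and let $\mathbf{S}=(s_1,\dots,s_d)$ be a free $(0,1)$-semicircular family, free from $M$. Put $\widetilde M=W^*(\mathbf{X},\mathbf{S})$. Suppose that there are a free ultrafilter $\omega$ on a countably infinite set and a diffuse, separable, abelian von Neumann subalgebra $N\subseteq M^\omega=W^*(\mathbf{X})^\omega$ such that $L^2(N\mathbf{X}N)\perp L^2(N)\otimes L^2(N)$ as $N$-$N$ bimodules (i.e. these bimodules are disjoint). Then, for all $t>0$, inside $\widetilde M^\omega$, $$N\vee W^*(\mathbf{X}+\sqrt{t}\,\mathbf{S})=W^*(N,\mathbf{X},\mathbf{S})=N\vee\widetilde M .$$ Equivalently, for all $t>0$, $$\mathbf{X}\subset W^*(N,\mathbf{X}+\sqrt{t}\,\mathbf{S}).$$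
   Context: A tracial von Neumann algebra $(M,\tau)$ is a von Neumann algebra with a faithful normal tracial state. $M^\omega$ and $\widetilde M^\omega$ are the tracial ultrapowers; $\widetilde M\subseteq \widetilde M^\omega$ diagonally and $M^\omega\subseteq\widetilde M^\omega$. $\mathbf{X}+\sqrt t\,\mathbf{S}$ denotes the tuple $(x_1+\sqrt t s_1,\dots,x_d+\sqrt t s_d)$. $W^*(\cdot)$ denotes the von Neumann algebra generated, $A\vee B$ the von Neumann algebra generated by $A\cup B$. $L^2(N\mathbf{X}N)$ is the closed linear span in $L^2(\widetilde M^\omega)$ of $\{a x_i b: a,b\in N,\ 1\le i\le d\}$, regarded as an $N$-$N$ bimodule. $L^2(N)\otimes L^2(N)$ is the coarse $N$-$N$ bimodule. Two $N$-$N$ bimodules $H,K$ are written $H\perp K$ (disjoint) if no nonzero sub-bimodule of $H$ is isomorphic to a sub-bimodule of $K$, equivalently if there is no nonzero bounded $N$-$N$ bimodular map $H\to K$. (Identifying $N$ with $L^\infty(\mathcal X,\mu)$, this says that for each $i$ the measure on $\mathcal X\times\mathcal X$ associated with the $N$-$N$ cyclic vector $x_i$ is mutually singular with $\mu\otimes\mu$.) *)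

theory Defs
  imports "HOL-Analysis.Analysis"
begin

section \<open>Complex Hilbert spaces and bounded operators\<close>

text \<open>The inner product is linear in the first argument.  The library's real inner product is
  its real part, so that norm, topology and completeness are those of the library.\<close>

class chilbert_space = real_inner + complete_space +
  fixes scaleC :: "complex \<Rightarrow> 'a \<Rightarrow> 'a" (infixr \<open>*\<^sub>C\<close> 75)
    and cinner :: "'a \<Rightarrow> 'a \<Rightarrow> complex"
  assumes scaleC_add_right: "c *\<^sub>C (x + y) = c *\<^sub>C x + c *\<^sub>C y"
    and scaleC_add_left: "(c + d) *\<^sub>C x = c *\<^sub>C x + d *\<^sub>C x"
    and scaleC_scaleC: "c *\<^sub>C d *\<^sub>C x = (c * d) *\<^sub>C x"
    and scaleR_scaleC: "scaleR r x = complex_of_real r *\<^sub>C x"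
    and cinner_commute: "cinner x y = cnj (cinner y x)"
    and cinner_add_left: "cinner (x + y) z = cinner x z + cinner y z"
    and cinner_scaleC_left: "cinner (c *\<^sub>C x) y = c * cinner x y"
    and inner_eq_Re_cinner: "inner x y = Re (cinner x y)"

lemma cinner_self: "cinner x x = complex_of_real ((norm x)\<^sup>2)" for x :: "'a::chilbert_space"
proof -
  have "Im (cinner x x) = 0"
    using arg_cong[OF cinner_commute[of x x], of Im] by simp
  then show ?thesis
    by (simp add: complex_eq_iff power2_norm_eq_inner inner_eq_Re_cinner)
qed

lemma norm_scaleC: "norm (c *\<^sub>C x) = cmod c * norm x" for x :: "'a::chilbert_space"
proof -
  have "cinner (c *\<^sub>C x) (c *\<^sub>C x) = c * cnj (cinner (c *\<^sub>C x) x)"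
    by (simp add: cinner_scaleC_left cinner_commute[of x "c *\<^sub>C x"])
  also have "\<dots> = complex_of_real ((cmod c * norm x)\<^sup>2)"
    using complex_norm_square[of c]
    by (simp add: cinner_scaleC_left cinner_self power_mult_distrib mult.assoc [symmetric])
  finally have "(norm (c *\<^sub>C x))\<^sup>2 = (cmod c * norm x)\<^sup>2"
    unfolding cinner_self of_real_eq_iff .
  then show ?thesis
    by (simp add: power2_eq_iff_nonneg)
qed

lemma bounded_linear_scaleC: "bounded_linear (scaleC c :: 'a::chilbert_space \<Rightarrow> 'a)"
proof (rule bounded_linear_intro[where K = "cmod c"])
  show "c *\<^sub>C r *\<^sub>R x = r *\<^sub>R c *\<^sub>C x" for r and x :: 'a
    by (simp add: scaleR_scaleC scaleC_scaleC mult.commute)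
qed (simp_all add: scaleC_add_right norm_scaleC mult.commute)

type_synonym 'a op = "'a \<Rightarrow>\<^sub>L 'a"

lift_definition cscalar :: "complex \<Rightarrow> 'a::chilbert_space op" is scaleC
  by (rule bounded_linear_scaleC)

text \<open>The library's bounded operators are only real-linear; \<open>bounded_ops\<close> is $B(H)$.\<close>

definition bounded_ops :: "'a::chilbert_space op set" where
  "bounded_ops = {T. \<forall>c v. blinfun_apply T (c *\<^sub>C v) = c *\<^sub>C blinfun_apply T v}"

text \<open>The adjoint exists for every element of \<open>bounded_ops\<close>, and is only used there.\<close>

definition adj :: "'a::chilbert_space op \<Rightarrow> 'a op" where
  "adj T = (THE S. \<forall>v w. cinner (blinfun_apply T v) w = cinner v (blinfun_apply S w))"

definition selfadjoint :: "'a::chilbert_space op \<Rightarrow> bool" where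
  "selfadjoint T \<longleftrightarrow> T \<in> bounded_ops \<and> adj T = T"

definition projection :: "'a::chilbert_space op \<Rightarrow> bool" where
  "projection p \<longleftrightarrow> selfadjoint p \<and> p o\<^sub>L p = p"

definition csubspace :: "'a::chilbert_space set \<Rightarrow> bool" where
  "csubspace V \<longleftrightarrow> subspace V \<and> (\<forall>c. \<forall>v\<in>V. c *\<^sub>C v \<in> V)"

definition closed_cspan :: "'a::chilbert_space set \<Rightarrow> 'a set" where
  "closed_cspan A = (\<lambda>V. csubspace V \<and> closed V) hull A"


section \<open>Tracial von Neumann algebras\<close>

definition unital_star_algebra :: "'a::chilbert_space op set \<Rightarrow> bool" where
  "unital_star_algebra A \<longleftrightarrow> A \<subseteq> bounded_ops \<and> id_blinfun \<in> A \<and>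
     (\<forall>S\<in>A. \<forall>T\<in>A. S + T \<in> A \<and> S o\<^sub>L T \<in> A) \<and>
     (\<forall>T\<in>A. adj T \<in> A \<and> (\<forall>c. cscalar c o\<^sub>L T \<in> A))"

definition commutant :: "'a::chilbert_space op set \<Rightarrow> 'a op set" where
  "commutant A = {T \<in> bounded_ops. \<forall>S\<in>A. S o\<^sub>L T = T o\<^sub>L S}"

definition von_neumann_algebra :: "'a::chilbert_space op set \<Rightarrow> bool" where
  "von_neumann_algebra A \<longleftrightarrow> unital_star_algebra A \<and> commutant (commutant A) = A"

definition vN_gen :: "'a::chilbert_space op set \<Rightarrow> 'a op set" where
  "vN_gen A = von_neumann_algebra hull A"

definition vN_join :: "'a::chilbert_space op set \<Rightarrow> 'a op set \<Rightarrow> 'a op set"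
    (infixl \<open>\<or>\<^sub>v\<^sub>N\<close> 65) where
  "A \<or>\<^sub>v\<^sub>N B = vN_gen (A \<union> B)"

text \<open>Normality is ultraweak continuity on \<open>M\<close>, i.e. membership in the predual of \<open>M\<close>.\<close>

definition normal_functional :: "'a::chilbert_space op set \<Rightarrow> ('a op \<Rightarrow> complex) \<Rightarrow> bool" where
  "normal_functional M \<phi> \<longleftrightarrow>
     (\<exists>(\<xi> :: nat \<Rightarrow> 'a) (\<eta> :: nat \<Rightarrow> 'a).
        summable (\<lambda>n. (norm (\<xi> n))\<^sup>2) \<and> summable (\<lambda>n. (norm (\<eta> n))\<^sup>2) \<and>
        (\<forall>T\<in>M. (\<lambda>n. cinner (blinfun_apply T (\<xi> n)) (\<eta> n)) sums \<phi> T))"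

text \<open>Only the values of \<open>\<tau>\<close> on \<open>M\<close> matter.\<close>

definition faithful_normal_tracial_state ::
    "'a::chilbert_space op set \<Rightarrow> ('a op \<Rightarrow> complex) \<Rightarrow> bool" where
  "faithful_normal_tracial_state M \<tau> \<longleftrightarrow>
     (\<forall>S\<in>M. \<forall>T\<in>M. \<tau> (S + T) = \<tau> S + \<tau> T) \<and>
     (\<forall>c. \<forall>T\<in>M. \<tau> (cscalar c o\<^sub>L T) = c * \<tau> T) \<and>
     (\<forall>T\<in>M. \<tau> (adj T o\<^sub>L T) \<in> \<real>\<^sub>\<ge>\<^sub>0) \<and>
     \<tau> id_blinfun = 1 \<and>
     (\<forall>T\<in>M. \<tau> (adj T o\<^sub>L T) = 0 \<longrightarrow> T = 0) \<and>
     (\<forall>S\<in>M. \<forall>T\<in>M. \<tau> (S o\<^sub>L T) = \<tau> (T o\<^sub>L S)) \<and>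
     normal_functional M \<tau>"

definition tracial_vN_algebra :: "'a::chilbert_space op set \<Rightarrow> ('a op \<Rightarrow> complex) \<Rightarrow> bool" where
  "tracial_vN_algebra M \<tau> \<longleftrightarrow> von_neumann_algebra M \<and> faithful_normal_tracial_state M \<tau>"

definition abelian :: "'a::chilbert_space op set \<Rightarrow> bool" where
  "abelian N \<longleftrightarrow> (\<forall>a\<in>N. \<forall>b\<in>N. a o\<^sub>L b = b o\<^sub>L a)"

text \<open>For projections, \<open>q \<le> p\<close> is \<open>p q = q\<close>.\<close>

definition minimal_projection :: "'a::chilbert_space op set \<Rightarrow> 'a op \<Rightarrow> bool" where
  "minimal_projection N p \<longleftrightarrow> p \<in> N \<and> projection p \<and> p \<noteq> 0 \<and>
     (\<forall>q\<in>N. projection q \<and> p o\<^sub>L q = q \<longrightarrow> q = 0 \<or> q = p)"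

definition diffuse :: "'a::chilbert_space op set \<Rightarrow> bool" where
  "diffuse N \<longleftrightarrow> \<not> (\<exists>p. minimal_projection N p)"


section \<open>Freeness and semicircular elements\<close>

text \<open>As usual, a family of subsets is free when the unital \<open>*\<close>-algebras that they generate are:
  alternating products of centred elements are centred.\<close>

definition freely_independent ::
    "('a::chilbert_space op \<Rightarrow> complex) \<Rightarrow> 'j set \<Rightarrow> ('j \<Rightarrow> 'a op set) \<Rightarrow> bool" where
  "freely_independent \<tau> J F \<longleftrightarrow>
     (\<forall>w :: ('j \<times> 'a op) list.
        w \<noteq> [] \<and> distinct_adj (map fst w) \<and>
        (\<forall>(j, a)\<in>set w. j \<in> J \<and> a \<in> unital_star_algebra hull F j \<and> \<tau> a = 0)
        \<longrightarrow> \<tau> (foldr (o\<^sub>L) (map snd w) id_blinfun) = 0)"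

text \<open>A $(0,1)$-semicircular element: the distribution has density $\sqrt{4-r^2}/2\pi$ on
  $[-2,2]$.\<close>

definition semicircular :: "('a::chilbert_space op \<Rightarrow> complex) \<Rightarrow> 'a op \<Rightarrow> bool" where
  "semicircular \<tau> s \<longleftrightarrow> selfadjoint s \<and>
     (\<forall>n. \<tau> (((o\<^sub>L) s ^^ n) id_blinfun) =
        complex_of_real (integral {-2..2} (\<lambda>r::real. r ^ n * (sqrt (4 - r\<^sup>2) / (2 * pi)))))"

definition free_semicircular_family ::
    "('a::chilbert_space op \<Rightarrow> complex) \<Rightarrow> nat \<Rightarrow> (nat \<Rightarrow> 'a op) \<Rightarrow> bool" where
  "free_semicircular_family \<tau> d s \<longleftrightarrow>
     (\<forall>i<d. semicircular \<tau> (s i)) \<and> freely_independent \<tau> {..<d} (\<lambda>i. {s i})"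

definition free_pair ::
    "('a::chilbert_space op \<Rightarrow> complex) \<Rightarrow> 'a op set \<Rightarrow> 'a op set \<Rightarrow> bool" where
  "free_pair \<tau> A B \<longleftrightarrow> freely_independent \<tau> UNIV (\<lambda>b::bool. if b then A else B)"


section \<open>Tracial ultrapowers\<close>

definition free_ultrafilter :: "'i filter \<Rightarrow> bool" where
  "free_ultrafilter \<omega> \<longleftrightarrow> \<omega> \<noteq> bot \<and>
     (\<forall>P. eventually P \<omega> \<or> eventually (\<lambda>i. \<not> P i) \<omega>) \<and>
     (\<forall>i. eventually (\<lambda>j. j \<noteq> i) \<omega>)"

definition linf :: "'a::chilbert_space op set \<Rightarrow> ('i \<Rightarrow> 'a op) set" where
  "linf M = {u. range u \<subseteq> M \<and> bounded (range u)}"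

text \<open>The tracial ultrapower $M^\omega$ is the quotient of \<open>linf M\<close> by the ideal of all \<open>u\<close> with
  $\lim_\omega \|u_i\|_2 = 0$, with trace $\lim_\omega \tau(u_i)$.  It is taken here in its standard
  representation on $L^2(M^\omega)$, which is unique up to unitary equivalence: the type \<open>'k\<close> is
  the Hilbert space $L^2(M^\omega)$, the vector \<open>\<Omega>\<close> is the image of \<open>1\<close> (so that an element \<open>a\<close>
  of $M^\omega$, as a vector, is \<open>a \<Omega>\<close>), and \<open>\<pi> u\<close> is the class of \<open>u\<close>, acting by left
  multiplication.  Thus $M^\omega$ is \<open>\<pi> ` linf M\<close>; for a subalgebra \<open>A\<close> of \<open>M\<close>, the canonical
  copy of $A^\omega$ in $M^\omega$ is \<open>\<pi> ` linf A\<close>.\<close>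

definition tracial_ultrapower ::
    "'i filter \<Rightarrow> 'h::chilbert_space op set \<Rightarrow> ('h op \<Rightarrow> complex) \<Rightarrow>
      (('i \<Rightarrow> 'h op) \<Rightarrow> 'k::chilbert_space op) \<Rightarrow> 'k \<Rightarrow> bool" where
  "tracial_ultrapower \<omega> M \<tau> \<pi> \<Omega> \<longleftrightarrow>
     \<pi> ` linf M \<subseteq> bounded_ops \<and>
     \<pi> (\<lambda>_. id_blinfun) = id_blinfun \<and>
     (\<forall>u\<in>linf M. \<forall>v\<in>linf M.
        \<pi> (\<lambda>i. u i + v i) = \<pi> u + \<pi> v \<and> \<pi> (\<lambda>i. u i o\<^sub>L v i) = \<pi> u o\<^sub>L \<pi> v) \<and>
     (\<forall>c. \<forall>u\<in>linf M. \<pi> (\<lambda>i. cscalar c o\<^sub>L u i) = cscalar c o\<^sub>L \<pi> u) \<and>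
     (\<forall>u\<in>linf M. \<pi> (\<lambda>i. adj (u i)) = adj (\<pi> u)) \<and>
     (\<forall>u\<in>linf M. \<pi> u = 0 \<longleftrightarrow> ((\<lambda>i. \<tau> (adj (u i) o\<^sub>L u i)) \<longlongrightarrow> 0) \<omega>) \<and>
     (\<forall>u\<in>linf M. ((\<lambda>i. \<tau> (u i)) \<longlongrightarrow> cinner (blinfun_apply (\<pi> u) \<Omega>) \<Omega>) \<omega>) \<and>
     closed_cspan ((\<lambda>u. blinfun_apply (\<pi> u) \<Omega>) ` linf M) = UNIV"

definition diagonal :: "(('i \<Rightarrow> 'h op) \<Rightarrow> 'k op) \<Rightarrow> 'h::chilbert_space op \<Rightarrow> 'k::chilbert_space op" where
  "diagonal \<pi> a = \<pi> (\<lambda>_. a)"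


section \<open>Bimodules\<close>

record (overloaded) ('k, 'v) bimodule =
  bspace :: "'v set"
  lact :: "'k op \<Rightarrow> 'v op"
  ract :: "'k op \<Rightarrow> 'v op"

definition subbimodule_space ::
    "'k::chilbert_space op set \<Rightarrow> ('k, 'v::chilbert_space) bimodule \<Rightarrow> 'v set \<Rightarrow> bool" where
  "subbimodule_space N B V \<longleftrightarrow> csubspace V \<and> closed V \<and> V \<subseteq> bspace B \<and>
     (\<forall>a\<in>N. \<forall>v\<in>V. blinfun_apply (lact B a) v \<in> V \<and> blinfun_apply (ract B a) v \<in> V)"

text \<open>Isomorphism of Hilbert bimodules is unitary equivalence.\<close>

definition bimodule_isomorphic ::
    "'k::chilbert_space op set \<Rightarrow> ('k, 'v::chilbert_space) bimodule \<Rightarrow>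
      ('k, 'w::chilbert_space) bimodule \<Rightarrow> bool" where
  "bimodule_isomorphic N B B' \<longleftrightarrow>
     (\<exists>U. U ` bspace B = bspace B' \<and>
        (\<forall>v\<in>bspace B. \<forall>v'\<in>bspace B. U (v + v') = U v + U v') \<and>
        (\<forall>c. \<forall>v\<in>bspace B. U (c *\<^sub>C v) = c *\<^sub>C U v) \<and>
        (\<forall>v\<in>bspace B. norm (U v) = norm v) \<and>
        (\<forall>a\<in>N. \<forall>v\<in>bspace B.
           U (blinfun_apply (lact B a) v) = blinfun_apply (lact B' a) (U v) \<and>
           U (blinfun_apply (ract B a) v) = blinfun_apply (ract B' a) (U v)))"

definition disjoint_bimodules ::
    "'k::chilbert_space op set \<Rightarrow> ('k, 'v::chilbert_space) bimodule \<Rightarrow>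
      ('k, 'w::chilbert_space) bimodule \<Rightarrow> bool" where
  "disjoint_bimodules N B B' \<longleftrightarrow>
     \<not> (\<exists>V W. subbimodule_space N B V \<and> subbimodule_space N B' W \<and> V \<noteq> {0} \<and>
            bimodule_isomorphic N (B\<lparr>bspace := V\<rparr>) (B'\<lparr>bspace := W\<rparr>))"

text \<open>In the remaining definitions \<open>P\<close> is a tracial von Neumann algebra in its standard
  representation with trace vector \<open>\<Omega>\<close>.  Right multiplication by \<open>b\<close> on $L^2(P)$ extends
  $x \mapsto x b$; it is bounded because $\|xb\|_2 \le \|b\|\,\|x\|_2$.\<close>

definition right_mult :: "'k::chilbert_space op set \<Rightarrow> 'k \<Rightarrow> 'k op \<Rightarrow> 'k op" where
  "right_mult P \<Omega> b =
     (THE R. \<forall>x\<in>P. blinfun_apply R (blinfun_apply x \<Omega>) = blinfun_apply (x o\<^sub>L b) \<Omega>)"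

definition L2_space :: "'k::chilbert_space op set \<Rightarrow> 'k \<Rightarrow> 'k set" where
  "L2_space N \<Omega> = closed_cspan ((\<lambda>a. blinfun_apply a \<Omega>) ` N)"

definition L2_separable :: "'k::chilbert_space op set \<Rightarrow> 'k \<Rightarrow> bool" where
  "L2_separable N \<Omega> \<longleftrightarrow> (\<exists>D. countable D \<and> D \<subseteq> L2_space N \<Omega> \<and> L2_space N \<Omega> \<subseteq> closure D)"

text \<open>$L^2(N\mathbf{Y}N)$ for $\mathbf{Y} = (y_i)_{i<d}$ in \<open>P\<close>.\<close>

definition L2_NYN ::
    "'k::chilbert_space op set \<Rightarrow> 'k \<Rightarrow> 'k op set \<Rightarrow> nat \<Rightarrow> (nat \<Rightarrow> 'k op) \<Rightarrow>
      ('k, 'k) bimodule" where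
  "L2_NYN P \<Omega> N d y =
     \<lparr>bspace = closed_cspan {blinfun_apply (a o\<^sub>L y i o\<^sub>L b) \<Omega> | a b i. a \<in> N \<and> b \<in> N \<and> i < d},
      lact = (\<lambda>a. a),
      ract = right_mult P \<Omega>\<rparr>"

text \<open>\<open>tens\<close> turns the closed span of its values on \<open>V \<times> W\<close> into the Hilbert space tensor product
  of \<open>V\<close> and \<open>W\<close>.\<close>

definition hilbert_tensor ::
    "'v::chilbert_space set \<Rightarrow> 'w::chilbert_space set \<Rightarrow>
      ('v \<Rightarrow> 'w \<Rightarrow> 'c::chilbert_space) \<Rightarrow> bool" where
  "hilbert_tensor V W tens \<longleftrightarrow>
     (\<forall>v\<in>V. \<forall>v'\<in>V. \<forall>w\<in>W. tens (v + v') w = tens v w + tens v' w) \<and>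
     (\<forall>v\<in>V. \<forall>w\<in>W. \<forall>w'\<in>W. tens v (w + w') = tens v w + tens v w') \<and>
     (\<forall>c. \<forall>v\<in>V. \<forall>w\<in>W. tens (c *\<^sub>C v) w = c *\<^sub>C tens v w \<and> tens v (c *\<^sub>C w) = c *\<^sub>C tens v w) \<and>
     (\<forall>v\<in>V. \<forall>v'\<in>V. \<forall>w\<in>W. \<forall>w'\<in>W.
        cinner (tens v w) (tens v' w') = cinner v v' * cinner w w')"

text \<open>\<open>C\<close>, with the tensor map \<open>tens\<close>, is the coarse bimodule $L^2(N)\otimes L^2(N)$, with
  $a\cdot(\xi\otimes\eta)\cdot b = (a\xi)\otimes(\eta b)$.  The last two lines determine the bounded
  operators \<open>lact C a\<close> and \<open>ract C b\<close> on \<open>bspace C\<close>.\<close>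

definition coarse_bimodule ::
    "'k::chilbert_space op set \<Rightarrow> 'k \<Rightarrow> 'k op set \<Rightarrow> ('k \<Rightarrow> 'k \<Rightarrow> 'c::chilbert_space) \<Rightarrow>
      ('k, 'c) bimodule \<Rightarrow> bool" where
  "coarse_bimodule P \<Omega> N tens C \<longleftrightarrow>
     hilbert_tensor (L2_space N \<Omega>) (L2_space N \<Omega>) tens \<and>
     bspace C = closed_cspan {tens \<xi> \<eta> | \<xi> \<eta>. \<xi> \<in> L2_space N \<Omega> \<and> \<eta> \<in> L2_space N \<Omega>} \<and>
     (\<forall>a\<in>N. \<forall>\<xi>\<in>L2_space N \<Omega>. \<forall>\<eta>\<in>L2_space N \<Omega>.
        blinfun_apply (lact C a) (tens \<xi> \<eta>) = tens (blinfun_apply a \<xi>) \<eta> \<and>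
        blinfun_apply (ract C a) (tens \<xi> \<eta>) = tens \<xi> (blinfun_apply (right_mult P \<Omega> a) \<eta>))"

end

theory Submission
  imports Defs
begin

text \<open>Since \<open>s\<^sub>i\<close> is free from $M^\omega$, the closed span of $N s_i N$ is, up to scaling, the coarse bimodule and is
  orthogonal to \<open>x\<^sub>i\<close>.  Let \<open>E\<close> be the projection onto the closed span of $N(x_i + \sqrt t s_i)N$, and
  let \<open>P\<^sub>1\<close>, \<open>P\<^sub>2\<close> be the projections onto $L^2(N\mathbf{X}N)$ and the span of $N s_i N$.  The intertwiner
  \<open>P\<^sub>2 E P\<^sub>1\<close> vanishes by disjointness (after a polar decomposition), and this forces \<open>E x\<^sub>i = x\<^sub>i\<close>.  So
  \<open>x\<^sub>i\<close> is a limit in 2-norm of elements of $W^*(N, \mathbf{X} + \sqrt t\,\mathbf{S})$, and by the trace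
  property it belongs to that algebra.\<close>

section \<open>Orthogonal projections and adjoints\<close>

text \<open>That \<open>P2 E P1 = 0\<close> forces \<open>E X = X\<close> is elementary:
  \<open>E\<close> fixes \<open>X + r S\<close>, so \<open>X - E X = r (E S - S)\<close>, and
  pairing with \<open>X\<close> leaves \<open>r\<close> times the inner product of \<open>S\<close>
  with \<open>E X\<close>, which sees only the component of \<open>E X\<close> along the bimodule of
  \<open>S\<close>. Disjointness, however, excludes only unitarily equivalent sub-bimodules, while a
  nonzero intertwiner \<open>T\<close> need be neither injective nor isometric; hence the modulus of
  \<open>T\<close> and an operator square root.

  Operators, spans and projections are handled over the reals; a complex scalar is one more operator
  with which projections and isometries commute.

  Freeness from the ultrapower enters through the mixed moment \<tau>(q s p s) = \<tau>(s s)
  \<tau>(p) \<tau>(q), which survives limits along \<omega> because it is a polynomial identity in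
  traces. Comparison with all of \<open>Mt\<close>, not just its generators, asks that the diagonal
  embedding respect weak closures; normality of \<tau>, amplification and von Neumann's density
  theorem give this.\<close>

lemma orthogonal_decomposition:
  fixes V :: "'a::{real_inner,complete_space} set"
  assumes V: "subspace V" "closed V"
  shows "\<exists>y\<in>V. \<forall>v\<in>V. inner (x - y) v = 0"
proof -
  define D where "D = (\<lambda>v. (norm (x - v))\<^sup>2) ` V"
  define d where "d = Inf D"
  have "0 \<in> V" using V(1) by (rule subspace_0)
  then have D: "D \<noteq> {}" "bdd_below D" by (auto simp: D_def intro!: bdd_belowI2[where m=0])
  have lower: "d \<le> (norm (x - v))\<^sup>2" if "v \<in> V" for v
    unfolding d_def using D that by (intro cInf_lower) (auto simp: D_def)
  have "\<exists>v\<in>V. (norm (x - v))\<^sup>2 < d + inverse (real (Suc n))" for n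
    using cInf_lessD[OF D(1), of "d + inverse (real (Suc n))"] by (auto simp: d_def D_def)
  then obtain v where v: "\<And>n. v n \<in> V" "\<And>n. (norm (x - v n))\<^sup>2 < d + inverse (real (Suc n))"
    by metis
  \<comment> \<open>Parallelogram law: the midpoint lies in \<open>V\<close>, so its squared
    distance to \<open>x\<close> is at least \<open>d\<close>, which makes the minimising sequence
    Cauchy.\<close>
  have par: "(norm (v m - v n))\<^sup>2 \<le> 2 * inverse (real (Suc m)) + 2 * inverse (real (Suc n))" for m n
  proof -
    have mid: "(1/2) *\<^sub>R (v m + v n) \<in> V" using v(1) V(1) by (auto intro: subspace_scale subspace_add)
    have "(norm (v m - v n))\<^sup>2 = 2 * (norm (x - v m))\<^sup>2 + 2 * (norm (x - v n))\<^sup>2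
        - 4 * (norm (x - (1/2) *\<^sub>R (v m + v n)))\<^sup>2"
      by (simp add: power2_norm_eq_inner algebra_simps inner_commute)
    then show ?thesis using lower[OF mid] v(2)[of m] v(2)[of n] by linarith
  qed
  have "Cauchy v"
  proof (rule metric_CauchyI)
    fix e :: real assume "e > 0"
    then have "e\<^sup>2 / 4 > 0" by simp
    then obtain M where M: "inverse (real (Suc M)) < e\<^sup>2 / 4" using reals_Archimedean by blast
    have "dist (v m) (v n) < e" if "m \<ge> M" "n \<ge> M" for m n
    proof -
      have "inverse (real (Suc m)) \<le> inverse (real (Suc M))" "inverse (real (Suc n)) \<le> inverse (real (Suc M))"
        using that by (auto intro!: le_imp_inverse_le)
      then have "(norm (v m - v n))\<^sup>2 < e\<^sup>2" using par[of m n] M by linarith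
      then show ?thesis using \<open>e > 0\<close> by (simp add: dist_norm power2_less_imp_less)
    qed
    then show "\<exists>M. \<forall>m\<ge>M. \<forall>n\<ge>M. dist (v m) (v n) < e" by blast
  qed
  then obtain y where y: "v \<longlonglongrightarrow> y" using Cauchy_convergent_iff convergent_def by blast
  have yV: "y \<in> V" using closed_sequentially[OF V(2)] v(1) y by blast
  have "(\<lambda>n. d + inverse (real (Suc n))) \<longlonglongrightarrow> d + 0"
    by (intro tendsto_intros LIMSEQ_inverse_real_of_nat)
  moreover have "(\<lambda>n. (norm (x - v n))\<^sup>2) \<longlonglongrightarrow> (norm (x - y))\<^sup>2"
    by (intro tendsto_intros y)
  ultimately have le: "(norm (x - y))\<^sup>2 \<le> d"
    using LIMSEQ_le v(2) by (metis (no_types, lifting) add.right_neutral less_imp_le)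
  have "inner (x - y) w = 0" if w: "w \<in> V" for w
  proof (cases "w = 0")
    case False
    \<comment> \<open>The minimiser over \<open>r\<close> of the squared distance from
      \<open>x\<close> to \<open>y + r w\<close>. It would lower that distance by
      \<open>(inner (x - y) w)^2 / inner w w\<close>, so minimality of \<open>y\<close> makes this
      term vanish.\<close>
    define r where "r = inner (x - y) w / inner w w"
    have ww: "inner w w > 0" using False by simp
    have "y + r *\<^sub>R w \<in> V" using V(1) yV w by (auto intro: subspace_scale subspace_add)
    then have "(norm (x - y))\<^sup>2 \<le> (norm (x - (y + r *\<^sub>R w)))\<^sup>2" using lower le order_trans by blast
    also have "\<dots> = (norm (x - y))\<^sup>2 - 2 * r * inner (x - y) w + r\<^sup>2 * inner w w"
      unfolding power2_norm_eq_inner by (simp add: algebra_simps inner_commute power2_eq_square)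
    also have "\<dots> = (norm (x - y))\<^sup>2 - (inner (x - y) w)\<^sup>2 / inner w w"
      using ww by (simp add: r_def power2_eq_square field_simps)
    finally have "(inner (x - y) w)\<^sup>2 / inner w w \<le> 0" by simp
    then show ?thesis using ww by (simp add: divide_le_0_iff)
  qed simp
  then show ?thesis using yV by blast
qed

text \<open>A bounded operator, so that it composes with elements of the algebras. Only the real
  inner product enters; complex linearity is recovered from the invariance of \<open>V\<close> under
  scalars.\<close>

definition orth_proj :: "'a::{real_inner,complete_space} set \<Rightarrow> 'a \<Rightarrow>\<^sub>L 'a" where
  "orth_proj V = Blinfun (\<lambda>x. THE y. y \<in> V \<and> (\<forall>v\<in>V. inner (x - y) v = 0))"

context
  fixes V :: "'a::{real_inner,complete_space} set"
  assumes V: "subspace V" "closed V"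
begin

lemma orth_proj_ex1: "\<exists>!y. y \<in> V \<and> (\<forall>v\<in>V. inner (x - y) v = 0)"
proof -
  have "y = z" if "y \<in> V" "\<forall>v\<in>V. inner (x - y) v = 0" "z \<in> V" "\<forall>v\<in>V. inner (x - z) v = 0" for y z
  proof -
    have "z - y \<in> V" using that V by (simp add: subspace_diff)
    then have "inner (x - y) (z - y) = 0" "inner (x - z) (z - y) = 0" using that by blast+
    then have "inner (z - y) (z - y) = 0" by (simp add: inner_diff_left)
    then show ?thesis by simp
  qed
  moreover obtain y where "y \<in> V" "\<forall>v\<in>V. inner (x - y) v = 0"
    using orthogonal_decomposition[OF V] by blast
  ultimately show ?thesis by (intro ex1I[of _ y]) simp_all
qed

lemma
  shows orth_proj_in: "orth_proj V x \<in> V"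
    and orth_proj_orth: "v \<in> V \<Longrightarrow> inner (x - orth_proj V x) v = 0"
    and orth_proj_unique: "y \<in> V \<Longrightarrow> (\<And>v. v \<in> V \<Longrightarrow> inner (x - y) v = 0) \<Longrightarrow> orth_proj V x = y"
proof -
  define f where "f x = (THE y. y \<in> V \<and> (\<forall>v\<in>V. inner (x - y) v = 0))" for x
  have f: "f x \<in> V" "\<forall>v\<in>V. inner (x - f x) v = 0" for x
    unfolding f_def using theI'[OF orth_proj_ex1[of x]] by auto
  have fu: "f x = y" if "y \<in> V" "\<And>v. v \<in> V \<Longrightarrow> inner (x - y) v = 0" for x y
    unfolding f_def using that by (intro the1_equality orth_proj_ex1) auto
  have "bounded_linear f"
  proof (rule bounded_linear_intro[where K = 1])
    show "f (x + y) = f x + f y" for x y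
      using f[of x] f[of y] V by (intro fu) (auto simp: subspace_add inner_diff_left inner_add_left)
    show "f (r *\<^sub>R x) = r *\<^sub>R f x" for r x
      using f[of x] V by (intro fu) (auto simp: subspace_scale inner_diff_left right_diff_distrib[symmetric])
    show "norm (f x) \<le> norm x * 1" for x
    proof -
      have "inner (x - f x) (f x) = 0" using f by blast
      then have "(norm x)\<^sup>2 = (norm (f x))\<^sup>2 + (norm (x - f x))\<^sup>2"
        by (simp add: power2_norm_eq_inner algebra_simps inner_commute)
      then have "(norm (f x))\<^sup>2 \<le> (norm x)\<^sup>2" by simp
      then show ?thesis using power2_le_imp_le[of "norm (f x)" "norm x"] by simp
    qed
  qed
  then have "blinfun_apply (orth_proj V) = f"
    unfolding orth_proj_def f_def by (rule bounded_linear_Blinfun_apply)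
  then show "orth_proj V x \<in> V" "v \<in> V \<Longrightarrow> inner (x - orth_proj V x) v = 0"
    "y \<in> V \<Longrightarrow> (\<And>v. v \<in> V \<Longrightarrow> inner (x - y) v = 0) \<Longrightarrow> orth_proj V x = y"
    using f fu by auto
qed

lemma orth_proj_fixes: "v \<in> V \<Longrightarrow> orth_proj V v = v"
  by (rule orth_proj_unique) auto

lemma orth_proj_symmetric: "inner (orth_proj V x) y = inner x (orth_proj V y)"
  using orth_proj_orth[OF orth_proj_in, of x y] orth_proj_orth[OF orth_proj_in, of y x]
  unfolding inner_diff_left by (metis eq_iff_diff_eq_0 inner_commute)

lemma norm_orth_proj_le: "norm (orth_proj V x) \<le> norm x"
proof -
  have "(norm (orth_proj V x))\<^sup>2 = inner x (orth_proj V x)"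
    using orth_proj_orth[OF orth_proj_in, of x x] by (simp add: inner_diff_left power2_norm_eq_inner)
  also have "\<dots> \<le> norm x * norm (orth_proj V x)" by (rule norm_cauchy_schwarz)
  finally show ?thesis
    by (cases "norm (orth_proj V x) = 0") (auto simp: power2_eq_square)
qed

text \<open>A subspace invariant under an operator and its adjoint reduces it. \<open>A\<close> and
  \<open>B\<close> are plain functions so that amplified operators and complex scalars, with the
  conjugate scalar as adjoint, are covered too.\<close>

lemma orth_proj_commute:
  assumes adj: "\<And>v w. inner (A v) w = inner v (B w)" 
    and inv: "\<And>v. v \<in> V \<Longrightarrow> A v \<in> V" "\<And>v. v \<in> V \<Longrightarrow> B v \<in> V"
    and diff: "\<And>v w. A (v - w) = A v - A w"
  shows "orth_proj V (A x) = A (orth_proj V x)"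
proof (rule orth_proj_unique)
  show "A (orth_proj V x) \<in> V" by (intro inv orth_proj_in)
  show "inner (A x - A (orth_proj V x)) v = 0" if "v \<in> V" for v
    using orth_proj_orth[OF inv(2)[OF that]] by (simp add: diff[symmetric] adj)
qed

end

text \<open>In the application \<open>K\<close> is the closed span of \<open>N(x + r s)N\<close> and
  \<open>H\<close> that of \<open>N s N\<close>; the last assumption is what disjointness
  supplies.\<close>

lemma mem_if_orth_proj_orthogonal:
  fixes X S :: "'a::{real_inner,complete_space}"
  assumes K: "subspace K" "closed K" and H: "subspace H" "closed H"
    and "S \<in> H" "inner X S = 0" "X + r *\<^sub>R S \<in> K" and 0: "orth_proj H (orth_proj K X) = 0"
  shows "X \<in> K"
proof -
  define E where "E = blinfun_apply (orth_proj K)"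
  have "E X + r *\<^sub>R E S = X + r *\<^sub>R S"
    using orth_proj_fixes[OF K \<open>X + r *\<^sub>R S \<in> K\<close>] by (simp add: E_def blinfun.add_right blinfun.scaleR_right)
  then have z: "X - E X = r *\<^sub>R (E S - S)" by (simp add: algebra_simps)
  have "inner (X - E X) (X - E X) = inner (X - E X) X"
    using orth_proj_orth[OF K orth_proj_in[OF K], of X X] by (simp add: E_def inner_diff_right)
  also have "\<dots> = r * (inner (E S) X - inner S X)"
    by (simp only: z inner_diff_left inner_scaleR_left)
  also have "inner (E S) X - inner S X = inner S (E X)"
    using assms(6) by (simp only: E_def orth_proj_symmetric[OF K] inner_commute[of S X] diff_zero)
  also have "inner S (E X) = inner S (orth_proj H (E X))"
    using orth_proj_orth[OF H \<open>S \<in> H\<close>, of "E X"] by (simp add: inner_diff_left inner_diff_right inner_commute)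
  finally have "X = E X" using 0 by (simp add: E_def)
  then show ?thesis unfolding E_def by (metis K orth_proj_in)
qed

lemma riesz_representation:
  fixes f :: "'a::{real_inner,complete_space} \<Rightarrow> real"
  assumes "bounded_linear f"
  shows "\<exists>w. \<forall>v. f v = inner v w"
proof (cases "\<forall>v. f v = 0")
  case False
  interpret f: bounded_linear f by fact
  define V where "V = {v. f v = 0}"
  have V: "subspace V" "closed V"
    unfolding V_def by (auto simp: subspace_def f.add f.scaleR f.zero
        intro!: closed_Collect_eq continuous_intros f.continuous_on)
  obtain u where u: "f u \<noteq> 0" using False by blast
  \<comment> \<open>A vector orthogonal to the kernel on which \<open>f\<close> does not vanish; it
    spans the complement because the kernel has codimension one.\<close>
  define w where "w = u - orth_proj V u"
  have fw: "f w = f u" using orth_proj_in[OF V, of u] by (simp add: w_def f.diff V_def)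
  have wo: "inner w v = 0" if "f v = 0" for v
    unfolding w_def using that by (intro orth_proj_orth[OF V]) (simp add: V_def)
  have ww: "inner w w \<noteq> 0" using fw u by (auto simp: f.zero)
  have "f v = inner v ((f w / inner w w) *\<^sub>R w)" for v
  proof -
    have "f (v - (f v / f w) *\<^sub>R w) = 0" using fw u by (simp add: f.diff f.scaleR)
    from wo[OF this] have "inner w v = (f v / f w) * inner w w" by (simp add: inner_diff_right)
    then show ?thesis using fw u ww by (simp add: inner_commute field_simps)
  qed
  then show ?thesis by blast
qed (auto intro!: exI[of _ 0])

text \<open>The adjoint sends \<open>w\<close> to the Riesz vector of the functional
  \<open>inner (A v) w\<close> of \<open>v\<close>. The norm bound is recorded because
  \<open>linf\<close> must be stable under adjoints.\<close>

lemma real_adjoint_exists: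
  fixes A :: "'a::{real_inner,complete_space} \<Rightarrow>\<^sub>L 'b::real_inner"
  shows "\<exists>B :: 'b \<Rightarrow>\<^sub>L 'a. (\<forall>v w. inner (blinfun_apply A v) w = inner v (blinfun_apply B w)) \<and> norm B \<le> norm A"
proof -
  have "bounded_linear (\<lambda>v. inner (A v) w)" for w
    by (intro bounded_linear_inner_left_comp blinfun.bounded_linear_right)
  then have "\<forall>w. \<exists>u. \<forall>v. inner (A v) w = inner v u"
    by (intro allI riesz_representation)
  then obtain g where g: "\<And>v w. inner (A v) w = inner v (g w)" by metis
  have add: "g (v + w) = g v + g w" for v w
    by (intro vector_eq_ldot[THEN iffD1]) (auto simp: g[symmetric] inner_add_right)
  have sc: "g (r *\<^sub>R v) = r *\<^sub>R g v" for r v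
    by (intro vector_eq_ldot[THEN iffD1]) (auto simp: g[symmetric])
  have b: "norm (g w) \<le> norm w * norm A" for w
  proof -
    have "norm (g w) * norm (g w) = inner (A (g w)) w" 
      by (simp only: g dot_square_norm power2_eq_square)
    also have "\<dots> \<le> norm (A (g w)) * norm w" by (rule norm_cauchy_schwarz)
    also have "\<dots> \<le> norm A * norm (g w) * norm w" by (intro mult_right_mono norm_blinfun) auto
    finally have "norm (g w) * norm (g w) \<le> (norm w * norm A) * norm (g w)" by (simp add: mult_ac)
    then show ?thesis by (cases "g w = 0") simp_all
  qed
  have bl: "bounded_linear g" using add sc b by (rule bounded_linear_intro)
  have app: "blinfun_apply (Blinfun g) = g" by (rule bounded_linear_Blinfun_apply[OF bl])
  have "norm (Blinfun g) \<le> norm A"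
    proof (rule norm_blinfun_bound)
    show "norm (Blinfun g w) \<le> norm A * norm w" for w using b[of w] by (simp only: app mult.commute)
  qed simp
  moreover have "inner (A v) w = inner v (Blinfun g w)" for v w by (simp only: g app)
  ultimately show ?thesis by blast
qed

section \<open>The complex structure\<close>

text \<open>Multiplication by the imaginary unit turns imaginary parts into real parts, so complex
  identities can be checked on the real inner product.\<close>

lemma cinner_eqI_real:
  assumes "\<And>c. Re (cinner (c *\<^sub>C v) w) = Re (cinner (c *\<^sub>C v') w')"
  shows "cinner v w = cinner v' w'"
proof (rule complex_eqI)
  show "Re (cinner v w) = Re (cinner v' w')"
    using assms[of 1] by (simp add: cinner_scaleC_left)
  show "Im (cinner v w) = Im (cinner v' w')"
    using assms[of "\<i>"] by (simp add: cinner_scaleC_left)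
qed

lemma cinner_scaleC_right: "cinner x (c *\<^sub>C y) = cnj c * cinner x y"
  by (subst (1 2) cinner_commute) (simp add: cinner_scaleC_left)

lemma scaleC_one [simp]: "1 *\<^sub>C x = x" for x :: "'a::chilbert_space"
  using scaleR_scaleC[of 1 x] by simp

lemma scaleC_diff_right: "c *\<^sub>C (x - y) = c *\<^sub>C x - c *\<^sub>C y" for x :: "'a::chilbert_space"
  using scaleC_add_right[of c "x - y" y] by (simp add: algebra_simps)

lemma inner_scaleC: "inner (c *\<^sub>C v) w = inner v (cnj c *\<^sub>C w)" for v :: "'a::chilbert_space"
  by (simp add: inner_eq_Re_cinner cinner_scaleC_left cinner_scaleC_right)

section \<open>Closed complex subspaces and real spans\<close>

lemma csubspaceD: "csubspace V \<Longrightarrow> subspace V"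
  by (simp add: csubspace_def)

lemma csubspace_scaleC: "csubspace V \<Longrightarrow> v \<in> V \<Longrightarrow> c *\<^sub>C v \<in> V"
  by (simp add: csubspace_def)

lemma subspace_closure:
  fixes V :: "'a::real_normed_vector set"
  assumes V: "subspace V" shows "subspace (closure V)"
  unfolding subspace_def
proof safe
  show "0 \<in> closure V" using subspace_0[OF V] closure_subset by blast
next
  fix x y assume "x \<in> closure V" "y \<in> closure V"
  then obtain f g where "\<forall>n. f n \<in> V" "f \<longlonglongrightarrow> x" "\<forall>n. g n \<in> V" "g \<longlonglongrightarrow> y"
    unfolding closure_sequential by blast
  then show "x + y \<in> closure V"
    unfolding closure_sequential using V
    by (intro exI[of _ "\<lambda>n. f n + g n"]) (auto intro: tendsto_add subspace_add)
next
  fix x :: 'a and r :: real assume "x \<in> closure V"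
  then obtain f where "\<forall>n. f n \<in> V" "f \<longlonglongrightarrow> x"
    unfolding closure_sequential by blast
  then show "r *\<^sub>R x \<in> closure V"
    unfolding closure_sequential using V
    by (intro exI[of _ "\<lambda>n. r *\<^sub>R f n"]) (auto intro: tendsto_intros subspace_scale)
qed

lemma csubspace_closure:
  assumes "csubspace V" shows "csubspace (closure V)"
proof -
  have "c *\<^sub>C v \<in> closure V" if "v \<in> closure V" for c v
  proof -
    have "(scaleC c) ` closure V \<subseteq> closure ((scaleC c) ` V)"
      by (rule closure_bounded_linear_image_subset[OF bounded_linear_scaleC])
    also have "\<dots> \<subseteq> closure V"
      using assms by (intro closure_mono) (auto simp: csubspace_def)
    finally show ?thesis using that by blast
  qed
  then show ?thesis using assms by (auto simp: csubspace_def subspace_closure)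
qed

lemma csubspace_span:
  assumes "\<And>c v. v \<in> A \<Longrightarrow> c *\<^sub>C v \<in> A" shows "csubspace (span A)"
proof -
  have "c *\<^sub>C v \<in> span A" if "v \<in> span A" for c v
  proof -
    interpret bounded_linear "scaleC c :: 'a \<Rightarrow> 'a" by (rule bounded_linear_scaleC)
    have "c *\<^sub>C v \<in> scaleC c ` span A" using that by blast
    also have "\<dots> = span (scaleC c ` A)" by (rule linear_span_image[OF linear_axioms, symmetric])
    also have "\<dots> \<subseteq> span A" using assms by (intro span_mono) auto
    finally show ?thesis .
  qed
  then show ?thesis by (simp add: csubspace_def)
qed

lemma
  shows csubspace_closed_cspan: "csubspace (closed_cspan A)"
    and closed_closed_cspan: "closed (closed_cspan A)"
proof -
  have "csubspace (closed_cspan A) \<and> closed (closed_cspan A)"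
    unfolding closed_cspan_def
    by (rule hull_in) (auto simp: csubspace_def subspace_def)
  then show "csubspace (closed_cspan A)" "closed (closed_cspan A)" by auto
qed

lemma closed_cspan_superset: "A \<subseteq> closed_cspan A"
  unfolding closed_cspan_def by (rule hull_subset)

lemma closed_cspan_minimal: "A \<subseteq> V \<Longrightarrow> csubspace V \<Longrightarrow> closed V \<Longrightarrow> closed_cspan A \<subseteq> V"
  unfolding closed_cspan_def by (rule hull_minimal) auto

text \<open>A generating set closed under complex scalars has a complex real-span. This turns
  complex closed spans into closures of real spans, to which the facts on images under bounded
  linear maps apply.\<close>

lemma closed_cspan_eq_closure_span:
  assumes "\<And>c v. v \<in> A \<Longrightarrow> c *\<^sub>C v \<in> A"
  shows "closed_cspan A = closure (span A)"
proof
  show "closed_cspan A \<subseteq> closure (span A)"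
    using span_superset[of A] closure_subset[of "span A"]
    by (intro closed_cspan_minimal csubspace_closure csubspace_span assms) auto
  show "closure (span A) \<subseteq> closed_cspan A"
    by (intro closure_minimal span_minimal closed_cspan_superset closed_closed_cspan
        csubspaceD[OF csubspace_closed_cspan])
qed

lemma closed_cspan_csubspace: "csubspace V \<Longrightarrow> closed_cspan V = closure V"
  by (subst closed_cspan_eq_closure_span)
     (auto simp: csubspace_scaleC dest!: csubspaceD simp del: span_eq_iff simp add: span_eq_iff[THEN iffD2])

section \<open>Complex-linear operators and their adjoints\<close>

lemma cscalar_apply [simp]: "blinfun_apply (cscalar c) v = c *\<^sub>C v"
  by transfer simp

lemma bounded_opsD: "T \<in> bounded_ops \<Longrightarrow> blinfun_apply T (c *\<^sub>C v) = c *\<^sub>C blinfun_apply T v"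
  by (simp add: bounded_ops_def)

lemma bounded_ops_cinner_adjoint:
  fixes S T :: "'a::chilbert_space op"
  assumes "T \<in> bounded_ops" "\<And>v w. inner (T v) w = inner v (S w)"
  shows "cinner (T v) w = cinner v (S w)"
  using assms by (intro cinner_eqI_real) (metis bounded_opsD inner_eq_Re_cinner)

text \<open>Justifies the definite description in \<open>adj\<close>: the real adjoint of a
  complex-linear operator also satisfies the complex identity, and nondegeneracy of the real inner
  product makes it unique.\<close>

lemma adj_cinner_norm:
  fixes T :: "'a::chilbert_space op"
  assumes "T \<in> bounded_ops"
  shows "(\<forall>v w. cinner (T v) w = cinner v (adj T w)) \<and> norm (adj T) \<le> norm T"
proof -
  obtain S :: "'a op" where S: "\<And>v w. inner (T v) w = inner v (S w)" "norm S \<le> norm T"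
    using real_adjoint_exists[of T] by blast
  have S': "\<forall>v w. cinner (T v) w = cinner v (S w)"
    using bounded_ops_cinner_adjoint[OF assms S(1)] by blast
  have "adj T = S"
    unfolding adj_def
  proof (rule the_equality)
    show "\<forall>v w. cinner (T v) w = cinner v (S w)" by (rule S')
  next
    fix R assume R: "\<forall>v w. cinner (T v) w = cinner v (blinfun_apply R w)"
    have "inner v (R w) = inner v (S w)" for v w
      using R S(1) by (metis inner_eq_Re_cinner)
    then show "R = S" by (intro blinfun_eqI vector_eq_ldot[THEN iffD1]) auto
  qed
  then show ?thesis using S' S(2) by blast
qed

lemma cinner_adj: "T \<in> bounded_ops \<Longrightarrow> cinner (blinfun_apply T v) w = cinner v (blinfun_apply (adj T) w)"
  using adj_cinner_norm by blast

lemma norm_adj_le: "T \<in> bounded_ops \<Longrightarrow> norm (adj T) \<le> norm T"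
  using adj_cinner_norm by blast

lemma inner_adj: "T \<in> bounded_ops \<Longrightarrow> inner (blinfun_apply T v) w = inner v (blinfun_apply (adj T) w)"
  by (simp add: inner_eq_Re_cinner cinner_adj)

lemma adj_eqI:
  assumes "T \<in> bounded_ops" "\<And>v w. inner (blinfun_apply T v) w = inner v (blinfun_apply S w)"
  shows "adj T = S"
  using assms inner_adj[OF assms(1)] by (intro blinfun_eqI vector_eq_ldot[THEN iffD1]) metis

lemma bounded_ops_id [simp]: "id_blinfun \<in> bounded_ops"
  and bounded_ops_add: "S \<in> bounded_ops \<Longrightarrow> T \<in> bounded_ops \<Longrightarrow> S + T \<in> bounded_ops"
  and bounded_ops_compose: "S \<in> bounded_ops \<Longrightarrow> T \<in> bounded_ops \<Longrightarrow> S o\<^sub>L T \<in> bounded_ops"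
  and bounded_ops_cscalar [simp]: "cscalar c \<in> bounded_ops"
  by (auto simp: bounded_ops_def blinfun.add_left scaleC_add_right scaleC_scaleC mult.commute)

lemma bounded_ops_adj: "T \<in> bounded_ops \<Longrightarrow> adj T \<in> bounded_ops"
  unfolding bounded_ops_def
proof safe
  fix c v assume T: "\<forall>c v. blinfun_apply T (c *\<^sub>C v) = c *\<^sub>C blinfun_apply T v"
  then have T': "T \<in> bounded_ops" by (simp add: bounded_ops_def)
  show "blinfun_apply (adj T) (c *\<^sub>C v) = c *\<^sub>C blinfun_apply (adj T) v"
    by (intro vector_eq_ldot[THEN iffD1])
       (simp add: inner_adj[OF T', symmetric] inner_scaleC[of "cnj c", simplified, symmetric] T)
qed

lemma adj_adj: "T \<in> bounded_ops \<Longrightarrow> adj (adj T) = T"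
  by (intro adj_eqI bounded_ops_adj, assumption) (metis inner_adj inner_commute)

lemma adj_compose: "S \<in> bounded_ops \<Longrightarrow> T \<in> bounded_ops \<Longrightarrow> adj (S o\<^sub>L T) = adj T o\<^sub>L adj S"
  by (intro adj_eqI bounded_ops_compose) (simp_all add: inner_adj)

lemma adj_add: "S \<in> bounded_ops \<Longrightarrow> T \<in> bounded_ops \<Longrightarrow> adj (S + T) = adj S + adj T"
  by (intro adj_eqI bounded_ops_add)
     (simp_all add: inner_adj blinfun.add_left inner_add_left inner_add_right)

lemma adj_id [simp]: "adj id_blinfun = id_blinfun"
  by (intro adj_eqI) simp_all

section \<open>Square roots, isometries and extensions\<close>

text \<open>Makes the space of bounded operators complete, as the convergence of the square-root
  iteration requires.\<close>

instance chilbert_space \<subseteq> banach ..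

lemma blinfun_compose_assoc: "(A o\<^sub>L B) o\<^sub>L C = A o\<^sub>L (B o\<^sub>L C)"
  by (rule blinfun_eqI) simp

lemma id_blinfun_compose [simp]: "id_blinfun o\<^sub>L A = A" "A o\<^sub>L id_blinfun = A"
  by (rule blinfun_eqI, simp)+

lemmas blinfun_compose_algebra =
  bounded_bilinear.add_left[OF bounded_bilinear_blinfun_compose]
  bounded_bilinear.add_right[OF bounded_bilinear_blinfun_compose]
  bounded_bilinear.diff_left[OF bounded_bilinear_blinfun_compose]
  bounded_bilinear.diff_right[OF bounded_bilinear_blinfun_compose]
  bounded_bilinear.scaleR_left[OF bounded_bilinear_blinfun_compose]
  bounded_bilinear.scaleR_right[OF bounded_bilinear_blinfun_compose]

text \<open>The root of \<open>1 - B\<close> is \<open>1 - Y\<close> with \<open>Y = (B + Y\<^sup>2) / 2\<close>; the increments of the operator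
  iteration are dominated by those of the scalar iteration for \<open>B = 1\<close>.\<close>

lemma operator_sqrt_exists:
  fixes A :: "'a::chilbert_space op"
  assumes norm: "norm (id_blinfun - A) \<le> 1"
    and sym: "\<And>v w. inner (A v) w = inner v (A w)"
  obtains S :: "'a op" where "S o\<^sub>L S = A" "\<And>v w. inner (S v) w = inner v (S w)"
    "\<And>D. D o\<^sub>L A = A o\<^sub>L D \<Longrightarrow> D o\<^sub>L S = S o\<^sub>L D"
proof -
  define B where "B = id_blinfun - A"
  define Y where "Y = rec_nat 0 (\<lambda>_ Z. (1/2) *\<^sub>R (B + (Z o\<^sub>L Z)))"
  define y :: "nat \<Rightarrow> real" where "y = rec_nat 0 (\<lambda>_ z. (1 + z * z) / 2)"
  have Y0: "Y 0 = 0" and YS: "Y (Suc n) = (1/2) *\<^sub>R (B + (Y n o\<^sub>L Y n))" for n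
    by (simp_all add: Y_def)
  have y0: "y 0 = 0" and yS: "y (Suc n) = (1 + y n * y n) / 2" for n
    by (simp_all add: y_def)
  have y01: "0 \<le> y n \<and> y n \<le> 1" for n
  proof (induction n)
    case (Suc n)
    then have "y n * y n \<le> 1" "0 \<le> y n * y n" by (simp_all add: mult_le_one)
    then show ?case by (simp add: yS)
  qed (simp add: y0)
  have Yy: "norm (Y n) \<le> y n" for n
  proof (induction n)
    case (Suc n)
    have "norm (Y n o\<^sub>L Y n) \<le> y n * y n"
      using Suc y01 by (intro order_trans[OF norm_blinfun_compose] mult_mono) auto
    then have "norm (B + (Y n o\<^sub>L Y n)) \<le> 1 + y n * y n"
      using norm by (intro order_trans[OF norm_triangle_ineq] add_mono) (auto simp: B_def)
    then show ?case by (simp add: YS yS)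
  qed (simp add: Y0 y0)
  have step: "norm (Y (Suc n) - Y n) \<le> y (Suc n) - y n" for n
  proof (induction n)
    case 0
    then show ?case using norm by (simp add: YS Y0 yS y0 B_def)
  next
    case (Suc n)
    define P Q where "P = Y (Suc n) - Y n" and "Q = Y (Suc n) + Y n"
    have "Y (Suc (Suc n)) - Y (Suc n) =
        (1/2) *\<^sub>R ((Y (Suc n) o\<^sub>L Y (Suc n)) - (Y n o\<^sub>L Y n))"
      unfolding YS[of "Suc n"] by (subst (2) YS) (simp add: scaleR_diff_right[symmetric])
    \<comment> \<open>A symmetrised difference of squares,
      \<open>P Q + Q P = 2 (Y (Suc n) Y (Suc n) - Y n Y n)\<close>, which holds without knowing that
      successive iterates commute.\<close>
    also have "\<dots> = (1/4) *\<^sub>R ((P o\<^sub>L Q) + (Q o\<^sub>L P))"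
      unfolding P_def Q_def blinfun_compose_algebra by (simp add: algebra_simps flip: scaleR_2)
    finally have eq: "Y (Suc (Suc n)) - Y (Suc n) = (1/4) *\<^sub>R ((P o\<^sub>L Q) + (Q o\<^sub>L P))" .
    have Q: "norm Q \<le> y (Suc n) + y n"
      unfolding Q_def by (intro order_trans[OF norm_triangle_ineq] add_mono Yy)
    have "norm (P o\<^sub>L Q) \<le> (y (Suc n) - y n) * (y (Suc n) + y n)"
      using Suc Q norm_ge_zero[of P] norm_ge_zero[of Q] unfolding P_def
      by (intro order_trans[OF norm_blinfun_compose] mult_mono) linarith+
    moreover have "norm (Q o\<^sub>L P) \<le> (y (Suc n) - y n) * (y (Suc n) + y n)"
      using Suc Q norm_ge_zero[of P] norm_ge_zero[of Q] unfolding P_def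
      by (subst mult.commute, intro order_trans[OF norm_blinfun_compose] mult_mono) linarith+
    ultimately have "norm ((P o\<^sub>L Q) + (Q o\<^sub>L P)) \<le> 2 * ((y (Suc n) - y n) * (y (Suc n) + y n))"
      using norm_triangle_ineq[of "P o\<^sub>L Q" "Q o\<^sub>L P"] by linarith
    moreover have "y (Suc (Suc n)) - y (Suc n) = (y (Suc n) - y n) * (y (Suc n) + y n) / 2"
      unfolding yS[of "Suc n"] by (subst (3) yS) (simp add: field_simps)
    ultimately show ?case by (simp add: eq)
  qed
  have tail: "norm (Y (n + k) - Y n) \<le> y (n + k) - y n" for n k
  proof (induction k)
    case (Suc k)
    then show ?case using step[of "n + k"] norm_triangle_ineq[of "Y (n + Suc k) - Y (n + k)" "Y (n + k) - Y n"]
      by simp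
  qed simp
  have "incseq y"
    using step by (intro incseq_SucI) (metis diff_ge_0_iff_ge norm_ge_zero order_trans)
  then obtain l where "y \<longlonglongrightarrow> l" using y01 incseq_convergent by blast
  then have "Cauchy y" by (simp add: LIMSEQ_imp_Cauchy)
  have "Cauchy Y"
  proof (rule metric_CauchyI)
    fix e :: real assume "e > 0"
    then obtain M where M: "\<And>m n. m \<ge> M \<Longrightarrow> n \<ge> M \<Longrightarrow> dist (y m) (y n) < e"
      using \<open>Cauchy y\<close> metric_CauchyD by blast
    have *: "dist (Y m) (Y n) < e" if "m \<ge> n" "n \<ge> M" for m n
      using tail[of n "m - n"] M[of m n] that by (simp add: dist_norm)
    have "dist (Y m) (Y n) < e" if "m \<ge> M" "n \<ge> M" for m n
      using *[of m n] *[of n m] that by (cases "m \<ge> n") (auto simp: dist_commute)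
    then show "\<exists>M. \<forall>m\<ge>M. \<forall>n\<ge>M. dist (Y m) (Y n) < e" by blast
  qed
  then obtain L where L: "Y \<longlonglongrightarrow> L" using Cauchy_convergent_iff convergent_def by blast
  have LL: "(\<lambda>n. Y n o\<^sub>L Y n) \<longlonglongrightarrow> (L o\<^sub>L L)"
    by (intro bounded_bilinear.tendsto[OF bounded_bilinear_blinfun_compose] L)
  have "(\<lambda>n. Y (Suc n)) \<longlonglongrightarrow> (1/2) *\<^sub>R (B + (L o\<^sub>L L))"
    unfolding YS by (intro tendsto_intros LL)
  moreover have "(\<lambda>n. Y (Suc n)) \<longlonglongrightarrow> L" using L by (rule LIMSEQ_Suc)
  ultimately have "L = (1/2) *\<^sub>R (B + (L o\<^sub>L L))" by (rule LIMSEQ_unique[rotated])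
  then have LB: "2 *\<^sub>R L = B + (L o\<^sub>L L)" by (metis scaleR_half_double scaleR_2 scaleR_right_distrib)
  show thesis
  proof (rule that[of "id_blinfun - L"])
    have "(id_blinfun - L) o\<^sub>L (id_blinfun - L) = id_blinfun - 2 *\<^sub>R L + (L o\<^sub>L L)"
      unfolding blinfun_compose_algebra by (simp add: scaleR_2 diff_diff_eq)
    then show "(id_blinfun - L) o\<^sub>L (id_blinfun - L) = A"
      by (simp add: LB B_def)
    have "inner (Y n v) w = inner v (Y n w)" for n v w
      by (induction n arbitrary: v w)
         (simp_all add: Y0 YS B_def sym blinfun.add_left blinfun.diff_left blinfun.scaleR_left
            inner_add_left inner_add_right inner_diff_left inner_diff_right)
    moreover have "(\<lambda>n. inner (Y n v) w) \<longlonglongrightarrow> inner (L v) w"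
      "(\<lambda>n. inner v (Y n w)) \<longlonglongrightarrow> inner v (L w)" for v w
      using L by (intro tendsto_intros; simp)+
    ultimately have "inner (L v) w = inner v (L w)" for v w
      using LIMSEQ_unique by fastforce
    then show "inner ((id_blinfun - L) v) w = inner v ((id_blinfun - L) w)" for v w
      by (simp add: blinfun.diff_left inner_diff_left inner_diff_right)
    show "D o\<^sub>L (id_blinfun - L) = (id_blinfun - L) o\<^sub>L D" if D: "D o\<^sub>L A = A o\<^sub>L D" for D
    proof -
      \<comment> \<open>Every iterate is a polynomial in \<open>A\<close>, and commutation passes to
        norm limits.\<close>
      have "D o\<^sub>L Y n = Y n o\<^sub>L D" for n
      proof (induction n)
        case (Suc n)
        have "D o\<^sub>L (Y n o\<^sub>L Y n) = (Y n o\<^sub>L Y n) o\<^sub>L D"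
          by (metis Suc blinfun_compose_assoc)
        then show ?case
          unfolding YS B_def blinfun_compose_algebra by (simp add: D)
      qed (simp add: Y0)
      moreover have "(\<lambda>n. D o\<^sub>L Y n) \<longlonglongrightarrow> (D o\<^sub>L L)" "(\<lambda>n. Y n o\<^sub>L D) \<longlonglongrightarrow> (L o\<^sub>L D)"
        by (intro bounded_bilinear.tendsto[OF bounded_bilinear_blinfun_compose] L tendsto_const)+
      ultimately have "D o\<^sub>L L = L o\<^sub>L D" using LIMSEQ_unique by fastforce
      then show ?thesis unfolding blinfun_compose_algebra by simp
    qed
  qed
qed

text \<open>The bound makes the second coordinates over a Cauchy sequence of first coordinates
  Cauchy as well, so the limit of the latter is again a first coordinate.\<close>

lemma closed_fst_image_graph:
  fixes G :: "('a::real_normed_vector \<times> 'b::{real_normed_vector,complete_space}) set"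
  assumes G: "subspace G" "closed G" and bound: "\<And>v w. (v, w) \<in> G \<Longrightarrow> norm w \<le> K * norm v"
  shows "closed (fst ` G)"
  unfolding closed_sequential_limits
proof safe
  fix v l assume "\<forall>n. v n \<in> fst ` G" and v: "v \<longlonglongrightarrow> l"
  then have "\<forall>n. \<exists>w. (v n, w) \<in> G" by force
  then obtain w where w: "\<And>n. (v n, w n) \<in> G" by metis
  have "norm (w m - w n) \<le> K * norm (v m - v n)" for m n
    using subspace_diff[OF G(1) w[of m] w[of n]] bound by simp
  then have le: "norm (w m - w n) \<le> \<bar>K\<bar> * norm (v m - v n)" for m n
    by (rule order_trans) (simp add: mult_right_mono)
  have "Cauchy v" using v by (simp add: LIMSEQ_imp_Cauchy)
  have "Cauchy w"
  proof (rule metric_CauchyI)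
    fix e :: real assume "e > 0"
    \<comment> \<open>No sign of \<open>K\<close> is assumed; the absolute value and the added 1
      keep the denominator positive.\<close>
    then have "e / (\<bar>K\<bar> + 1) > 0" by simp
    then obtain M where M: "\<And>m n. m \<ge> M \<Longrightarrow> n \<ge> M \<Longrightarrow> dist (v m) (v n) < e / (\<bar>K\<bar> + 1)"
      using \<open>Cauchy v\<close> metric_CauchyD by metis
    have "dist (w m) (w n) < e" if "m \<ge> M" "n \<ge> M" for m n
    proof -
      have "norm (w m - w n) \<le> (\<bar>K\<bar> + 1) * norm (v m - v n)"
        by (rule order_trans[OF le]) (simp add: mult_right_mono)
      also have "\<dots> < e" using M[OF that] by (simp add: dist_norm field_simps)
      finally show ?thesis by (simp add: dist_norm)
    qed
    then show "\<exists>M. \<forall>m\<ge>M. \<forall>n\<ge>M. dist (w m) (w n) < e" by blast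
  qed
  then obtain z where "w \<longlonglongrightarrow> z" using Cauchy_convergent_iff convergent_def by blast
  then have "(\<lambda>n. (v n, w n)) \<longlonglongrightarrow> (l, z)" using v by (intro tendsto_Pair)
  then have "(l, z) \<in> G" using closed_sequentially[OF G(2), of "\<lambda>n. (v n, w n)"] w by simp
  then show "l \<in> fst ` G" by force
qed

lemma graph_functional:
  assumes "subspace G" "\<And>v w. (v, w) \<in> G \<Longrightarrow> norm w \<le> K * norm v" "(v, w) \<in> G" "(v, w') \<in> G"
  shows "w = w'"
  using subspace_diff[OF assms(1,3,4)] assms(2)[of 0 "w - w'"] by simp

lemma closure_span_minimal: "A \<subseteq> V \<Longrightarrow> subspace V \<Longrightarrow> closed V \<Longrightarrow> closure (span A) \<subseteq> V"
  by (intro closure_minimal span_minimal)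

lemma subspace_fst_image: "subspace G \<Longrightarrow> subspace (fst ` G)"
  and subspace_snd_image: "subspace G \<Longrightarrow> subspace (snd ` G)"
  for G :: "('a::real_vector \<times> 'b::real_vector) set"
  by (intro linear_subspace_image linear_fst linear_snd; assumption)+

text \<open>Extension by continuity, done on graphs: the closure of \<open>G\<close> satisfies the
  same bound, so it is single-valued with closed domain, and density makes that domain everything.
  Well-definedness on \<open>G\<close> itself is settled by the same argument.\<close>

lemma bounded_extension:
  fixes G :: "('a::real_normed_vector \<times> 'b::{real_normed_vector,complete_space}) set"
  assumes G: "subspace G" and bound: "\<And>v w. (v, w) \<in> G \<Longrightarrow> norm w \<le> K * norm v"
    and dense: "closure (fst ` G) = UNIV"
  shows "\<exists>R :: 'a \<Rightarrow>\<^sub>L 'b. \<forall>(v, w)\<in>G. blinfun_apply R v = w"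
proof -
  define H where "H = closure G"
  have H: "subspace H" "closed H" unfolding H_def using subspace_closure[OF G] by auto
  have "closed {p :: 'a \<times> 'b. norm (snd p) \<le> K * norm (fst p)}"
    by (intro closed_Collect_le continuous_intros)
  then have "H \<subseteq> {p. norm (snd p) \<le> K * norm (fst p)}"
    unfolding H_def using bound by (intro closure_minimal) auto
  then have b: "norm w \<le> K * norm v" if "(v, w) \<in> H" for v w using that by auto
  have "closure (fst ` G) \<subseteq> fst ` H"
    using closed_fst_image_graph[OF H b] closure_subset[of G] by (intro closure_minimal) (auto simp: H_def)
  then have tot: "\<exists>w. (v, w) \<in> H" for v using dense by force
  then obtain g where g: "\<And>v. (v, g v) \<in> H" by metis
  have gu: "g v = w" if "(v, w) \<in> H" for v w
    using graph_functional[OF H(1) b g that] .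
  have "bounded_linear g"
  proof (rule bounded_linear_intro[where K = K])
    show "g (v + w) = g v + g w" for v w using subspace_add[OF H(1) g g, of v w] by (intro gu) simp
    show "g (r *\<^sub>R v) = r *\<^sub>R g v" for r v using subspace_scale[OF H(1) g, of r v] by (intro gu) simp
    show "norm (g v) \<le> norm v * K" for v using b[OF g, of v] by (simp add: mult.commute)
  qed
  then have "blinfun_apply (Blinfun g) = g" by (rule bounded_linear_Blinfun_apply)
  then show ?thesis using gu closure_subset[of G] by (intro exI[of _ "Blinfun g"]) (auto simp: H_def)
qed

text \<open>The closed linear relation spanned by the pairs \<open>(e i, f i)\<close> is isometric
  when the Gram data agree, hence single-valued both ways with closed domain and range; linear
  combinations never have to be chosen. The last conclusion lets intertwining relations be checked
  on generators.\<close>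

lemma gram_isometry:
  fixes e :: "'i \<Rightarrow> 'a::{real_inner,complete_space}" and f :: "'i \<Rightarrow> 'b::{real_inner,complete_space}"
  assumes gram: "\<And>i j. i \<in> I \<Longrightarrow> j \<in> I \<Longrightarrow> inner (e i) (e j) = inner (f i) (f j)"
  obtains U V W where
    "subspace V" "closed V" "e ` I \<subseteq> V" "V \<subseteq> closure (span (e ` I))"
    "subspace W" "closed W" "f ` I \<subseteq> W" "W \<subseteq> closure (span (f ` I))"
    "U ` V = W" "\<And>i. i \<in> I \<Longrightarrow> U (e i) = f i"
    "\<And>v w. v \<in> V \<Longrightarrow> w \<in> V \<Longrightarrow> U (v + w) = U v + U w"
    "\<And>v w. v \<in> V \<Longrightarrow> w \<in> V \<Longrightarrow> inner (U v) (U w) = inner v w"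
    "\<forall>A B v. bounded_linear A \<longrightarrow> bounded_linear B \<longrightarrow>
       (\<forall>i\<in>I. \<exists>j\<in>I. A (e i) = e j \<and> B (f i) = f j) \<longrightarrow>
       v \<in> V \<longrightarrow> A v \<in> V \<and> U (A v) = B (U v)"
proof -
  define gen where "gen = (\<lambda>i. (e i, f i)) ` I"
  define G where "G = closure (span gen)"
  have G: "subspace G" "closed G" unfolding G_def by (auto intro: subspace_closure)
  have gen_G: "gen \<subseteq> G" unfolding G_def using span_superset closure_subset by blast
  have "closed {p. inner (fst p) a = inner (snd p) b}" "subspace {p. inner (fst p) a = inner (snd p) b}"
    for a :: 'a and b :: 'b
    by (intro closed_Collect_eq continuous_intros) (auto simp: subspace_def inner_add_left)
  note cs = this
  have 1: "inner v (e i) = inner w (f i)" if "(v, w) \<in> G" "i \<in> I" for v w i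
  proof -
    have "G \<subseteq> {p. inner (fst p) (e i) = inner (snd p) (f i)}"
      unfolding G_def using gram that(2) by (intro closure_span_minimal cs) (auto simp: gen_def)
    then show ?thesis using that(1) by auto
  qed
  \<comment> \<open>Agreement against generators is known for one arbitrary pair; it is a closed
    linear condition on the other pair, so it extends to all of \<open>G\<close>.\<close>
  have 2: "inner v v' = inner w w'" if "(v, w) \<in> G" "(v', w') \<in> G" for v w v' w'
  proof -
    have "G \<subseteq> {p. inner (fst p) v = inner (snd p) w}"
      using 1 that(1) unfolding G_def[symmetric]
      by (subst (1) G_def, intro closure_span_minimal cs) (auto simp: gen_def inner_commute)
    then show ?thesis using that(2) by (auto simp: inner_commute)
  qed
  have n: "norm w \<le> 1 * norm v" if "(v, w) \<in> G" for v w
    using 2[OF that that] by (simp add: norm_eq_sqrt_inner)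
  \<comment> \<open>The flipped relation, so that closedness of the range follows from the lemma on
    closed domains.\<close>
  have "(\<lambda>p. (snd p, fst p)) ` G = (\<lambda>p. (snd p, fst p)) -` G" by force
  moreover have "linear (\<lambda>p :: 'a \<times> 'b. (snd p, fst p))" by (auto intro!: linearI)
  ultimately have G': "subspace ((\<lambda>p. (snd p, fst p)) ` G)" "closed ((\<lambda>p. (snd p, fst p)) ` G)"
    using G linear_subspace_image[of "\<lambda>p. (snd p, fst p)" G]
    by (auto intro!: closed_vimage continuous_intros)
  have "norm v \<le> 1 * norm w" if "(w, v) \<in> (\<lambda>p. (snd p, fst p)) ` G" for v w
    using 2[of v w v w] that by (auto simp: norm_eq_sqrt_inner)
  note closed_snd = closed_fst_image_graph[OF G' this]
  define U where "U v = (THE w. (v, w) \<in> G)" for v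
  have U: "U v = w" if "(v, w) \<in> G" for v w
    unfolding U_def using that graph_functional[OF G(1) n] by (intro the_equality) blast+
  have UG: "(v, U v) \<in> G" if "v \<in> fst ` G" for v using that U by force
  show thesis
  proof (rule that[of "fst ` G" "snd ` G" U])
    show "subspace (fst ` G)" "subspace (snd ` G)"
      using G by (auto intro: subspace_fst_image subspace_snd_image)
    show "closed (fst ` G)" by (rule closed_fst_image_graph[OF G n])
    show "closed (snd ` G)" using closed_snd by (simp add: image_image)
    show "e ` I \<subseteq> fst ` G" "f ` I \<subseteq> snd ` G" using gen_G by (force simp: gen_def)+
    have "fst ` G \<subseteq> closure (fst ` span gen)" "snd ` G \<subseteq> closure (snd ` span gen)"
      unfolding G_def
      by (intro closure_bounded_linear_image_subset bounded_linear_fst bounded_linear_snd)+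
    moreover have "fst ` span gen = span (e ` I)" "snd ` span gen = span (f ` I)"
      using linear_span_image[OF linear_fst, of gen] linear_span_image[OF linear_snd, of gen]
      by (simp_all add: gen_def image_image)
    ultimately show "fst ` G \<subseteq> closure (span (e ` I))" "snd ` G \<subseteq> closure (span (f ` I))" by simp_all
    show "U ` fst ` G = snd ` G" using U by (force simp: image_image)
    show "U (e i) = f i" if "i \<in> I" for i using that gen_G by (intro U) (auto simp: gen_def)
    show "U (v + w) = U v + U w" if "v \<in> fst ` G" "w \<in> fst ` G" for v w
      using subspace_add[OF G(1) UG UG, OF that] by (intro U) simp
    show "inner (U v) (U w) = inner v w" if "v \<in> fst ` G" "w \<in> fst ` G" for v w
      using 2[OF UG UG, OF that] by simp
    have "A v \<in> fst ` G \<and> U (A v) = B (U v)"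
      if AB: "bounded_linear A" "bounded_linear B"
        and gen: "\<forall>i\<in>I. \<exists>j\<in>I. A (e i) = e j \<and> B (f i) = f j" and v: "v \<in> fst ` G" for A B v
    proof -
      \<comment> \<open>\<open>A\<close> and \<open>B\<close> acting together map generating pairs
        to generating pairs, hence preserve \<open>G\<close>; that \<open>F (v, U v)\<close> lies in
        \<open>G\<close> says exactly that \<open>U (A v) = B (U v)\<close>.\<close>
      define F where "F = (\<lambda>p. (A (fst p), B (snd p)))"
      have F: "bounded_linear F" unfolding F_def
        by (intro bounded_linear_Pair bounded_linear_compose[OF AB(1)] bounded_linear_compose[OF AB(2)]
            bounded_linear_fst bounded_linear_snd)
      have "F ` gen \<subseteq> gen" using gen by (force simp: F_def gen_def)
      then have "span (F ` gen) \<subseteq> span gen" by (rule span_mono)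
      then have "F ` span gen \<subseteq> span gen"
        using linear_span_image[OF bounded_linear.linear[OF F], of gen] by simp
      then have "F ` G \<subseteq> G"
        unfolding G_def using closure_bounded_linear_image_subset[OF F, of "span gen"] closure_mono by blast
      then have "(A v, B (U v)) \<in> G" using UG[OF v] by (force simp: F_def)
      then show ?thesis using U by force
    qed
    then show "\<forall>A B v. bounded_linear A \<longrightarrow> bounded_linear B \<longrightarrow>
       (\<forall>i\<in>I. \<exists>j\<in>I. A (e i) = e j \<and> B (f i) = f j) \<longrightarrow>
       v \<in> fst ` G \<longrightarrow> A v \<in> fst ` G \<and> U (A v) = B (U v)" by blast
  qed
qed

section \<open>Generated von Neumann algebras\<close>

lemma unital_star_algebraD:
  assumes "unital_star_algebra A"
  shows "A \<subseteq> bounded_ops" "id_blinfun \<in> A" "S \<in> A \<Longrightarrow> T \<in> A \<Longrightarrow> S + T \<in> A"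
    "S \<in> A \<Longrightarrow> T \<in> A \<Longrightarrow> S o\<^sub>L T \<in> A" "T \<in> A \<Longrightarrow> adj T \<in> A" "T \<in> A \<Longrightarrow> cscalar c o\<^sub>L T \<in> A"
  using assms by (auto simp: unital_star_algebra_def)

lemma cscalar_of_real: "cscalar (complex_of_real r) o\<^sub>L T = r *\<^sub>R T"
  by (rule blinfun_eqI) (simp add: blinfun.scaleR_left scaleR_scaleC)

lemma unital_star_algebra_scaleR: "unital_star_algebra A \<Longrightarrow> T \<in> A \<Longrightarrow> r *\<^sub>R T \<in> A"
  using unital_star_algebraD(6)[of A T "complex_of_real r"] by (simp add: cscalar_of_real)

lemma unital_star_algebra_diff: "unital_star_algebra A \<Longrightarrow> S \<in> A \<Longrightarrow> T \<in> A \<Longrightarrow> S - T \<in> A"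
  using unital_star_algebraD(3)[of A S "(-1) *\<^sub>R T"] unital_star_algebra_scaleR[of A T "-1"] by simp

lemma unital_star_algebra_cscalar: "unital_star_algebra A \<Longrightarrow> cscalar c \<in> A"
  using unital_star_algebraD(6)[of A id_blinfun c] unital_star_algebraD(2)[of A] by simp

lemma commutant_subset: "commutant A \<subseteq> bounded_ops"
  by (auto simp: commutant_def)

lemma commutant_mono: "A \<subseteq> B \<Longrightarrow> commutant B \<subseteq> commutant A"
  by (auto simp: commutant_def)

lemma double_commutant_superset: "A \<subseteq> bounded_ops \<Longrightarrow> A \<subseteq> commutant (commutant A)"
  by (auto simp: commutant_def)

lemma triple_commutant: "A \<subseteq> bounded_ops \<Longrightarrow> commutant (commutant (commutant A)) = commutant A"
  by (intro equalityI commutant_mono double_commutant_superset commutant_subset)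

lemma unital_star_algebra_commutant:
  assumes "A \<subseteq> bounded_ops" and adj: "\<And>T. T \<in> A \<Longrightarrow> adj T \<in> A"
  shows "unital_star_algebra (commutant A)"
  unfolding unital_star_algebra_def
proof (intro conjI ballI allI)
  show "commutant A \<subseteq> bounded_ops" by (rule commutant_subset)
  show "id_blinfun \<in> commutant A" by (simp add: commutant_def)
  show "S + T \<in> commutant A" if "S \<in> commutant A" "T \<in> commutant A" for S T
    using that by (auto simp: commutant_def blinfun_compose_algebra bounded_ops_add)
  show "S o\<^sub>L T \<in> commutant A" if "S \<in> commutant A" "T \<in> commutant A" for S T
    using that unfolding commutant_def mem_Collect_eq
    by (metis blinfun_compose_assoc bounded_ops_compose)
  show "cscalar c o\<^sub>L T \<in> commutant A" if "T \<in> commutant A" for T c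
  proof -
    have "R o\<^sub>L (cscalar c o\<^sub>L T) = (cscalar c o\<^sub>L T) o\<^sub>L R" if "R \<in> A" for R
    proof -
      have "R o\<^sub>L cscalar c = cscalar c o\<^sub>L R"
        using assms(1) that by (intro blinfun_eqI) (auto simp: bounded_opsD)
      moreover have "R o\<^sub>L T = T o\<^sub>L R" using \<open>T \<in> commutant A\<close> that by (simp add: commutant_def)
      ultimately show ?thesis by (metis blinfun_compose_assoc)
    qed
    then show ?thesis using \<open>T \<in> commutant A\<close> by (auto simp: commutant_def bounded_ops_compose)
  qed
  show "adj T \<in> commutant A" if "T \<in> commutant A" for T
  proof -
    have T: "T \<in> bounded_ops" "\<And>S. S \<in> A \<Longrightarrow> S o\<^sub>L T = T o\<^sub>L S"
      using that by (auto simp: commutant_def)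
    have "S o\<^sub>L adj T = adj T o\<^sub>L S" if "S \<in> A" for S
    proof -
      have S: "S \<in> bounded_ops" using that assms(1) by blast
      have "adj (adj S o\<^sub>L T) = adj (T o\<^sub>L adj S)" using T(2)[OF adj[OF that]] by simp
      then show ?thesis using S T(1) by (simp add: adj_compose bounded_ops_adj adj_adj)
    qed
    then show ?thesis using T(1) by (simp add: commutant_def bounded_ops_adj)
  qed
qed

lemma von_neumann_algebra_double_commutant:
  assumes "A \<subseteq> bounded_ops" "\<And>T. T \<in> A \<Longrightarrow> adj T \<in> A"
  shows "von_neumann_algebra (commutant (commutant A))"
proof -
  have "unital_star_algebra (commutant A)" by (rule unital_star_algebra_commutant[OF assms])
  then have "unital_star_algebra (commutant (commutant A))"
    by (intro unital_star_algebra_commutant) (auto dest: unital_star_algebraD)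
  then show ?thesis
    unfolding von_neumann_algebra_def by (simp add: triple_commutant commutant_subset)
qed

lemma von_neumann_algebra_star: "von_neumann_algebra A \<Longrightarrow> unital_star_algebra A"
  by (simp add: von_neumann_algebra_def)

section \<open>Intersections and the generated von Neumann algebra\<close>

lemma unital_star_algebra_Inter:
  "F \<noteq> {} \<Longrightarrow> (\<And>A. A \<in> F \<Longrightarrow> unital_star_algebra A) \<Longrightarrow> unital_star_algebra (\<Inter>F)"
  unfolding unital_star_algebra_def by blast

lemma von_neumann_algebra_Inter:
  assumes "F \<noteq> {}" "\<And>A. A \<in> F \<Longrightarrow> von_neumann_algebra A"
  shows "von_neumann_algebra (\<Inter>F)"
proof -
  have star: "unital_star_algebra (\<Inter>F)"
    using assms by (intro unital_star_algebra_Inter) (auto dest: von_neumann_algebra_star)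
  have "commutant (commutant (\<Inter>F)) \<subseteq> A" if "A \<in> F" for A
    using assms(2)[OF that] commutant_mono[OF commutant_mono[of "\<Inter>F" A]] that
    by (auto simp: von_neumann_algebra_def)
  then have "commutant (commutant (\<Inter>F)) = \<Inter>F"
    using double_commutant_superset[of "\<Inter>F"] unital_star_algebraD(1)[OF star] by blast
  then show ?thesis using star by (simp add: von_neumann_algebra_def)
qed

lemma unital_star_algebra_bounded_ops: "unital_star_algebra bounded_ops"
  by (auto simp: unital_star_algebra_def bounded_ops_add bounded_ops_compose bounded_ops_adj)

lemma von_neumann_algebra_bounded_ops: "von_neumann_algebra bounded_ops"
  using double_commutant_superset[of bounded_ops] commutant_subset unital_star_algebra_bounded_ops
  unfolding von_neumann_algebra_def by blast

text \<open>Since \<open>bounded_ops\<close> is a von Neumann algebra above \<open>A\<close>, the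
  hull is an intersection of a nonempty family; over an empty family it would be
  \<open>UNIV\<close>.\<close>

lemma von_neumann_algebra_vN_gen: "A \<subseteq> bounded_ops \<Longrightarrow> von_neumann_algebra (vN_gen A)"
  unfolding vN_gen_def hull_def
  using von_neumann_algebra_bounded_ops by (intro von_neumann_algebra_Inter) auto

lemma vN_gen_superset: "A \<subseteq> vN_gen A"
  unfolding vN_gen_def by (rule hull_subset)

lemma vN_gen_minimal: "A \<subseteq> Q \<Longrightarrow> von_neumann_algebra Q \<Longrightarrow> vN_gen A \<subseteq> Q"
  unfolding vN_gen_def by (rule hull_minimal)

lemma vN_gen_mono: "A \<subseteq> B \<Longrightarrow> vN_gen A \<subseteq> vN_gen B"
  unfolding vN_gen_def by (rule hull_mono)

lemma double_commutant_minimal: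
  "A \<subseteq> Q \<Longrightarrow> von_neumann_algebra Q \<Longrightarrow> commutant (commutant A) \<subseteq> Q"
  using commutant_mono[OF commutant_mono, of A Q] by (simp add: von_neumann_algebra_def)

section \<open>Amplification and von Neumann's density theorem\<close>

text \<open>The direct sum of countably many copies of the Hilbert space. A normal functional is a
  countable sum of vector functionals, so it is controlled by a single vector here. Only the real
  structure is provided: it suffices for projections and norm approximation.\<close>

typedef (overloaded) 'a ell2 = "{f :: nat \<Rightarrow> 'a::real_inner. summable (\<lambda>n. (norm (f n))\<^sup>2)}"
  morphisms coord Abs_ell2
  by (rule exI[of _ "\<lambda>_. 0"]) simp

setup_lifting type_definition_ell2

lemma summable_norm_sq_add:
  fixes f g :: "nat \<Rightarrow> 'a::real_inner"
  assumes "summable (\<lambda>n. (norm (f n))\<^sup>2)" "summable (\<lambda>n. (norm (g n))\<^sup>2)"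
  shows "summable (\<lambda>n. (norm (f n + g n))\<^sup>2)"
proof (rule summable_comparison_test)
  show "summable (\<lambda>n. 2 * (norm (f n))\<^sup>2 + 2 * (norm (g n))\<^sup>2)"
    using assms by (intro summable_add summable_mult)
  have "(norm (f n + g n))\<^sup>2 \<le> 2 * (norm (f n))\<^sup>2 + 2 * (norm (g n))\<^sup>2" for n
    using zero_le_power2[of "norm (f n - g n)"]
    by (simp add: power2_norm_eq_inner algebra_simps inner_commute)
  then show "\<exists>N. \<forall>n\<ge>N. norm ((norm (f n + g n))\<^sup>2) \<le> 2 * (norm (f n))\<^sup>2 + 2 * (norm (g n))\<^sup>2"
    by simp
qed

lemma summable_inner_ell2:
  fixes f g :: "nat \<Rightarrow> 'a::real_inner"
  assumes "summable (\<lambda>n. (norm (f n))\<^sup>2)" "summable (\<lambda>n. (norm (g n))\<^sup>2)"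
  shows "summable (\<lambda>n. inner (f n) (g n))"
proof (rule summable_comparison_test)
  show "summable (\<lambda>n. (norm (f n))\<^sup>2 + (norm (g n))\<^sup>2)"
    using assms by (intro summable_add)
  have "norm (inner (f n) (g n)) \<le> (norm (f n))\<^sup>2 + (norm (g n))\<^sup>2" for n
  proof -
    have "\<bar>inner (f n) (g n)\<bar> \<le> norm (f n) * norm (g n)" by (rule Cauchy_Schwarz_ineq2)
    moreover have "2 * (norm (f n) * norm (g n)) \<le> (norm (f n))\<^sup>2 + (norm (g n))\<^sup>2"
      using sum_squares_bound[of "norm (f n)" "norm (g n)"] by simp
    moreover have "0 \<le> norm (f n) * norm (g n)" by simp
    ultimately show ?thesis by (simp only: real_norm_def)
  qed
  then show "\<exists>N. \<forall>n\<ge>N. norm (inner (f n) (g n)) \<le> (norm (f n))\<^sup>2 + (norm (g n))\<^sup>2" by blast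
qed

instantiation ell2 :: (real_inner) real_inner
begin

lift_definition zero_ell2 :: "'a ell2" is "\<lambda>_. 0" by simp
lift_definition plus_ell2 :: "'a ell2 \<Rightarrow> 'a ell2 \<Rightarrow> 'a ell2" is "\<lambda>f g n. f n + g n"
  by (rule summable_norm_sq_add)
lift_definition uminus_ell2 :: "'a ell2 \<Rightarrow> 'a ell2" is "\<lambda>f n. - f n" by simp
lift_definition minus_ell2 :: "'a ell2 \<Rightarrow> 'a ell2 \<Rightarrow> 'a ell2" is "\<lambda>f g n. f n - g n"
  using summable_norm_sq_add[of _ "\<lambda>n. - g n" for g] by simp
lift_definition scaleR_ell2 :: "real \<Rightarrow> 'a ell2 \<Rightarrow> 'a ell2" is "\<lambda>r f n. r *\<^sub>R f n"
  by (simp add: power_mult_distrib summable_mult)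
lift_definition inner_ell2 :: "'a ell2 \<Rightarrow> 'a ell2 \<Rightarrow> real" is "\<lambda>f g. \<Sum>n. inner (f n) (g n)" .
definition norm_ell2 :: "'a ell2 \<Rightarrow> real" where "norm_ell2 f = sqrt (inner f f)"
definition dist_ell2 :: "'a ell2 \<Rightarrow> 'a ell2 \<Rightarrow> real" where "dist_ell2 f g = norm (f - g)"
definition sgn_ell2 :: "'a ell2 \<Rightarrow> 'a ell2" where "sgn_ell2 f = inverse (norm f) *\<^sub>R f"
definition uniformity_ell2 :: "('a ell2 \<times> 'a ell2) filter" where
  "uniformity_ell2 = (INF e\<in>{0 <..}. principal {(x, y). dist x y < e})"
definition open_ell2 :: "'a ell2 set \<Rightarrow> bool" where
  "open_ell2 U \<longleftrightarrow> (\<forall>x\<in>U. eventually (\<lambda>(x', y). x' = x \<longrightarrow> y \<in> U) uniformity)"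

instance
proof
  fix f g h :: "'a ell2" and r q :: real
  show "f + g + h = f + (g + h)" by transfer (simp add: add.assoc)
  show "f + g = g + f" by transfer (simp add: add.commute)
  show "0 + f = f" by transfer simp
  show "- f + f = 0" by transfer simp
  show "f - g = f + - g" by transfer simp
  show "r *\<^sub>R (f + g) = r *\<^sub>R f + r *\<^sub>R g" by transfer (simp add: scaleR_add_right)
  show "(r + q) *\<^sub>R f = r *\<^sub>R f + q *\<^sub>R f" by transfer (simp add: scaleR_add_left)
  show "r *\<^sub>R q *\<^sub>R f = (r * q) *\<^sub>R f" by transfer simp
  show "1 *\<^sub>R f = f" by transfer simp
  show "inner f g = inner g f" by transfer (simp add: inner_commute)
  show "inner (f + g) h = inner f h + inner g h"
    by transfer (simp add: inner_add_left suminf_add summable_inner_ell2)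
  show "inner (r *\<^sub>R f) g = r * inner f g"
    by transfer (simp add: suminf_mult summable_inner_ell2)
  show "0 \<le> inner f f"
    by transfer (simp add: suminf_nonneg summable_inner_ell2)
  show "inner f f = 0 \<longleftrightarrow> f = 0"
  proof transfer
    fix f :: "nat \<Rightarrow> 'a" assume f: "summable (\<lambda>n. (norm (f n))\<^sup>2)"
    then have "(\<Sum>n. inner (f n) (f n)) = 0 \<longleftrightarrow> (\<forall>n. inner (f n) (f n) = 0)"
      by (intro suminf_eq_zero_iff summable_inner_ell2) auto
    then show "(\<Sum>n. inner (f n) (f n)) = 0 \<longleftrightarrow> f = (\<lambda>_. 0)" by auto
  qed
qed (simp_all only: norm_ell2_def dist_ell2_def sgn_ell2_def uniformity_ell2_def open_ell2_def)

end

lemma summable_coord: "summable (\<lambda>n. (norm (coord f n))\<^sup>2)"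
  using coord[of f] by simp

lemma norm_ell2_sq: "(norm f)\<^sup>2 = (\<Sum>n. (norm (coord f n))\<^sup>2)"
  unfolding power2_norm_eq_inner by (rule inner_ell2.rep_eq)

lemma norm_coord_le: "norm (coord f n) \<le> norm f"
proof (rule power2_le_imp_le)
  have "(\<Sum>k\<in>{n}. (norm (coord f k))\<^sup>2) \<le> (\<Sum>k. (norm (coord f k))\<^sup>2)"
    by (intro sum_le_suminf summable_coord) auto
  then show "(norm (coord f n))\<^sup>2 \<le> (norm f)\<^sup>2" by (simp add: norm_ell2_sq)
qed simp

lemma sum_coord_le: "(\<Sum>k<n. (norm (coord f k))\<^sup>2) \<le> (norm f)\<^sup>2"
  unfolding norm_ell2_sq by (intro sum_le_suminf summable_coord) auto

lemma coord_Abs: "summable (\<lambda>n. (norm (g n))\<^sup>2) \<Longrightarrow> coord (Abs_ell2 g) = g"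
  by (simp add: Abs_ell2_inverse)

lemmas coord_simps [simp] = zero_ell2.rep_eq plus_ell2.rep_eq minus_ell2.rep_eq scaleR_ell2.rep_eq

text \<open>For sequences known only coordinatewise, where both membership in the space and the norm
  bound must come from finite sums.\<close>

lemma ell2_normI:
  assumes "\<And>n. (\<Sum>k<n. (norm (g k))\<^sup>2) \<le> K\<^sup>2" "K \<ge> 0"
  shows "summable (\<lambda>n. (norm (g n))\<^sup>2)" "norm (Abs_ell2 g) \<le> K"
proof -
  show s: "summable (\<lambda>n. (norm (g n))\<^sup>2)" by (rule summableI_nonneg_bounded[OF _ assms(1)]) simp
  show "norm (Abs_ell2 g) \<le> K"
  proof (rule power2_le_imp_le[OF _ assms(2)])
    show "(norm (Abs_ell2 g))\<^sup>2 \<le> K\<^sup>2"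
      unfolding norm_ell2_sq coord_Abs[OF s] by (rule suminf_le_const[OF s assms(1)])
  qed
qed

instance ell2 :: ("{real_inner,complete_space}") complete_space
proof
  fix F :: "nat \<Rightarrow> 'a ell2" assume F: "Cauchy F"
  have C: "\<exists>M. \<forall>m\<ge>M. \<forall>n\<ge>M. norm (F m - F n) < e" if "e > 0" for e
    using metric_CauchyD[OF F that] by (simp add: dist_norm)
  have "Cauchy (\<lambda>n. coord (F n) k)" for k
  proof (rule metric_CauchyI)
    fix e :: real assume "e > 0"
    then obtain M where M: "\<And>m n. m \<ge> M \<Longrightarrow> n \<ge> M \<Longrightarrow> norm (F m - F n) < e" using C by blast
    have "dist (coord (F m) k) (coord (F n) k) < e" if "m \<ge> M" "n \<ge> M" for m n
      using norm_coord_le[of "F m - F n" k] M[OF that] by (simp add: dist_norm)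
    then show "\<exists>M. \<forall>m\<ge>M. \<forall>n\<ge>M. dist (coord (F m) k) (coord (F n) k) < e" by blast
  qed
  then have "\<forall>k. \<exists>l. (\<lambda>n. coord (F n) k) \<longlonglongrightarrow> l"
    using Cauchy_convergent_iff convergent_def by blast
  then obtain g where g: "\<And>k. (\<lambda>n. coord (F n) k) \<longlonglongrightarrow> g k" by metis
  \<comment> \<open>A finite partial sum survives the coordinatewise limit in \<open>n\<close>, and
    the bound is uniform in \<open>N\<close>.\<close>
  have bound: "(\<Sum>k<N. (norm (g k - coord (F m) k))\<^sup>2) \<le> e\<^sup>2"
    if "\<And>n. n \<ge> M \<Longrightarrow> norm (F n - F m) \<le> e" for M m N e
  proof (rule LIMSEQ_le_const2)
    show "(\<lambda>n. \<Sum>k<N. (norm (coord (F n) k - coord (F m) k))\<^sup>2) \<longlonglongrightarrow> (\<Sum>k<N. (norm (g k - coord (F m) k))\<^sup>2)"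
      by (intro tendsto_intros g)
    have "(\<Sum>k<N. (norm (coord (F n) k - coord (F m) k))\<^sup>2) \<le> e\<^sup>2" if "n \<ge> M" for n
    proof -
      have "(\<Sum>k<N. (norm (coord (F n) k - coord (F m) k))\<^sup>2) \<le> (norm (F n - F m))\<^sup>2"
        using sum_coord_le[of "F n - F m" N] by simp
      also have "\<dots> \<le> e\<^sup>2" using \<open>\<And>n. n \<ge> M \<Longrightarrow> norm (F n - F m) \<le> e\<close>[OF that] by (intro power_mono) auto
      finally show ?thesis .
    qed
    then show "\<exists>N'. \<forall>n\<ge>N'. (\<Sum>k<N. (norm (coord (F n) k - coord (F m) k))\<^sup>2) \<le> e\<^sup>2" by blast
  qed
  obtain M0 where M0: "\<And>m n. m \<ge> M0 \<Longrightarrow> n \<ge> M0 \<Longrightarrow> norm (F m - F n) < 1" using C[of 1] by auto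
  \<comment> \<open>One index suffices: the limit is within norm 1 of \<open>F M0\<close>, which is
    itself square-summable.\<close>
  have "summable (\<lambda>k. (norm (g k - coord (F M0) k))\<^sup>2)"
    using bound[of M0 M0 1] M0 by (intro ell2_normI(1)[of _ 1]) (simp_all add: less_imp_le)
  from summable_norm_sq_add[OF this summable_coord[of "F M0"]]
  have gs: "summable (\<lambda>k. (norm (g k))\<^sup>2)" by simp
  have "F \<longlonglongrightarrow> Abs_ell2 g"
  proof (rule metric_LIMSEQ_I)
    fix e :: real assume "e > 0"
    then obtain M where M: "\<And>m n. m \<ge> M \<Longrightarrow> n \<ge> M \<Longrightarrow> norm (F m - F n) < e / 2"
      using C[of "e / 2"] by auto
    have "dist (F m) (Abs_ell2 g) < e" if "m \<ge> M" for m
    proof -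
      have "norm (Abs_ell2 (\<lambda>k. g k - coord (F m) k)) \<le> e / 2"
        using bound[OF less_imp_le[OF M[OF _ that]]] \<open>e > 0\<close> by (intro ell2_normI(2)) simp_all
      moreover have "Abs_ell2 (\<lambda>k. g k - coord (F m) k) = Abs_ell2 g - F m"
        unfolding minus_ell2.rep_eq[of "Abs_ell2 g" "F m", symmetric, unfolded coord_Abs[OF gs]] by (rule coord_inverse)
      ultimately show ?thesis using \<open>e > 0\<close> by (simp add: dist_norm norm_minus_commute)
    qed
    then show "\<exists>M. \<forall>m\<ge>M. dist (F m) (Abs_ell2 g) < e" by blast
  qed
  then show "convergent F" by (auto simp: convergent_def)
qed

lift_definition single :: "nat \<Rightarrow> 'a::real_inner \<Rightarrow> 'a ell2" is "\<lambda>n v k. if k = n then v else 0"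
proof -
  fix n :: nat and v :: 'a
  have "(\<lambda>k. (norm (if k = n then v else 0))\<^sup>2) = (\<lambda>k. if k = n then (norm v)\<^sup>2 else 0)" by auto
  then show "summable (\<lambda>k. (norm (if k = n then v else 0))\<^sup>2)" by simp
qed

lift_definition truncate :: "nat \<Rightarrow> 'a::real_inner ell2 \<Rightarrow> 'a ell2" is "\<lambda>N f k. if k < N then f k else 0"
proof -
  fix N and f :: "nat \<Rightarrow> 'a" assume "summable (\<lambda>n. (norm (f n))\<^sup>2)"
  then show "summable (\<lambda>k. (norm (if k < N then f k else 0))\<^sup>2)"
    by (rule summable_comparison_test[rotated]) auto
qed

lemma norm_single: "norm (single n v) = norm v"
proof -
  have "(\<lambda>k. (norm (coord (single n v) k))\<^sup>2) = (\<lambda>k. if k = n then (norm v)\<^sup>2 else 0)"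
    by (auto simp: single.rep_eq)
  then have "(norm (single n v))\<^sup>2 = (norm v)\<^sup>2"
    using sums_unique[OF sums_single[of n "\<lambda>_. (norm v)\<^sup>2"]] by (simp add: norm_ell2_sq)
  then show ?thesis by (simp add: power2_eq_iff_nonneg)
qed

lemma ell2_eqI: "(\<And>k. coord f k = coord g k) \<Longrightarrow> f = g"
  by (metis coord_inject ext)

lemma truncate_0: "truncate 0 f = 0"
  and truncate_Suc: "truncate (Suc N) f = truncate N f + single N (coord f N)"
  by (rule ell2_eqI, auto simp: truncate.rep_eq single.rep_eq less_Suc_eq)+

lemma truncate_tendsto: "(\<lambda>N. truncate N f) \<longlonglongrightarrow> f"
proof -
  have "(norm (f - truncate N f))\<^sup>2 = (norm f)\<^sup>2 - (\<Sum>k<N. (norm (coord f k))\<^sup>2)" for N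
  proof -
    have "(\<lambda>k. (norm (coord f k))\<^sup>2 - (if k \<in> {..<N} then (norm (coord f k))\<^sup>2 else 0))
        sums ((norm f)\<^sup>2 - (\<Sum>k<N. (norm (coord f k))\<^sup>2))"
      unfolding norm_ell2_sq
      by (intro sums_diff summable_sums summable_coord sums_If_finite_set) simp
    moreover have "(norm (coord f k))\<^sup>2 - (if k \<in> {..<N} then (norm (coord f k))\<^sup>2 else 0)
        = (norm (coord (f - truncate N f) k))\<^sup>2" for k
      by (simp add: truncate.rep_eq)
    ultimately show ?thesis unfolding norm_ell2_sq[of "f - truncate N f"] by (simp add: sums_iff)
  qed
  moreover have "(\<lambda>N. (norm f)\<^sup>2 - (\<Sum>k<N. (norm (coord f k))\<^sup>2)) \<longlonglongrightarrow> (norm f)\<^sup>2 - (norm f)\<^sup>2"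
    unfolding norm_ell2_sq by (intro tendsto_intros summable_LIMSEQ summable_coord)
  ultimately have "(\<lambda>N. (norm (f - truncate N f))\<^sup>2) \<longlonglongrightarrow> 0" by simp
  then have "(\<lambda>N. sqrt ((norm (f - truncate N f))\<^sup>2)) \<longlonglongrightarrow> sqrt 0" by (rule tendsto_real_sqrt)
  then have "(\<lambda>N. norm (truncate N f - f)) \<longlonglongrightarrow> 0" by (simp add: norm_minus_commute)
  then show ?thesis using LIM_zero_iff tendsto_norm_zero_iff by blast
qed

lemma ell2_bounded_linear_eqI:
  fixes F G :: "'a::real_inner ell2 \<Rightarrow> 'b::real_normed_vector"
  assumes F: "bounded_linear F" and G: "bounded_linear G" and eq: "\<And>n v. F (single n v) = G (single n v)"
  shows "F f = G f"
proof -
  interpret F: bounded_linear F by fact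
  interpret G: bounded_linear G by fact
  have "F (truncate N f) = G (truncate N f)" for N
    by (induction N) (simp_all add: truncate_0 truncate_Suc F.add G.add F.zero G.zero eq)
  moreover have "(\<lambda>N. F (truncate N f)) \<longlonglongrightarrow> F f" "(\<lambda>N. G (truncate N f)) \<longlonglongrightarrow> G f"
    by (intro F.tendsto G.tendsto truncate_tendsto)+
  ultimately show ?thesis using LIMSEQ_unique by fastforce
qed

section \<open>Operators acting coordinatewise\<close>

lift_definition amplify :: "('a::real_inner \<Rightarrow>\<^sub>L 'a) \<Rightarrow> 'a ell2 \<Rightarrow> 'a ell2" is "\<lambda>T f n. blinfun_apply T (f n)"
proof -
  fix T :: "'a \<Rightarrow>\<^sub>L 'a" and f :: "nat \<Rightarrow> 'a" assume "summable (\<lambda>n. (norm (f n))\<^sup>2)"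
  then have "summable (\<lambda>n. (norm T)\<^sup>2 * (norm (f n))\<^sup>2)" by (rule summable_mult)
  moreover have "norm ((norm (T (f n)))\<^sup>2) \<le> (norm T)\<^sup>2 * (norm (f n))\<^sup>2" for n
    using power_mono[OF norm_blinfun[of T "f n"], of 2] by (simp add: power_mult_distrib)
  ultimately show "summable (\<lambda>n. (norm (T (f n)))\<^sup>2)"
    by (rule summable_comparison_test'[where N = 0])
qed

lemmas coord_amplify [simp] = amplify.rep_eq

lemma bounded_linear_amplify: "bounded_linear (amplify T)"
proof (rule bounded_linear_intro[where K = "norm T"])
  show "amplify T (f + g) = amplify T f + amplify T g" for f g
    by (rule ell2_eqI) (simp add: blinfun.add_right)
  show "amplify T (r *\<^sub>R f) = r *\<^sub>R amplify T f" for r f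
    by (rule ell2_eqI) (simp add: blinfun.scaleR_right)
  show "norm (amplify T f) \<le> norm f * norm T" for f
  proof (rule power2_le_imp_le)
    have "(\<Sum>n. (norm (T (coord f n)))\<^sup>2) \<le> (\<Sum>n. (norm T)\<^sup>2 * (norm (coord f n))\<^sup>2)"
      using summable_coord[of "amplify T f"] 
      by (intro suminf_le summable_mult summable_coord)
        (simp_all add: power_mono[OF norm_blinfun] norm_blinfun flip: power_mult_distrib)
    also have "\<dots> = (norm T)\<^sup>2 * (norm f)\<^sup>2"
      unfolding norm_ell2_sq by (intro suminf_mult summable_coord)
    finally show "(norm (amplify T f))\<^sup>2 \<le> (norm f * norm T)\<^sup>2"
      by (simp add: norm_ell2_sq[of "amplify T f"] power_mult_distrib mult.commute)
  qed simp
qed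

lemma inner_amplify: "T \<in> bounded_ops \<Longrightarrow> inner (amplify T f) g = inner f (amplify (adj T) g)"
  by (simp add: inner_ell2.rep_eq inner_adj)

text \<open>The projection \<open>E\<close> onto the closed orbit \<open>K\<close> of
  \<open>f\<close> commutes with the amplified \<open>A\<close>, so its matrix entries lie in the
  commutant of \<open>A\<close> and commute with \<open>a\<close>. Hence the amplified
  \<open>a\<close> commutes with \<open>E\<close> and preserves \<open>K\<close>, which contains
  \<open>f\<close> because \<open>A\<close> is unital.\<close>

lemma von_neumann_density:
  fixes A :: "'a::chilbert_space op set"
  assumes A: "unital_star_algebra A" and a: "a \<in> commutant (commutant A)"
  shows "amplify a f \<in> closure ((\<lambda>b. amplify b f) ` A)"
proof -
  define K where "K = closure ((\<lambda>b. amplify b f) ` A)"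
  have "subspace ((\<lambda>b. amplify b f) ` A)"
    unfolding subspace_def
  proof safe
    have "0 \<in> A" using unital_star_algebra_diff[OF A] unital_star_algebraD(2)[OF A] by fastforce
    moreover have "amplify 0 f = 0" by (rule ell2_eqI) simp
    ultimately show "0 \<in> (\<lambda>b. amplify b f) ` A" by (metis image_eqI)
    show "amplify b f + amplify c f \<in> (\<lambda>b. amplify b f) ` A" if "b \<in> A" "c \<in> A" for b c
    proof (rule image_eqI)
      show "amplify b f + amplify c f = amplify (b + c) f" by (rule ell2_eqI) (simp add: blinfun.add_left)
    qed (rule unital_star_algebraD(3)[OF A that])
    show "r *\<^sub>R amplify b f \<in> (\<lambda>b. amplify b f) ` A" if "b \<in> A" for b r
    proof (rule image_eqI)
      show "r *\<^sub>R amplify b f = amplify (r *\<^sub>R b) f" by (rule ell2_eqI) (simp add: blinfun.scaleR_left)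
    qed (rule unital_star_algebra_scaleR[OF A that])
  qed
  then have K: "subspace K" "closed K" unfolding K_def by (auto intro: subspace_closure)
  define E where "E = blinfun_apply (orth_proj K)"
  have E: "bounded_linear E" unfolding E_def by (rule blinfun.bounded_linear_right)
  have inv: "amplify b g \<in> K" if "b \<in> A" "g \<in> K" for b g
  proof -
    have "amplify b ` K \<subseteq> closure (amplify b ` (\<lambda>b. amplify b f) ` A)"
      unfolding K_def by (rule closure_bounded_linear_image_subset[OF bounded_linear_amplify])
    also have "\<dots> \<subseteq> K" unfolding K_def
    proof (rule closure_mono, safe)
      fix c assume "c \<in> A"
      show "amplify b (amplify c f) \<in> (\<lambda>b. amplify b f) ` A"
      proof (rule image_eqI)
        show "amplify b (amplify c f) = amplify (b o\<^sub>L c) f" by (rule ell2_eqI) simp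
      qed (rule unital_star_algebraD(4)[OF A that(1) \<open>c \<in> A\<close>])
    qed
    finally show ?thesis using that by blast
  qed
  have comm: "E (amplify b g) = amplify b (E g)" if "b \<in> A" for b g
    unfolding E_def
    using that A unital_star_algebraD[OF A]
    by (intro orth_proj_commute[OF K inner_amplify])
       (auto intro: inv simp: bounded_linear.linear[OF bounded_linear_amplify, THEN linear_diff])
  \<comment> \<open>The matrix entries of \<open>E\<close>. Every operator is later compared on
    vectors \<open>single n v\<close>, so no infinite sum of entries is formed.\<close>
  define e where "e n m = Blinfun (\<lambda>v. coord (E (single n v)) m)" for n m
  have "bounded_linear (\<lambda>v. coord (E (single n v)) m)" for n m
  proof (rule bounded_linear_compose[of "\<lambda>f. coord f m"])
    show "bounded_linear (\<lambda>f. coord f m)"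
      by (rule bounded_linear_intro[where K = 1]) (simp_all add: norm_coord_le)
    have "bounded_linear (single n :: 'a \<Rightarrow> 'a ell2)"
    proof (rule bounded_linear_intro[where K = 1])
      show "single n (v + w) = single n v + single n w" for v w :: 'a
        by (rule ell2_eqI) (simp add: single.rep_eq)
      show "single n (r *\<^sub>R v) = r *\<^sub>R single n v" for r and v :: 'a
        by (rule ell2_eqI) (simp add: single.rep_eq)
    qed (simp add: norm_single)
    then show "bounded_linear (\<lambda>v. E (single n v))" by (rule bounded_linear_compose[OF E])
  qed
  then have e: "e n m v = coord (E (single n v)) m" for n m v
    unfolding e_def by (simp add: bounded_linear_Blinfun_apply)
  have amp_single: "amplify b (single n v) = single n (b v)" for b n and v :: 'a
    by (rule ell2_eqI) (simp add: single.rep_eq)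
  have be: "b o\<^sub>L e n m = e n m o\<^sub>L b" if "b \<in> A" for b n m
    by (rule blinfun_eqI) (simp add: e amp_single[symmetric] comm[OF that])
  have "e n m \<in> commutant A" for n m
  proof -
    \<comment> \<open>\<open>E\<close> was built as a real projection; complex linearity of its
      entries follows from their commuting with the scalars contained in \<open>A\<close>.\<close>
    have "e n m (c *\<^sub>C v) = c *\<^sub>C e n m v" for c v
      using be[OF unital_star_algebra_cscalar[OF A], of c n m] by (metis blinfun_apply_blinfun_compose cscalar_apply)
    then show ?thesis using be by (simp add: commutant_def bounded_ops_def)
  qed
  then have ae: "e n m o\<^sub>L a = a o\<^sub>L e n m" for n m
    using a by (auto simp: commutant_def)
  have "amplify a (E g) = E (amplify a g)" for g
  proof (rule ell2_bounded_linear_eqI[of "\<lambda>g. amplify a (E g)" "\<lambda>g. E (amplify a g)"])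
    show "bounded_linear (\<lambda>g. amplify a (E g))" "bounded_linear (\<lambda>g. E (amplify a g))"
      by (rule bounded_linear_compose[OF bounded_linear_amplify E],
          rule bounded_linear_compose[OF E bounded_linear_amplify])
    show "amplify a (E (single n v)) = E (amplify a (single n v))" for n v
    proof (rule ell2_eqI)
      show "coord (amplify a (E (single n v))) m = coord (E (amplify a (single n v))) m" for m
        using arg_cong[OF ae, of "\<lambda>T. blinfun_apply T v" n m] by (simp add: amp_single e)
    qed
  qed
  then have "amplify a (E f) = E (amplify a f)" .
  moreover have "f \<in> K"
  proof -
    have "amplify id_blinfun f = f" by (rule ell2_eqI) simp
    then have "f \<in> (\<lambda>b. amplify b f) ` A" using unital_star_algebraD(2)[OF A] by (metis image_eqI)
    then show ?thesis unfolding K_def by (rule subsetD[OF closure_subset])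
  qed
  ultimately have "amplify a f = E (amplify a f)" by (simp add: E_def orth_proj_fixes[OF K])
  also have "\<dots> \<in> K" unfolding E_def by (rule orth_proj_in[OF K])
  finally show ?thesis unfolding K_def .
qed

section \<open>Tracial algebras in standard form\<close>

text \<open>What the argument takes from the ultrapower once sequences are forgotten: a cyclic
  vector whose vector state is a trace.\<close>

locale cyclic_trace =
  fixes P :: "'k::chilbert_space op set" and \<Omega> :: 'k
  assumes star: "unital_star_algebra P"
    and tracial: "S \<in> P \<Longrightarrow> T \<in> P \<Longrightarrow> cinner (S (T \<Omega>)) \<Omega> = cinner (T (S \<Omega>)) \<Omega>"
    and cyclic: "closure ((\<lambda>a. blinfun_apply a \<Omega>) ` P) = UNIV"
begin

lemma bounded: "a \<in> P \<Longrightarrow> a \<in> bounded_ops"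
  using star by (auto dest: unital_star_algebraD)

text \<open>The adjoint is isometric in 2-norm. This is the source of the bound for right
  multiplication and of the convergence of adjoints.\<close>

lemma norm_adj_\<Omega>: 
  assumes "a \<in> P" shows "norm (adj a \<Omega>) = norm (a \<Omega>)"
proof -
  have a: "a \<in> bounded_ops" "adj a \<in> P" using assms star bounded by (auto intro: unital_star_algebraD)
  have "cinner (adj a \<Omega>) (adj a \<Omega>) = cinner (a (adj a \<Omega>)) \<Omega>"
    using cinner_adj[OF a(1)] by simp
  also have "\<dots> = cinner (adj a (a \<Omega>)) \<Omega>" by (rule tracial) fact+
  also have "\<dots> = cinner (a \<Omega>) (a \<Omega>)"
    using cinner_adj[OF bounded[OF a(2)], of "a \<Omega>" \<Omega>] adj_adj[OF a(1)] by simp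
  finally have "(norm (adj a \<Omega>))\<^sup>2 = (norm (a \<Omega>))\<^sup>2" unfolding cinner_self of_real_eq_iff .
  then show ?thesis by (simp add: power2_eq_iff_nonneg)
qed

lemma bounded_linear_eqI:
  assumes F: "bounded_linear F" and G: "bounded_linear G"
    and eq: "\<And>a. a \<in> P \<Longrightarrow> F (a \<Omega>) = (G (a \<Omega>) :: 'b::real_normed_vector)"
  shows "F v = G v"
proof -
  have "closed {v. F v = G v}"
    using F G by (intro closed_Collect_eq linear_continuous_on)
  then have "closure ((\<lambda>a. blinfun_apply a \<Omega>) ` P) \<subseteq> {v. F v = G v}"
    using eq by (intro closure_minimal) auto
  then show ?thesis using cyclic by auto
qed

text \<open>Shows that the definite description in \<open>right_mult\<close> has a value. Passing to
  adjoints turns right multiplication by \<open>b\<close> into left multiplication by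
  \<open>adj b\<close>, which is bounded; cyclicity then permits extension by continuity.\<close>

lemma right_mult_apply:
  assumes b: "b \<in> P" and x: "x \<in> P"
  shows "right_mult P \<Omega> b (x \<Omega>) = x (b \<Omega>)"
proof -
  define G where "G = (\<lambda>x. (blinfun_apply x \<Omega>, blinfun_apply x (blinfun_apply b \<Omega>))) ` P"
  have "subspace G"
    unfolding subspace_def
  proof safe
    have "0 \<in> P" using unital_star_algebra_diff[OF star x x] by simp
    then show "0 \<in> G" unfolding G_def by (intro image_eqI[of _ _ 0]) (simp_all add: zero_prod_def)
  next
    fix v w v' w' assume "(v, w) \<in> G" "(v', w') \<in> G"
    then show "(v, w) + (v', w') \<in> G" 
      using unital_star_algebraD(3)[OF star] by (force simp: G_def blinfun.add_left)
  next
    fix v w and r :: real assume "(v, w) \<in> G"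
    then show "r *\<^sub>R (v, w) \<in> G" 
      using unital_star_algebra_scaleR[OF star] by (force simp: G_def blinfun.scaleR_left)
  qed
  moreover have "norm w \<le> norm (adj b) * norm v" if vw: "(v, w) \<in> G" for v w
  proof -
    obtain y :: "'k op" where y: "y \<in> P" "v = y \<Omega>" "w = y (b \<Omega>)" using vw unfolding G_def by blast
    have "norm w = norm (adj (y o\<^sub>L b) \<Omega>)"
      using norm_adj_\<Omega>[OF unital_star_algebraD(4)[OF star y(1) b]] y by simp
    also have "\<dots> = norm (adj b (adj y \<Omega>))" using bounded y(1) b by (simp add: adj_compose)
    also have "\<dots> \<le> norm (adj b) * norm (adj y \<Omega>)" by (rule norm_blinfun)
    also have "\<dots> = norm (adj b) * norm v" using y by (simp add: norm_adj_\<Omega>)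
    finally show ?thesis .
  qed
  moreover have "closure (fst ` G) = UNIV" using cyclic by (simp add: G_def image_image)
  ultimately obtain R :: "'k op" where R: "\<forall>(v, w)\<in>G. R v = w" using bounded_extension by blast
  then have R': "\<forall>y\<in>P. R (blinfun_apply y \<Omega>) = (y o\<^sub>L b) \<Omega>" by (auto simp: G_def)
  have "right_mult P \<Omega> b = R"
    unfolding right_mult_def
  proof (rule the_equality)
    show "\<forall>y\<in>P. blinfun_apply R (blinfun_apply y \<Omega>) = blinfun_apply (y o\<^sub>L b) \<Omega>" by (rule R')
    show "Q = R" if "\<forall>y\<in>P. blinfun_apply Q (blinfun_apply y \<Omega>) = blinfun_apply (y o\<^sub>L b) \<Omega>" for Q
      by (rule blinfun_eqI, rule bounded_linear_eqI[OF blinfun.bounded_linear_right blinfun.bounded_linear_right])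
         (simp add: that R')
  qed
  then show ?thesis using R' x by simp
qed

lemma right_mult_left_mult:
  assumes "b \<in> P" "a \<in> P"
  shows "right_mult P \<Omega> b (a v) = a (right_mult P \<Omega> b v)"
proof (rule bounded_linear_eqI[of "\<lambda>v. right_mult P \<Omega> b (a v)" "\<lambda>v. a (right_mult P \<Omega> b v)"])
  show "right_mult P \<Omega> b (a (x \<Omega>)) = a (right_mult P \<Omega> b (x \<Omega>))" if "x \<in> P" for x
    using right_mult_apply[OF assms(1), of "a o\<^sub>L x"] right_mult_apply[OF assms(1) that]
      unital_star_algebraD(4)[OF star assms(2) that] by simp
qed (intro bounded_linear_compose[OF blinfun.bounded_linear_right] blinfun.bounded_linear_right)+

lemma right_mult_\<Omega>: "b \<in> P \<Longrightarrow> right_mult P \<Omega> b \<Omega> = b \<Omega>"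
  using right_mult_apply[OF _ unital_star_algebraD(2)[OF star], of b] by simp

text \<open>With y* the adjoint of \<open>y\<close>, traciality moves \<open>b\<close> cyclically
  from the right end of y* x b to its left end, where its adjoint passes to the other
  argument.\<close>

lemma right_mult_adjoint:
  assumes b: "b \<in> P"
  shows "inner (right_mult P \<Omega> b v) w = inner v (right_mult P \<Omega> (adj b) w)"
proof -
  have b': "adj b \<in> P" using star b by (rule unital_star_algebraD)
  have 1: "inner (right_mult P \<Omega> b (x \<Omega>)) (y \<Omega>) = inner (x \<Omega>) (right_mult P \<Omega> (adj b) (y \<Omega>))"
    if x: "x \<in> P" and y: "y \<in> P" for x y
  proof -
    have y': "adj y \<in> P" using star y by (rule unital_star_algebraD)
    have "cinner (x (b \<Omega>)) (y \<Omega>) = cinner ((adj y o\<^sub>L x) (b \<Omega>)) \<Omega>"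
      using cinner_adj[OF bounded[OF y'], of "x (b \<Omega>)" \<Omega>] adj_adj[OF bounded[OF y]] by simp
    also have "\<dots> = cinner (b ((adj y o\<^sub>L x) \<Omega>)) \<Omega>"
      using unital_star_algebraD(4)[OF star y' x] by (intro tracial b)
    also have "\<dots> = cinner (x \<Omega>) (y (adj b \<Omega>))"
      using cinner_adj[OF bounded[OF y'], of "x \<Omega>" "adj b \<Omega>"] adj_adj[OF bounded[OF y]]
      by (simp add: cinner_adj[OF bounded[OF b]])
    finally show ?thesis
      by (simp add: right_mult_apply[OF b x] right_mult_apply[OF b' y] inner_eq_Re_cinner)
  qed
  have 2: "inner (right_mult P \<Omega> b (x \<Omega>)) w = inner (x \<Omega>) (right_mult P \<Omega> (adj b) w)" if "x \<in> P" for x w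
    by (rule bounded_linear_eqI[of "inner (right_mult P \<Omega> b (x \<Omega>))" "\<lambda>w. inner (x \<Omega>) (right_mult P \<Omega> (adj b) w)"])
       (intro bounded_linear_inner_right bounded_linear_inner_right_comp blinfun.bounded_linear_right 1 that)+
  show ?thesis
    by (rule bounded_linear_eqI[of "\<lambda>v. inner (right_mult P \<Omega> b v) w" "\<lambda>v. inner v (right_mult P \<Omega> (adj b) w)"])
       (intro bounded_linear_inner_left bounded_linear_inner_left_comp blinfun.bounded_linear_right 2)+
qed

text \<open>The approximants need not be bounded in operator norm, so they need not converge
  strongly. They converge on each vector \<open>b \<Omega>\<close> by right multiplication, and so
  do their adjoints; matrix coefficients between such vectors are enough to test
  commutation.\<close>

lemma mem_double_commutant:
  assumes A: "A \<subseteq> P" "\<And>a. a \<in> A \<Longrightarrow> adj a \<in> A" and x: "x \<in> P"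
    and cl: "x \<Omega> \<in> closure ((\<lambda>a. blinfun_apply a \<Omega>) ` A)"
  shows "x \<in> commutant (commutant A)"
proof -
  obtain v where "\<forall>n. v n \<in> (\<lambda>a. blinfun_apply a \<Omega>) ` A" and v: "v \<longlonglongrightarrow> x \<Omega>"
    using cl unfolding closure_sequential by blast
  then have "\<forall>n. \<exists>a\<in>A. v n = a \<Omega>" by blast
  then obtain q where q: "\<And>n. q n \<in> A" "\<And>n. v n = q n \<Omega>" by metis
  have qP: "q n \<in> P" for n using q A by blast
  have "v = (\<lambda>n. q n \<Omega>)" by (rule ext) (rule q(2))
  then have lim: "(\<lambda>n. q n \<Omega>) \<longlonglongrightarrow> x \<Omega>" using v by simp
  have lim': "(\<lambda>n. adj (q n) \<Omega>) \<longlonglongrightarrow> adj x \<Omega>"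
  proof (rule LIM_zero_cancel, rule tendsto_norm_zero_cancel)
    have "norm (adj (q n) \<Omega> - adj x \<Omega>) = norm (q n \<Omega> - x \<Omega>)" for n
    proof -
      have d: "q n - x \<in> P" by (rule unital_star_algebra_diff[OF star qP x])
      have "adj (q n) = adj (q n - x) + adj x"
        using adj_add[OF bounded[OF d] bounded[OF x]] by simp
      then show ?thesis using norm_adj_\<Omega>[OF d] by (simp add: blinfun.add_left blinfun.diff_left)
    qed
    then show "(\<lambda>n. norm (adj (q n) \<Omega> - adj x \<Omega>)) \<longlonglongrightarrow> 0"
      using tendsto_norm_zero[OF LIM_zero[OF lim]] by simp
  qed
  have right: "(\<lambda>n. a n (b \<Omega>)) \<longlonglongrightarrow> l (b \<Omega>)"
    if "\<And>n. a n \<in> P" "l \<in> P" "(\<lambda>n. a n \<Omega>) \<longlonglongrightarrow> l \<Omega>" "b \<in> P" for a l b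
    using blinfun.tendsto[OF tendsto_const[of "right_mult P \<Omega> b"] that(3)] that
    by (simp add: right_mult_apply)
  have adjP: "adj a \<in> P" if "a \<in> P" for a using star that by (rule unital_star_algebraD)
  have "T o\<^sub>L x = x o\<^sub>L T" if T: "T \<in> commutant A" for T
  proof -
    have Tq: "q n o\<^sub>L T = T o\<^sub>L q n" for n using T q(1) by (simp add: commutant_def)
    \<comment> \<open>\<open>T (b \<Omega>)\<close> is an arbitrary vector, where convergence of
      \<open>q n\<close> is unknown; the adjoint moves \<open>q n\<close> to
      \<open>c \<Omega>\<close>, where it is known.\<close>
    have bc: "inner (T (x (b \<Omega>))) (c \<Omega>) = inner (x (T (b \<Omega>))) (c \<Omega>)" if "b \<in> P" "c \<in> P" for b c
    proof -
      have "(\<lambda>n. inner (T (q n (b \<Omega>))) (c \<Omega>)) \<longlonglongrightarrow> inner (T (x (b \<Omega>))) (c \<Omega>)"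
        by (intro tendsto_intros blinfun.tendsto right qP x lim that)
      moreover have "inner (T (q n (b \<Omega>))) (c \<Omega>) = inner (T (b \<Omega>)) (adj (q n) (c \<Omega>))" for n
        using arg_cong[OF Tq[symmetric], of "\<lambda>T. blinfun_apply T (b \<Omega>)" n] inner_adj[OF bounded[OF qP]] by simp
      moreover have "(\<lambda>n. inner (T (b \<Omega>)) (adj (q n) (c \<Omega>))) \<longlonglongrightarrow> inner (T (b \<Omega>)) (adj x (c \<Omega>))"
        by (intro tendsto_intros right lim' adjP qP x that)
      ultimately show ?thesis
        using LIMSEQ_unique inner_adj[OF bounded[OF x]] by fastforce
    qed
    have "inner ((T o\<^sub>L x) v) w = inner ((x o\<^sub>L T) v) w" for v w
    proof (rule bounded_linear_eqI[of "\<lambda>v. inner ((T o\<^sub>L x) v) w" "\<lambda>v. inner ((x o\<^sub>L T) v) w"])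
      show "inner ((T o\<^sub>L x) (b \<Omega>)) w = inner ((x o\<^sub>L T) (b \<Omega>)) w" if "b \<in> P" for b
        by (rule bounded_linear_eqI[of "inner ((T o\<^sub>L x) (b \<Omega>))" "inner ((x o\<^sub>L T) (b \<Omega>))"])
           (use bc that in \<open>simp_all add: bounded_linear_inner_right\<close>)
    qed (intro bounded_linear_inner_left_comp blinfun.bounded_linear_right)+
    then show ?thesis by (intro blinfun_eqI vector_eq_rdot[THEN iffD1]) blast
  qed
  then show ?thesis using bounded[OF x] by (simp add: commutant_def)
qed

end

section \<open>The consequence of disjointness\<close>

text \<open>Takes a set of generators so that the spans of the \<open>x i\<close>, of
  \<open>s\<close> and of \<open>x j + r s\<close> are all instances.\<close>

definition bimodule_span :: "'k::chilbert_space \<Rightarrow> 'k op set \<Rightarrow> 'k op set \<Rightarrow> 'k set" where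
  "bimodule_span \<Omega> N Y = closed_cspan {blinfun_apply (a o\<^sub>L y o\<^sub>L b) \<Omega> | a y b. a \<in> N \<and> y \<in> Y \<and> b \<in> N}"

lemma bimodule_span_eq_closure_span:
  assumes "unital_star_algebra N"
  shows "bimodule_span \<Omega> N Y = closure (span {blinfun_apply (a o\<^sub>L y o\<^sub>L b) \<Omega> | a y b. a \<in> N \<and> y \<in> Y \<and> b \<in> N})"
    (is "_ = closure (span ?G)")
proof -
  have "c *\<^sub>C v \<in> ?G" if v: "v \<in> ?G" for c v
  proof -
    obtain a y b where "a \<in> N" "y \<in> Y" "b \<in> N" and eq: "v = (a o\<^sub>L y o\<^sub>L b) \<Omega>" using v by blast
    moreover have "c *\<^sub>C v = ((cscalar c o\<^sub>L a) o\<^sub>L y o\<^sub>L b) \<Omega>" by (simp add: eq)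
    ultimately show ?thesis using unital_star_algebraD(6)[OF assms] by blast
  qed
  then show ?thesis unfolding bimodule_span_def by (rule closed_cspan_eq_closure_span)
qed

lemma
  shows subspace_bimodule_span: "subspace (bimodule_span \<Omega> N Y)"
    and closed_bimodule_span: "closed (bimodule_span \<Omega> N Y)"
    and bimodule_span_scaleC: "v \<in> bimodule_span \<Omega> N Y \<Longrightarrow> c *\<^sub>C v \<in> bimodule_span \<Omega> N Y"
  unfolding bimodule_span_def
  by (auto intro: csubspaceD csubspace_closed_cspan closed_closed_cspan csubspace_scaleC)

lemma bimodule_span_gen:
  "a \<in> N \<Longrightarrow> y \<in> Y \<Longrightarrow> b \<in> N \<Longrightarrow> blinfun_apply a (blinfun_apply y (blinfun_apply b \<Omega>)) \<in> bimodule_span \<Omega> N Y"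
  unfolding bimodule_span_def
  by (rule subsetD[OF closed_cspan_superset]) force

lemma bimodule_span_invariant:
  assumes N: "unital_star_algebra N" and F: "bounded_linear F"
    and gen: "\<And>a y b. a \<in> N \<Longrightarrow> y \<in> Y \<Longrightarrow> b \<in> N \<Longrightarrow>
      F (blinfun_apply a (blinfun_apply y (blinfun_apply b \<Omega>))) \<in> bimodule_span \<Omega> N Y"
    and v: "v \<in> bimodule_span \<Omega> N Y"
  shows "F v \<in> bimodule_span \<Omega> N Y"
proof -
  let ?G = "{blinfun_apply (a o\<^sub>L y o\<^sub>L b) \<Omega> | a y b. a \<in> N \<and> y \<in> Y \<and> b \<in> N}"
  have "F ` closure (span ?G) \<subseteq> closure (F ` span ?G)"
    by (rule closure_bounded_linear_image_subset[OF F])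
  also have "F ` span ?G = span (F ` ?G)"
    by (rule linear_span_image[OF bounded_linear.linear[OF F], symmetric])
  also have "closure (span (F ` ?G)) \<subseteq> bimodule_span \<Omega> N Y"
    using gen by (intro closure_span_minimal subspace_bimodule_span closed_bimodule_span) auto
  finally show ?thesis using v by (auto simp: bimodule_span_eq_closure_span[OF N, of \<Omega> Y])
qed

section \<open>Projections onto bimodules and their intertwiners\<close>

context cyclic_trace
begin

context
  fixes N assumes N: "unital_star_algebra N" "N \<subseteq> P"
begin

lemma bimodule_span_left: 
  assumes "c \<in> N" "v \<in> bimodule_span \<Omega> N Y" shows "blinfun_apply c v \<in> bimodule_span \<Omega> N Y"
proof (rule bimodule_span_invariant[OF N(1) blinfun.bounded_linear_right _ assms(2)])
  fix a y b assume "a \<in> N" "y \<in> Y" "b \<in> N"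
  then show "c (a (y (b \<Omega>))) \<in> bimodule_span \<Omega> N Y"
    using bimodule_span_gen[OF unital_star_algebraD(4)[OF N(1) assms(1)], of a y Y b \<Omega>] by simp
qed

lemma bimodule_span_right: 
  assumes "Y \<subseteq> P" "c \<in> N" "v \<in> bimodule_span \<Omega> N Y"
  shows "right_mult P \<Omega> c v \<in> bimodule_span \<Omega> N Y"
proof (rule bimodule_span_invariant[OF N(1) blinfun.bounded_linear_right _ assms(3)])
  fix a y b assume *: "a \<in> N" "y \<in> Y" "b \<in> N"
  then have "right_mult P \<Omega> c (a (y (b \<Omega>))) = a (y ((b o\<^sub>L c) \<Omega>))"
    using N assms by (auto simp: right_mult_left_mult right_mult_\<Omega> subset_iff)
  then show "right_mult P \<Omega> c (a (y (b \<Omega>))) \<in> bimodule_span \<Omega> N Y"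
    using bimodule_span_gen[OF *(1,2) unital_star_algebraD(4)[OF N(1) *(3) assms(2)]] by simp
qed

text \<open>The span is invariant under \<open>c\<close> and \<open>adj c\<close> on both sides, and
  under scalars, so its projection commutes with all of these.\<close>

lemma orth_proj_bimodule_span:
  assumes "Y \<subseteq> P"
  defines "Q \<equiv> orth_proj (bimodule_span \<Omega> N Y)"
  shows "c \<in> N \<Longrightarrow> Q (blinfun_apply c v) = c (Q v)"
    "c \<in> N \<Longrightarrow> Q (right_mult P \<Omega> c v) = right_mult P \<Omega> c (Q v)"
    "Q (z *\<^sub>C v) = z *\<^sub>C Q v"
proof -
  note V = subspace_bimodule_span[of \<Omega> N Y] closed_bimodule_span[of \<Omega> N Y]
  assume c: "c \<in> N"
  then have c': "adj c \<in> N" "c \<in> P" using N by (auto intro: unital_star_algebraD)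
  show "Q (c v) = c (Q v)"
    unfolding Q_def
    by (rule orth_proj_commute[OF V inner_adj[OF bounded[OF c'(2)]]])
       (simp_all add: bimodule_span_left c c' blinfun.diff_right)
  show "Q (right_mult P \<Omega> c v) = right_mult P \<Omega> c (Q v)"
    unfolding Q_def
    by (rule orth_proj_commute[OF V right_mult_adjoint[OF c'(2)]])
       (simp_all add: bimodule_span_right assms(1) c c' blinfun.diff_right)
next
  note V = subspace_bimodule_span[of \<Omega> N Y] closed_bimodule_span[of \<Omega> N Y]
  show "Q (z *\<^sub>C v) = z *\<^sub>C Q v"
    unfolding Q_def
    by (rule orth_proj_commute[OF V inner_scaleC]) (simp_all add: bimodule_span_scaleC scaleC_diff_right)
qed

text \<open>If \<open>x\<^sub>j \<Omega>\<close> is not in the closed span of \<open>N (x\<^sub>j + r s) N\<close>, then compressing the projection onto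
  that span gives a nonzero intertwiner \<open>T\<close> from the bimodule of \<open>x\<close> to that of \<open>s\<close>, which is coarse;
  the map \<open>|T| z \<mapsto> T z\<close> then contradicts disjointness.\<close>

theorem mem_bimodule_span_if_disjoint:
  assumes C: "coarse_bimodule P \<Omega> N tens C"
    and disj: "disjoint_bimodules N (L2_NYN P \<Omega> N d x) C"
    and x: "\<And>i. i < d \<Longrightarrow> x i \<in> P" and j: "j < d" and s: "s \<in> P"
    and ortho: "inner (x j \<Omega>) (s \<Omega>) = 0"
    and coarse: "\<And>a b c e. a \<in> N \<Longrightarrow> b \<in> N \<Longrightarrow> c \<in> N \<Longrightarrow> e \<in> N \<Longrightarrow>
      cinner (a (s (b \<Omega>))) (c (s (e \<Omega>))) = complex_of_real \<kappa> * (cinner (a \<Omega>) (c \<Omega>) * cinner (b \<Omega>) (e \<Omega>))"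
    and \<kappa>: "\<kappa> > 0"
  shows "x j \<Omega> \<in> bimodule_span \<Omega> N {x j + r *\<^sub>R s}"
proof (rule ccontr)
  define X where "X = x ` {..<d}"
  have X: "X \<subseteq> P" using x by (auto simp: X_def)
  define H1 where "H1 = bimodule_span \<Omega> N X"
  define H2 where "H2 = bimodule_span \<Omega> N {s}"
  define K where "K = bimodule_span \<Omega> N {x j + r *\<^sub>R s}"
  note H1 = subspace_bimodule_span[of \<Omega> N X, folded H1_def] closed_bimodule_span[of \<Omega> N X, folded H1_def]
  note H2 = subspace_bimodule_span[of \<Omega> N "{s}", folded H2_def] closed_bimodule_span[of \<Omega> N "{s}", folded H2_def]
  note K = subspace_bimodule_span[of \<Omega> N "{x j + r *\<^sub>R s}", folded K_def]
    closed_bimodule_span[of \<Omega> N "{x j + r *\<^sub>R s}", folded K_def]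
  note idN = unital_star_algebraD(2)[OF N(1)]
  have L2: "bspace (L2_NYN P \<Omega> N d x) = H1"
    unfolding L2_NYN_def H1_def bimodule_span_def X_def bimodule.simps
    by (rule arg_cong[of _ _ closed_cspan]) auto
  define P1 where "P1 = orth_proj H1"
  define P2 where "P2 = orth_proj H2"
  define E where "E = orth_proj K"
  assume "x j \<Omega> \<notin> bimodule_span \<Omega> N {x j + r *\<^sub>R s}"
  moreover have "s \<Omega> \<in> H2" using bimodule_span_gen[OF idN _ idN, of s "{s}" \<Omega>] by (simp add: H2_def)
  moreover have "x j \<Omega> + r *\<^sub>R s \<Omega> \<in> K"
    using bimodule_span_gen[OF idN _ idN, of "x j + r *\<^sub>R s" "{x j + r *\<^sub>R s}" \<Omega>]
    by (simp add: K_def blinfun.add_left blinfun.scaleR_left)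
  ultimately have "P2 (E (x j \<Omega>)) \<noteq> 0"
    using mem_if_orth_proj_orthogonal[OF K H2 _ ortho] unfolding P2_def E_def K_def by blast
  moreover have "x j \<Omega> \<in> H1"
    using bimodule_span_gen[OF idN _ idN, of "x j" X \<Omega>] j by (simp add: H1_def X_def)
  ultimately have nz: "P2 (E (P1 (x j \<Omega>))) \<noteq> 0" by (simp add: P1_def orth_proj_fixes[OF H1])
  define T where "T = P2 o\<^sub>L E o\<^sub>L P1"
  define T' where "T' = P1 o\<^sub>L E o\<^sub>L P2"
  have TT': "inner (T v) w = inner v (T' w)" for v w
    by (simp add: T_def T'_def P1_def P2_def E_def orth_proj_symmetric H1 H2 K)
  have nT: "norm (T' v) \<le> norm v" "norm (T v) \<le> norm v" for v
    unfolding T'_def T_def P1_def P2_def E_def blinfun_apply_blinfun_compose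
    by (rule order_trans[OF norm_orth_proj_le[OF H1] order_trans[OF norm_orth_proj_le[OF K] norm_orth_proj_le[OF H2]]],
        rule order_trans[OF norm_orth_proj_le[OF H2] order_trans[OF norm_orth_proj_le[OF K] norm_orth_proj_le[OF H1]]])
  \<comment> \<open>\<open>T'\<close> is the adjoint of \<open>T\<close>, so \<open>A\<close> is a
    positive contraction, \<open>1 - A\<close> has norm at most 1, and the root \<open>R\<close>
    below is the modulus of \<open>T\<close>.\<close>
  define A where "A = T' o\<^sub>L T"
  have symA: "inner (A v) w = inner v (A w)" for v w
    using TT'[of w "T v"] by (simp add: A_def TT'[symmetric] inner_commute)
  have "norm (id_blinfun - A) \<le> 1"
  proof (rule norm_blinfun_bound)
    fix v
    have "(norm ((id_blinfun - A) v))\<^sup>2 = (norm v)\<^sup>2 - 2 * inner v (A v) + (norm (A v))\<^sup>2"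
      unfolding power2_norm_eq_inner
      by (simp add: blinfun.diff_left inner_diff_left inner_diff_right inner_commute)
    also have "inner v (A v) = (norm (T v))\<^sup>2"
      unfolding power2_norm_eq_inner by (simp add: A_def TT')
    also have "(norm (A v))\<^sup>2 \<le> (norm (T v))\<^sup>2"
      using nT(1)[of "T v"] by (simp add: A_def power_mono)
    finally have "(norm ((id_blinfun - A) v))\<^sup>2 \<le> (norm v)\<^sup>2"
      using zero_le_power2[of "norm (T v)"] by linarith
    then show "norm ((id_blinfun - A) v) \<le> 1 * norm v"
      unfolding mult_1 by (rule power2_le_imp_le[OF _ norm_ge_zero])
  qed simp
  then obtain R where R: "R o\<^sub>L R = A" "\<And>v w. inner (R v) w = inner v (R w)"
    "\<And>D. D o\<^sub>L A = A o\<^sub>L D \<Longrightarrow> D o\<^sub>L R = R o\<^sub>L D"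
    using operator_sqrt_exists[OF _ symA] by blast
  \<comment> \<open>\<open>P1\<close> commutes with \<open>A\<close> and therefore with its root,
    which keeps the vectors \<open>R (P1 v)\<close> inside \<open>H1\<close>.\<close>
  have P1A: "P1 o\<^sub>L A = A o\<^sub>L P1"
    by (rule blinfun_eqI) (simp add: A_def T_def T'_def P1_def orth_proj_fixes[OF H1] orth_proj_in[OF H1])
  have TP1: "T (P1 v) = T v" for v
    by (simp add: T_def P1_def orth_proj_fixes[OF H1] orth_proj_in[OF H1])
  have RP1: "R (P1 v) \<in> H1" for v
    using arg_cong[OF R(3)[OF P1A], of "\<lambda>T. blinfun_apply T v"] orth_proj_in[OF H1, of "R v"]
    by (simp add: P1_def)
  have inT: "T v \<in> H2" for v by (simp add: T_def P2_def orth_proj_in[OF H2])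
  \<comment> \<open>The Gram identity behind polar decomposition: the modulus and \<open>T\<close>
    have the same inner products.\<close>
  have Rin: "inner (R (P1 v)) (R (P1 w)) = inner (T v) (T w)" for v w
  proof -
    have "inner (R (P1 v)) (R (P1 w)) = inner (P1 v) (A (P1 w))"
      using arg_cong[OF R(1), of "\<lambda>T. blinfun_apply T (P1 w)"] by (simp add: R(2))
    also have "\<dots> = inner (T v) (T w)" by (simp add: A_def TT'[symmetric] TP1)
    finally show ?thesis .
  qed
  \<comment> \<open>Commutation with the three projections passes at once to \<open>T\<close>, to
    \<open>A\<close> and to \<open>R\<close>; both actions of \<open>N\<close> and the complex
    scalars qualify.\<close>
  define intertwiner where "intertwiner D \<longleftrightarrow> (\<forall>v. P1 (D v) = D (P1 v) \<and> P2 (D v) = D (P2 v) \<and> E (D v) = D (E v))" for D :: "'k op"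
  have RD: "R (P1 (D v)) = D (R (P1 v))" and TD: "T (D v) = D (T v)" if "intertwiner D" for D v
  proof -
    show "T (D v) = D (T v)" using that by (simp add: intertwiner_def T_def)
    have "D o\<^sub>L A = A o\<^sub>L D"
      using that by (intro blinfun_eqI) (simp add: intertwiner_def A_def T_def T'_def)
    from arg_cong[OF R(3)[OF this], of "\<lambda>T. blinfun_apply T (P1 v)"]
    show "R (P1 (D v)) = D (R (P1 v))" using that by (simp add: intertwiner_def)
  qed
  have sP: "{s} \<subseteq> P" "{x j + r *\<^sub>R s} \<subseteq> P"
    using s x[OF j] by (auto intro: unital_star_algebraD[OF star] unital_star_algebra_scaleR[OF star])
  have iL: "intertwiner c" and iR: "intertwiner (right_mult P \<Omega> c)" if "c \<in> N" for c
    unfolding intertwiner_def P1_def P2_def E_def H1_def H2_def K_def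
    using that orth_proj_bimodule_span[OF X] orth_proj_bimodule_span[OF sP(1)] orth_proj_bimodule_span[OF sP(2)]
    by simp_all
  have iC: "intertwiner (cscalar z)" for z
    unfolding intertwiner_def P1_def P2_def E_def H1_def H2_def K_def
    using orth_proj_bimodule_span[OF X] orth_proj_bimodule_span[OF sP(1)] orth_proj_bimodule_span[OF sP(2)]
    by simp

  \<comment> \<open>Equal Gram data map the closed span of \<open>N s N\<close> isometrically into
    the coarse bimodule; \<open>sqrt \<kappa>\<close> absorbs the variance in
    \<open>coarse\<close>.\<close>
  define e1 :: "'k op \<times> 'k op \<Rightarrow> 'k" where "e1 = (\<lambda>(a, b). blinfun_apply a (s (blinfun_apply b \<Omega>)))"
  define f1 where "f1 = (\<lambda>(a, b). sqrt \<kappa> *\<^sub>R tens (blinfun_apply a \<Omega>) (blinfun_apply b \<Omega>))"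
  have inL: "a \<Omega> \<in> L2_space N \<Omega>" if "a \<in> N" for a
    unfolding L2_space_def using that by (intro subsetD[OF closed_cspan_superset] imageI)
  have ht: "hilbert_tensor (L2_space N \<Omega>) (L2_space N \<Omega>) tens"
    and bC: "bspace C = closed_cspan {tens \<xi> \<eta> | \<xi> \<eta>. \<xi> \<in> L2_space N \<Omega> \<and> \<eta> \<in> L2_space N \<Omega>}"
    and act: "\<And>a \<xi> \<eta>. a \<in> N \<Longrightarrow> \<xi> \<in> L2_space N \<Omega> \<Longrightarrow> \<eta> \<in> L2_space N \<Omega> \<Longrightarrow>
        lact C a (tens \<xi> \<eta>) = tens (a \<xi>) \<eta> \<and> ract C a (tens \<xi> \<eta>) = tens \<xi> (right_mult P \<Omega> a \<eta>)"
    using C unfolding coarse_bimodule_def by blast+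
  have tens_scale: "tens (z *\<^sub>C \<xi>) \<eta> = z *\<^sub>C tens \<xi> \<eta>"
    and tens_cinner: "\<xi>' \<in> L2_space N \<Omega> \<Longrightarrow> \<eta>' \<in> L2_space N \<Omega> \<Longrightarrow> cinner (tens \<xi> \<eta>) (tens \<xi>' \<eta>') = cinner \<xi> \<xi>' * cinner \<eta> \<eta>'"
    if "\<xi> \<in> L2_space N \<Omega>" "\<eta> \<in> L2_space N \<Omega>" for z \<xi> \<eta> \<xi>' \<eta>'
    using ht that unfolding hilbert_tensor_def by (elim conjE, simp)+
  have gram1: "inner (e1 p) (e1 q) = inner (f1 p) (f1 q)" if pq: "p \<in> N \<times> N" "q \<in> N \<times> N" for p q
  proof -
    obtain a b c e where "p = (a, b)" "q = (c, e)" "a \<in> N" "b \<in> N" "c \<in> N" "e \<in> N" using pq by blast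
    moreover from this have "inner (f1 p) (f1 q) = \<kappa> * inner (tens (a \<Omega>) (b \<Omega>)) (tens (c \<Omega>) (e \<Omega>))"
      using \<kappa> by (simp add: f1_def flip: mult.assoc)
    ultimately show ?thesis
      using coarse[of a b c e] by (simp add: e1_def inner_eq_Re_cinner tens_cinner inL)
  qed
  obtain U1 V1 W1 where
    V1: "subspace V1" "closed V1" "e1 ` (N \<times> N) \<subseteq> V1" "V1 \<subseteq> closure (span (e1 ` (N \<times> N)))" and
    W1: "subspace W1" "closed W1" "f1 ` (N \<times> N) \<subseteq> W1" "W1 \<subseteq> closure (span (f1 ` (N \<times> N)))" and
    U1: "U1 ` V1 = W1" "\<And>i. i \<in> N \<times> N \<Longrightarrow> U1 (e1 i) = f1 i"
      "\<And>v w. v \<in> V1 \<Longrightarrow> w \<in> V1 \<Longrightarrow> U1 (v + w) = U1 v + U1 w"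
      "\<And>v w. v \<in> V1 \<Longrightarrow> w \<in> V1 \<Longrightarrow> inner (U1 v) (U1 w) = inner v w"
      "\<forall>A B v. bounded_linear A \<longrightarrow> bounded_linear B \<longrightarrow>
       (\<forall>i\<in>N \<times> N. \<exists>j\<in>N \<times> N. A (e1 i) = e1 j \<and> B (f1 i) = f1 j) \<longrightarrow>
       v \<in> V1 \<longrightarrow> A v \<in> V1 \<and> U1 (A v) = B (U1 v)"
    by (rule gram_isometry[of "N \<times> N" e1 f1], rule gram1, assumption+) (rule that)
  have H2V1: "H2 \<subseteq> V1"
    unfolding H2_def bimodule_span_eq_closure_span[OF N(1)]
    using V1 by (intro closure_span_minimal) (force simp: e1_def)+
  have W1C: "W1 \<subseteq> bspace C"
  proof -
    have "csubspace (bspace C)" "closed (bspace C)"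
      unfolding bC by (rule csubspace_closed_cspan closed_closed_cspan)+
    moreover have "f1 p \<in> bspace C" if "p \<in> N \<times> N" for p
    proof -
      obtain a b where p: "p = (a, b)" "a \<in> N" "b \<in> N" using \<open>p \<in> N \<times> N\<close> by blast
      then have "tens (a \<Omega>) (b \<Omega>) \<in> bspace C"
        unfolding bC using inL by (intro subsetD[OF closed_cspan_superset]) blast
      then show ?thesis
        using \<open>csubspace (bspace C)\<close> by (simp add: p f1_def subspace_scale csubspaceD)
    qed
    ultimately have "closure (span (f1 ` (N \<times> N))) \<subseteq> bspace C"
      by (intro closure_span_minimal) (auto simp: csubspaceD)
    then show ?thesis using W1(4) by blast
  qed
  have U1L: "U1 (c v) = lact C c (U1 v)" if "c \<in> N" "v \<in> V1" for c v
  proof -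
    have "\<exists>j\<in>N \<times> N. c (e1 i) = e1 j \<and> lact C c (f1 i) = f1 j" if i: "i \<in> N \<times> N" for i
    proof -
      obtain a b where "i = (a, b)" "a \<in> N" "b \<in> N" using i by blast
      then show ?thesis
        using unital_star_algebraD(4)[OF N(1) \<open>c \<in> N\<close> \<open>a \<in> N\<close>]
        by (intro bexI[of _ "(c o\<^sub>L a, b)"]) (simp_all add: e1_def f1_def blinfun.scaleR_right act inL \<open>c \<in> N\<close>)
    qed
    then show ?thesis using U1(5)[rule_format, OF blinfun.bounded_linear_right blinfun.bounded_linear_right _ that(2)] by blast
  qed
  have U1R: "U1 (right_mult P \<Omega> c v) = ract C c (U1 v)" if "c \<in> N" "v \<in> V1" for c v
  proof -
    have "\<exists>j\<in>N \<times> N. right_mult P \<Omega> c (e1 i) = e1 j \<and> ract C c (f1 i) = f1 j" if i: "i \<in> N \<times> N" for i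
    proof -
      obtain a b where "i = (a, b)" "a \<in> N" "b \<in> N" using i by blast
      moreover from this \<open>c \<in> N\<close> have "a \<in> P" "b \<in> P" "c \<in> P" using N(2) by auto
      ultimately show ?thesis
        using unital_star_algebraD(4)[OF N(1) \<open>b \<in> N\<close> \<open>c \<in> N\<close>] s
        by (intro bexI[of _ "(a, b o\<^sub>L c)"])
           (simp_all add: e1_def f1_def blinfun.scaleR_right act inL \<open>c \<in> N\<close> right_mult_left_mult right_mult_\<Omega>)
    qed
    then show ?thesis using U1(5)[rule_format, OF blinfun.bounded_linear_right blinfun.bounded_linear_right _ that(2)] by blast
  qed
  \<comment> \<open>\<open>gram_isometry\<close> yields additivity and real inner products only; a
    complex scalar is absorbed into the left factor and so carries generators to generators.\<close>
  have U1C: "U1 (z *\<^sub>C v) = z *\<^sub>C U1 v" if "v \<in> V1" for z v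
  proof -
    have "\<exists>j\<in>N \<times> N. z *\<^sub>C (e1 i) = e1 j \<and> z *\<^sub>C (f1 i) = f1 j" if i: "i \<in> N \<times> N" for i
    proof -
      obtain a b where "i = (a, b)" "a \<in> N" "b \<in> N" using i by blast
      then show ?thesis
        using unital_star_algebraD(6)[OF N(1) \<open>a \<in> N\<close>]
        by (intro bexI[of _ "(cscalar z o\<^sub>L a, b)"])
           (simp_all add: e1_def f1_def scaleR_scaleC scaleC_scaleC mult.commute tens_scale inL)
    qed
    then show ?thesis using U1(5)[rule_format, OF bounded_linear_scaleC bounded_linear_scaleC _ that] by blast
  qed

  \<comment> \<open>The polar part, from the modulus applied to \<open>z\<close> to
    \<open>T z\<close>, followed by \<open>U1\<close>. Indexing by all vectors turns each
    intertwining relation, such as \<open>c (e2 z) = e2 (c z)\<close>, into the hypothesis of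
    \<open>gram_isometry\<close>; the closed domain and range are the two sub-bimodules
    sought.\<close>
  define e2 where "e2 z = R (P1 z)" for z
  define f2 where "f2 z = U1 (T z)" for z
  have gram2: "inner (e2 v) (e2 w) = inner (f2 v) (f2 w)" for v w
    using Rin U1(4) inT H2V1 by (auto simp: e2_def f2_def subset_iff)
  obtain U2 V2 W2 where
    V2: "subspace V2" "closed V2" "range e2 \<subseteq> V2" "V2 \<subseteq> closure (span (range e2))" and
    W2: "subspace W2" "closed W2" "range f2 \<subseteq> W2" "W2 \<subseteq> closure (span (range f2))" and
    U2: "U2 ` V2 = W2" "\<And>z. z \<in> UNIV \<Longrightarrow> U2 (e2 z) = f2 z"
      "\<And>v w. v \<in> V2 \<Longrightarrow> w \<in> V2 \<Longrightarrow> U2 (v + w) = U2 v + U2 w"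
      "\<And>v w. v \<in> V2 \<Longrightarrow> w \<in> V2 \<Longrightarrow> inner (U2 v) (U2 w) = inner v w"
      "\<forall>A B v. bounded_linear A \<longrightarrow> bounded_linear B \<longrightarrow>
       (\<forall>i\<in>UNIV. \<exists>j\<in>UNIV. A (e2 i) = e2 j \<and> B (f2 i) = f2 j) \<longrightarrow>
       v \<in> V2 \<longrightarrow> A v \<in> V2 \<and> U2 (A v) = B (U2 v)"
    by (rule gram_isometry[of UNIV e2 f2, OF gram2]) (rule that)
  have TV1: "T z \<in> V1" for z using inT H2V1 by blast
  have actL: "c v \<in> V2 \<and> U2 (c v) = lact C c (U2 v)" if "c \<in> N" "v \<in> V2" for c v
    using that(1) by (intro U2(5)[rule_format] blinfun.bounded_linear_right that(2) bexI[of _ "c _"] conjI)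
      (simp_all add: e2_def f2_def RD TD iL U1L TV1)
  have actR: "right_mult P \<Omega> c v \<in> V2 \<and> U2 (right_mult P \<Omega> c v) = ract C c (U2 v)" if "c \<in> N" "v \<in> V2" for c v
    using that(1) by (intro U2(5)[rule_format] blinfun.bounded_linear_right that(2) bexI[of _ "right_mult P \<Omega> c _"] conjI)
      (simp_all add: e2_def f2_def RD TD iR U1R TV1)
  have actC: "z *\<^sub>C v \<in> V2 \<and> U2 (z *\<^sub>C v) = z *\<^sub>C (U2 v)" if "v \<in> V2" for z v
    using RD[OF iC, of z] TD[OF iC, of z]
    by (intro U2(5)[rule_format] bounded_linear_scaleC that bexI[of _ "z *\<^sub>C _"] conjI)
      (simp_all add: e2_def f2_def U1C TV1)
  have "V2 \<subseteq> H1"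
    using V2(4) closure_span_minimal[OF _ H1, of "range e2"] RP1 by (auto simp: e2_def)
  then have sub1: "subbimodule_space N (L2_NYN P \<Omega> N d x) V2"
    using V2 actL actR actC unfolding subbimodule_space_def L2 csubspace_def by (simp add: L2_NYN_def)
  have "W2 \<subseteq> W1"
    using W2(4) closure_span_minimal[OF _ W1(1,2), of "range f2"] TV1 U1(1) by (auto simp: f2_def)
  moreover have "csubspace W2"
    using W2(1) actC unfolding csubspace_def U2(1)[symmetric] by (metis imageE imageI)
  moreover have "lact C c w \<in> W2 \<and> ract C c w \<in> W2" if "c \<in> N" "w \<in> W2" for c w
    using that actL actR unfolding U2(1)[symmetric] by (metis imageE imageI)
  ultimately have sub2: "subbimodule_space N C W2"
    using W2 W1C unfolding subbimodule_space_def by blast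
  \<comment> \<open>By the Gram identity \<open>e2 (x j \<Omega>)\<close> has the norm of
    \<open>T (x j \<Omega>)\<close>, which is nonzero by \<open>nz\<close>.\<close>
  have "V2 \<noteq> {0}"
  proof
    assume "V2 = {0}"
    then have "e2 (x j \<Omega>) = 0" using V2(3) by blast
    then have "inner (T (x j \<Omega>)) (T (x j \<Omega>)) = 0" using Rin[of "x j \<Omega>" "x j \<Omega>"] by (simp add: e2_def)
    then show False using nz by (simp add: T_def)
  qed
  moreover have "bimodule_isomorphic N (L2_NYN P \<Omega> N d x\<lparr>bspace := V2\<rparr>) (C\<lparr>bspace := W2\<rparr>)"
    unfolding bimodule_isomorphic_def
    using U2 actL actR actC by (intro exI[of _ U2]) (simp add: L2_NYN_def norm_eq_sqrt_inner)
  ultimately show False using disj sub1 sub2 unfolding disjoint_bimodules_def by blast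
qed

end

end

section \<open>Ultrapowers\<close>

lemma linf_iff: "u \<in> linf A \<longleftrightarrow> (\<forall>i. u i \<in> A) \<and> (\<exists>K. \<forall>i. norm (u i) \<le> K)"
  by (auto simp: linf_def bounded_iff)

lemma linf_closed:
  assumes A: "unital_star_algebra A" and u: "u \<in> linf A" and v: "v \<in> linf A"
  shows "(\<lambda>i. u i + v i) \<in> linf A" "(\<lambda>i. u i o\<^sub>L v i) \<in> linf A" "(\<lambda>i. adj (u i)) \<in> linf A"
    "(\<lambda>i. cscalar c o\<^sub>L u i) \<in> linf A"
proof -
  obtain K where K: "\<And>i. norm (u i) \<le> K" and uA: "\<And>i. u i \<in> A" using u unfolding linf_iff by blast
  obtain L where L: "\<And>i. norm (v i) \<le> L" and vA: "\<And>i. v i \<in> A" using v unfolding linf_iff by blast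
  have "norm (u i + v i) \<le> K + L" for i
    by (intro order_trans[OF norm_triangle_ineq] add_mono K L)
  then show "(\<lambda>i. u i + v i) \<in> linf A"
    unfolding linf_iff using unital_star_algebraD(3)[OF A uA vA] by blast
  have "norm (u i o\<^sub>L v i) \<le> K * L" for i
    using order_trans[OF norm_ge_zero K] by (intro order_trans[OF norm_blinfun_compose] mult_mono K L) auto
  then show "(\<lambda>i. u i o\<^sub>L v i) \<in> linf A"
    unfolding linf_iff using unital_star_algebraD(4)[OF A uA vA] by blast
  have "norm (adj (u i)) \<le> K" for i
    using norm_adj_le[of "u i"] uA unital_star_algebraD(1)[OF A] K order_trans by blast
  then show "(\<lambda>i. adj (u i)) \<in> linf A"
    unfolding linf_iff using unital_star_algebraD(5)[OF A uA] by blast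
  have "norm (cscalar c o\<^sub>L u i) \<le> norm (cscalar c :: 'a op) * K" for i
    by (intro order_trans[OF norm_blinfun_compose] mult_left_mono K) auto
  then show "(\<lambda>i. cscalar c o\<^sub>L u i) \<in> linf A"
    unfolding linf_iff using unital_star_algebraD(6)[OF A uA] by blast
qed

lemma linf_const: "a \<in> A \<Longrightarrow> (\<lambda>_. a) \<in> linf A"
  by (auto simp: linf_iff)

lemma linf_mono: "A \<subseteq> B \<Longrightarrow> linf A \<subseteq> linf B"
  unfolding linf_iff subset_iff by blast

lemma csubspace_orbit:
  assumes A: "unital_star_algebra A" shows "csubspace ((\<lambda>a. blinfun_apply a v) ` A)"
  unfolding csubspace_def subspace_def
proof safe
  have "0 \<in> A" using unital_star_algebra_diff[OF A] unital_star_algebraD(2)[OF A] by fastforce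
  then show "0 \<in> (\<lambda>a. blinfun_apply a v) ` A" by (intro image_eqI[of _ _ 0]) auto
  show "a v + b v \<in> (\<lambda>a. blinfun_apply a v) ` A" if "a \<in> A" "b \<in> A" for a b
    using unital_star_algebraD(3)[OF A that] by (intro image_eqI[of _ _ "a + b"]) (simp_all add: blinfun.add_left)
  show "r *\<^sub>R a v \<in> (\<lambda>a. blinfun_apply a v) ` A" if "a \<in> A" for a r
    using unital_star_algebra_scaleR[OF A that] by (intro image_eqI[of _ _ "r *\<^sub>R a"]) (simp_all add: blinfun.scaleR_left)
  show "c *\<^sub>C a v \<in> (\<lambda>a. blinfun_apply a v) ` A" if "a \<in> A" for a c
    using unital_star_algebraD(6)[OF A that] by (intro image_eqI[of _ _ "cscalar c o\<^sub>L a"]) simp_all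
qed

text \<open>Properness of \<omega> gives uniqueness of limits; their existence is part of
  \<open>tracial_ultrapower\<close>.\<close>

locale ultrapower =
  fixes Mt :: "'h::chilbert_space op set" and \<tau> :: "'h op \<Rightarrow> complex" and \<omega> :: "'i filter"
    and \<pi> :: "('i \<Rightarrow> 'h op) \<Rightarrow> 'k::chilbert_space op" and \<Omega> :: 'k
  assumes Mt: "tracial_vN_algebra Mt \<tau>" and \<omega>: "\<omega> \<noteq> bot"
    and up: "tracial_ultrapower \<omega> Mt \<tau> \<pi> \<Omega>"
begin

lemma Mt_star: "unital_star_algebra Mt"
  using Mt by (simp add: tracial_vN_algebra_def von_neumann_algebra_star)

lemma trace:
  shows trace_add: "S \<in> Mt \<Longrightarrow> T \<in> Mt \<Longrightarrow> \<tau> (S + T) = \<tau> S + \<tau> T"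
    and trace_scale: "T \<in> Mt \<Longrightarrow> \<tau> (cscalar c o\<^sub>L T) = c * \<tau> T"
    and trace_pos: "T \<in> Mt \<Longrightarrow> \<tau> (adj T o\<^sub>L T) \<in> \<real>\<^sub>\<ge>\<^sub>0"
    and trace_id: "\<tau> id_blinfun = 1"
    and trace_faithful: "T \<in> Mt \<Longrightarrow> \<tau> (adj T o\<^sub>L T) = 0 \<Longrightarrow> T = 0"
    and trace_commute: "S \<in> Mt \<Longrightarrow> T \<in> Mt \<Longrightarrow> \<tau> (S o\<^sub>L T) = \<tau> (T o\<^sub>L S)"
    and trace_normal: "normal_functional Mt \<tau>"
  using Mt unfolding tracial_vN_algebra_def faithful_normal_tracial_state_def
  by (elim conjE; (assumption | metis))+

lemma
  shows \<pi>_bounded: "\<pi> ` linf Mt \<subseteq> bounded_ops"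
    and \<pi>_id: "\<pi> (\<lambda>_. id_blinfun) = id_blinfun"
    and \<pi>_add: "u \<in> linf Mt \<Longrightarrow> v \<in> linf Mt \<Longrightarrow> \<pi> (\<lambda>i. u i + v i) = \<pi> u + \<pi> v"
    and \<pi>_mult: "u \<in> linf Mt \<Longrightarrow> v \<in> linf Mt \<Longrightarrow> \<pi> (\<lambda>i. u i o\<^sub>L v i) = \<pi> u o\<^sub>L \<pi> v"
    and \<pi>_scale: "u \<in> linf Mt \<Longrightarrow> \<pi> (\<lambda>i. cscalar c o\<^sub>L u i) = cscalar c o\<^sub>L \<pi> u"
    and \<pi>_adj: "u \<in> linf Mt \<Longrightarrow> \<pi> (\<lambda>i. adj (u i)) = adj (\<pi> u)"
    and \<pi>_trace: "u \<in> linf Mt \<Longrightarrow> ((\<lambda>i. \<tau> (u i)) \<longlongrightarrow> cinner (\<pi> u \<Omega>) \<Omega>) \<omega>"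
    and \<pi>_cyclic: "closed_cspan ((\<lambda>u. blinfun_apply (\<pi> u) \<Omega>) ` linf Mt) = UNIV"
  using up unfolding tracial_ultrapower_def by blast+

lemma unital_star_algebra_\<pi>:
  assumes A: "unital_star_algebra A" "A \<subseteq> Mt"
  shows "unital_star_algebra (\<pi> ` linf A)"
proof -
  note sub = subsetD[OF linf_mono[OF A(2)]]
  have "\<pi> u + \<pi> v \<in> \<pi> ` linf A" "\<pi> u o\<^sub>L \<pi> v \<in> \<pi> ` linf A" "adj (\<pi> u) \<in> \<pi> ` linf A" 
    "cscalar c o\<^sub>L \<pi> u \<in> \<pi> ` linf A"
    if "u \<in> linf A" "v \<in> linf A" for u v c
    using linf_closed[OF A(1) that] that
    by (auto simp: \<pi>_add[symmetric] \<pi>_mult[symmetric] \<pi>_adj[symmetric] \<pi>_scale[symmetric] sub)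
  moreover have "\<pi> ` linf A \<subseteq> bounded_ops" using \<pi>_bounded sub by blast
  moreover have "id_blinfun \<in> \<pi> ` linf A"
    using \<pi>_id linf_const[OF unital_star_algebraD(2)[OF A(1)]] by (metis image_eqI)
  ultimately show ?thesis unfolding unital_star_algebra_def by blast
qed

abbreviation "P \<equiv> \<pi> ` linf Mt"

text \<open>The trace property holds at every index and passes to the limit; cyclicity holds because
  the orbit of \<Omega> is already a complex subspace.\<close>

sublocale cyclic_trace P \<Omega>
proof
  show star: "unital_star_algebra P" by (rule unital_star_algebra_\<pi>[OF Mt_star order_refl])
  show "cinner (S (T \<Omega>)) \<Omega> = cinner (T (S \<Omega>)) \<Omega>" if ST: "S \<in> P" "T \<in> P" for S T
  proof -
    obtain u v where uv: "u \<in> linf Mt" "v \<in> linf Mt" "S = \<pi> u" "T = \<pi> v" using ST by blast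
    have "((\<lambda>i. \<tau> (u i o\<^sub>L v i)) \<longlongrightarrow> cinner (S (T \<Omega>)) \<Omega>) \<omega>"
      "((\<lambda>i. \<tau> (v i o\<^sub>L u i)) \<longlongrightarrow> cinner (T (S \<Omega>)) \<Omega>) \<omega>"
      using \<pi>_trace[OF linf_closed(2)[OF Mt_star uv(1,2)]] \<pi>_trace[OF linf_closed(2)[OF Mt_star uv(2,1)]]
      by (simp_all add: \<pi>_mult uv)
    moreover have "\<tau> (u i o\<^sub>L v i) = \<tau> (v i o\<^sub>L u i)" for i
      using uv(1,2) by (intro trace_commute) (auto simp: linf_iff)
    ultimately show ?thesis using tendsto_unique[OF \<omega>] by simp
  qed
  have "(\<lambda>u. blinfun_apply (\<pi> u) \<Omega>) ` linf Mt = (\<lambda>a. blinfun_apply a \<Omega>) ` P" by auto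
  then show "closure ((\<lambda>a. blinfun_apply a \<Omega>) ` P) = UNIV"
    using \<pi>_cyclic closed_cspan_csubspace[OF csubspace_orbit[OF star, of \<Omega>]] by simp
qed

section \<open>The diagonal embedding\<close>

lemma
  assumes "a \<in> Mt"
  shows diagonal_mem: "diagonal \<pi> a \<in> P"
    and diagonal_adj: "diagonal \<pi> (adj a) = adj (diagonal \<pi> a)"
    and diagonal_scale: "diagonal \<pi> (cscalar c o\<^sub>L a) = cscalar c o\<^sub>L diagonal \<pi> a"
    and diagonal_trace: "cinner (diagonal \<pi> a \<Omega>) \<Omega> = \<tau> a"
  using linf_const[OF assms] \<pi>_adj[of "\<lambda>_. a"] \<pi>_scale[of "\<lambda>_. a" c]
    tendsto_unique[OF \<omega> \<pi>_trace[of "\<lambda>_. a"] tendsto_const]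
  by (auto simp: diagonal_def)

lemma diagonal_id: "diagonal \<pi> id_blinfun = id_blinfun"
  by (simp add: diagonal_def \<pi>_id)

lemma
  assumes "a \<in> Mt" "b \<in> Mt"
  shows diagonal_add: "diagonal \<pi> (a + b) = diagonal \<pi> a + diagonal \<pi> b"
    and diagonal_mult: "diagonal \<pi> (a o\<^sub>L b) = diagonal \<pi> a o\<^sub>L diagonal \<pi> b"
  using linf_const[OF assms(1)] linf_const[OF assms(2)] \<pi>_add[of "\<lambda>_. a" "\<lambda>_. b"] \<pi>_mult[of "\<lambda>_. a" "\<lambda>_. b"]
  by (auto simp: diagonal_def)

lemma diagonal_diff:
  assumes "a \<in> Mt" "b \<in> Mt"
  shows "diagonal \<pi> (a - b) = diagonal \<pi> a - diagonal \<pi> b"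
  using diagonal_add[OF unital_star_algebra_diff[OF Mt_star assms] assms(2)] by simp

lemma norm_diagonal: "a \<in> Mt \<Longrightarrow> complex_of_real ((norm (diagonal \<pi> a \<Omega>))\<^sup>2) = \<tau> (adj a o\<^sub>L a)"
  using diagonal_trace[of "adj a o\<^sub>L a"] unital_star_algebraD(4,5)[OF Mt_star]
    cinner_adj[OF bounded_ops_adj[OF bounded[OF diagonal_mem]], of a "diagonal \<pi> a \<Omega>" \<Omega>]
  by (simp add: diagonal_mult diagonal_adj adj_adj[OF bounded[OF diagonal_mem]] cinner_self)

text \<open>Weak closures are carried through the diagonal embedding. Normality of the trace bounds
  the 2-norm of \<open>c\<close> by the amplified \<open>c\<close> on one fixed vector, so the
  density theorem yields 2-norm approximation, which \<open>mem_double_commutant\<close> turns into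
  membership in \<open>Q\<close>.\<close>

lemma diagonal_subset:
  assumes X: "Mt = vN_gen X" and Q: "von_neumann_algebra Q" "diagonal \<pi> ` X \<subseteq> Q"
  shows "diagonal \<pi> ` Mt \<subseteq> Q"
proof
  fix z assume "z \<in> diagonal \<pi> ` Mt"
  then obtain a where a: "a \<in> Mt" and z: "z = diagonal \<pi> a" by blast
  \<comment> \<open>The preimage of \<open>Q\<close>: a star-algebra containing \<open>X\<close>, so
    its double commutant contains \<open>Mt\<close>. It is not yet known to be weakly closed, hence
    the approximation below.\<close>
  define L where "L = {b \<in> Mt. diagonal \<pi> b \<in> Q}"
  note Qs = unital_star_algebraD[OF von_neumann_algebra_star[OF Q(1)]]
  note Ms = unital_star_algebraD[OF Mt_star]
  have L: "unital_star_algebra L"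
    unfolding unital_star_algebra_def L_def
    using Qs Ms by (auto simp: diagonal_id diagonal_add diagonal_mult diagonal_adj diagonal_scale)
  note Ls = unital_star_algebraD[OF L]
  have "X \<subseteq> L" using vN_gen_superset[of X] Q(2) unfolding X[symmetric] L_def by blast
  also have "L \<subseteq> commutant (commutant L)" using Ls(1) by (rule double_commutant_superset)
  finally have "Mt \<subseteq> commutant (commutant L)"
    unfolding X using Ls by (intro vN_gen_minimal von_neumann_algebra_double_commutant)
  then have aL: "a \<in> commutant (commutant L)" using a by blast
  obtain \<xi> \<eta> :: "nat \<Rightarrow> 'h" where \<xi>: "summable (\<lambda>n. (norm (\<xi> n))\<^sup>2)" and \<eta>: "summable (\<lambda>n. (norm (\<eta> n))\<^sup>2)"
    and \<tau>: "\<And>T. T \<in> Mt \<Longrightarrow> (\<lambda>n. cinner (T (\<xi> n)) (\<eta> n)) sums \<tau> T"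
    using trace_normal unfolding normal_functional_def by blast
  \<comment> \<open>Interleaves the two sequences representing the trace, so that a single vector
    \<open>f\<close> controls both; the parity convention is that of \<open>sums_if\<close>.\<close>
  define \<zeta> where "\<zeta> n = (if even n then \<eta> (n div 2) else \<xi> ((n - 1) div 2))" for n
  have sum: "(\<lambda>n. (norm (c (\<zeta> n)))\<^sup>2) sums ((\<Sum>n. (norm (c (\<xi> n)))\<^sup>2) + (\<Sum>n. (norm (c (\<eta> n)))\<^sup>2))"
    and s\<xi>: "summable (\<lambda>n. (norm (c (\<xi> n)))\<^sup>2)" and s\<eta>: "summable (\<lambda>n. (norm (c (\<eta> n)))\<^sup>2)" for c :: "'h op"
  proof -
    show s: "summable (\<lambda>n. (norm (c (\<xi> n)))\<^sup>2)" "summable (\<lambda>n. (norm (c (\<eta> n)))\<^sup>2)"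
      using summable_coord[of "amplify c (Abs_ell2 \<xi>)"] summable_coord[of "amplify c (Abs_ell2 \<eta>)"]
      by (simp_all add: coord_Abs \<xi> \<eta>)
    have "(\<lambda>n. (norm (c (\<zeta> n)))\<^sup>2) = (\<lambda>n. if even n then (norm (c (\<eta> (n div 2))))\<^sup>2 else (norm (c (\<xi> ((n - 1) div 2))))\<^sup>2)"
      by (auto simp: \<zeta>_def)
    then show "(\<lambda>n. (norm (c (\<zeta> n)))\<^sup>2) sums ((\<Sum>n. (norm (c (\<xi> n)))\<^sup>2) + (\<Sum>n. (norm (c (\<eta> n)))\<^sup>2))"
      using sums_if[OF summable_sums[OF s(1)] summable_sums[OF s(2)]] by simp
  qed
  define f where "f = Abs_ell2 \<zeta>"
  have f: "coord f = \<zeta>" unfolding f_def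
    using sum[of id_blinfun] by (intro coord_Abs) (auto simp: summable_def)
  \<comment> \<open>The trace of c* c is the sum of the inner products of \<open>c (\<xi> n)\<close>
    and \<open>c (\<eta> n)\<close>, each at most the sum of the two squared norms.\<close>
  have key: "(norm (diagonal \<pi> c \<Omega>))\<^sup>2 \<le> (norm (amplify c f))\<^sup>2" if c: "c \<in> Mt" for c
  proof -
    have c': "c \<in> bounded_ops" using c Ms by blast
    have "(\<lambda>n. Re (cinner ((adj c o\<^sub>L c) (\<xi> n)) (\<eta> n))) sums Re (\<tau> (adj c o\<^sub>L c))"
      using c Ms by (intro sums_Re \<tau>) auto
    moreover have "Re (\<tau> (adj c o\<^sub>L c)) = (norm (diagonal \<pi> c \<Omega>))\<^sup>2"
      by (simp flip: norm_diagonal[OF c])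
    moreover have "Re (cinner ((adj c o\<^sub>L c) (\<xi> n)) (\<eta> n)) = inner (c (\<xi> n)) (c (\<eta> n))" for n
      using cinner_adj[OF bounded_ops_adj[OF c'], of "c (\<xi> n)" "\<eta> n"]
      by (simp add: adj_adj[OF c'] inner_eq_Re_cinner)
    ultimately have 1: "(\<lambda>n. inner (c (\<xi> n)) (c (\<eta> n))) sums (norm (diagonal \<pi> c \<Omega>))\<^sup>2" by simp
    have 2: "(\<lambda>n. (norm (c (\<xi> n)))\<^sup>2 + (norm (c (\<eta> n)))\<^sup>2) sums ((\<Sum>n. (norm (c (\<xi> n)))\<^sup>2) + (\<Sum>n. (norm (c (\<eta> n)))\<^sup>2))"
      by (intro sums_add summable_sums s\<xi> s\<eta>)
    have 3: "inner v w \<le> (norm v)\<^sup>2 + (norm w)\<^sup>2" for v w :: 'h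
    proof -
      have "inner v w \<le> norm v * norm w" by (rule norm_cauchy_schwarz)
      moreover have "0 \<le> norm v * norm w" by simp
      ultimately show ?thesis using sum_squares_bound[of "norm v" "norm w"] by linarith
    qed
    have "(norm (diagonal \<pi> c \<Omega>))\<^sup>2 \<le> (\<Sum>n. (norm (c (\<xi> n)))\<^sup>2) + (\<Sum>n. (norm (c (\<eta> n)))\<^sup>2)"
      by (rule sums_le[OF 3 1 2])
    also have "\<dots> = (norm (amplify c f))\<^sup>2"
      using sum[of c] by (simp add: norm_ell2_sq f sums_iff)
    finally show ?thesis .
  qed
  have "diagonal \<pi> a \<Omega> \<in> closure ((\<lambda>p. blinfun_apply p \<Omega>) ` (diagonal \<pi> ` L))"
    unfolding closure_approachable
  proof (intro allI impI)
    fix e :: real assume "e > 0"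
    then obtain b where b: "b \<in> L" "dist (amplify b f) (amplify a f) < e"
      using von_neumann_density[OF L aL, of f] unfolding closure_approachable by blast
    have bM: "b \<in> Mt" using b by (simp add: L_def)
    have "amplify b f - amplify a f = amplify (b - a) f"
      by (rule ell2_eqI) (simp add: blinfun.diff_left)
    then have "norm (amplify (b - a) f) < e" using b(2) by (simp add: dist_norm)
    moreover have "norm (diagonal \<pi> (b - a) \<Omega>) \<le> norm (amplify (b - a) f)"
      by (rule power2_le_imp_le[OF key[OF unital_star_algebra_diff[OF Mt_star bM a]] norm_ge_zero])
    ultimately have "dist (diagonal \<pi> b \<Omega>) (diagonal \<pi> a \<Omega>) < e"
      by (simp add: dist_norm diagonal_diff bM a blinfun.diff_left)
    then show "\<exists>y\<in>(\<lambda>p. blinfun_apply p \<Omega>) ` (diagonal \<pi> ` L). dist y (diagonal \<pi> a \<Omega>) < e"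
      using b(1) by blast
  qed
  moreover have "diagonal \<pi> ` L \<subseteq> P" using diagonal_mem by (auto simp: L_def)
  moreover have "adj p \<in> diagonal \<pi> ` L" if "p \<in> diagonal \<pi> ` L" for p
    using that Ls(5) by (auto simp: L_def diagonal_adj[symmetric])
  ultimately have "diagonal \<pi> a \<in> commutant (commutant (diagonal \<pi> ` L))"
    using diagonal_mem[OF a] by (intro mem_double_commutant)
  also have "\<dots> \<subseteq> Q" using Q(1) by (intro double_commutant_minimal) (auto simp: L_def)
  finally show "z \<in> Q" using z by simp
qed

end

section \<open>Freeness\<close>

lemma unital_star_algebra_hull:
  assumes "F \<subseteq> bounded_ops" shows "unital_star_algebra (unital_star_algebra hull F)"
  unfolding hull_def using unital_star_algebra_bounded_ops assms
  by (intro unital_star_algebra_Inter) auto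

text \<open>The first moment of an even density: reflection changes the sign of the
  integrand.\<close>

lemma semicircular_centred:
  assumes "semicircular \<tau> s" shows "\<tau> s = 0"
proof -
  define f where "f = (\<lambda>r::real. r ^ 1 * (sqrt (4 - r\<^sup>2) / (2 * pi)))"
  have "integral {-2..2} f = integral {-2..2} (\<lambda>r. f (- r))"
    using Henstock_Kurzweil_Integration.integral_reflect_real[of 2 "- 2" f] unfolding minus_minus by (rule sym)
  also have "(\<lambda>r. f (- r)) = (\<lambda>r. - f r)" by (auto simp: f_def)
  finally have "integral {-2..2} f = 0" by (simp add: integral_neg)
  moreover have "\<tau> (((o\<^sub>L) s ^^ 1) id_blinfun) = complex_of_real (integral {-2..2} f)"
    using assms unfolding semicircular_def f_def by blast
  ultimately show ?thesis by simp
qed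

context ultrapower
begin

lemma trace_diff: "S \<in> Mt \<Longrightarrow> T \<in> Mt \<Longrightarrow> \<tau> (S - T) = \<tau> S - \<tau> T"
  using trace_add[OF unital_star_algebra_diff[OF Mt_star], of S T T] by simp

lemma trace_cscalar: "\<tau> (cscalar c) = c"
  using trace_scale[OF unital_star_algebraD(2)[OF Mt_star], of c] trace_id by simp

definition centre :: "'h op \<Rightarrow> 'h op" where "centre p = p - cscalar (\<tau> p)"

lemma centre_mem: "unital_star_algebra A \<Longrightarrow> p \<in> A \<Longrightarrow> centre p \<in> A"
  unfolding centre_def by (intro unital_star_algebra_diff unital_star_algebra_cscalar)

lemma trace_centre: "p \<in> Mt \<Longrightarrow> \<tau> (centre p) = 0"
  using unital_star_algebra_cscalar[OF Mt_star] by (simp add: centre_def trace_diff trace_cscalar)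

text \<open>Substitutes \<open>centre p\<close> plus a scalar for one letter of a word; complex
  linearity of \<open>X\<close> lets the scalar pass to the front.\<close>

lemma trace_split:
  assumes "X \<in> Mt" "p \<in> Mt" "Y \<in> Mt"
  shows "\<tau> (X o\<^sub>L (p o\<^sub>L Y)) = \<tau> (X o\<^sub>L (centre p o\<^sub>L Y)) + \<tau> p * \<tau> (X o\<^sub>L Y)"
proof -
  note Ms = unital_star_algebraD[OF Mt_star]
  have "X \<in> bounded_ops" using assms(1) Ms(1) by blast
  then have "X o\<^sub>L (p o\<^sub>L Y) = (X o\<^sub>L (centre p o\<^sub>L Y)) + (cscalar (\<tau> p) o\<^sub>L (X o\<^sub>L Y))"
    by (intro blinfun_eqI) (simp add: centre_def blinfun.add_left blinfun.diff_left blinfun.diff_right bounded_opsD)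
  then show ?thesis
    using assms Ms centre_mem[OF Mt_star assms(2)] by (simp add: trace_add trace_scale)
qed

section \<open>Mixed moments of \<open>M\<close> with a free centred element\<close>

context
  fixes M F :: "'h op set" and s :: "'h op"
  assumes M: "unital_star_algebra M" "M \<subseteq> Mt" and F: "F \<subseteq> Mt" and free: "free_pair \<tau> M F"
    and s: "s \<in> F" "\<tau> s = 0"
begin

text \<open>\<open>M\<close> is its own star-algebra hull, so its elements serve as letters
  directly; tag \<open>True\<close> marks \<open>M\<close>, tag \<open>False\<close> the algebra
  generated by \<open>F\<close>.\<close>

lemma free_word:
  assumes "w \<noteq> []" "distinct_adj (map fst w)"
    "\<And>j a. (j, a) \<in> set w \<Longrightarrow> a \<in> (if j then M else unital_star_algebra hull F) \<and> \<tau> a = 0"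
  shows "\<tau> (foldr (o\<^sub>L) (map snd w) id_blinfun) = 0"
proof -
  have "unital_star_algebra hull M = M"
    by (rule hull_same[of unital_star_algebra M, OF M(1)])
  then have "a \<in> unital_star_algebra hull (if j then M else F) \<and> \<tau> a = 0" if "(j, a) \<in> set w" for j a
    using assms(3)[OF that] by (auto split: if_splits)
  then show ?thesis
    using free assms(1,2) unfolding free_pair_def freely_independent_def by blast
qed

lemma hull_star: "unital_star_algebra (unital_star_algebra hull F)"
  using F unital_star_algebraD(1)[OF Mt_star] by (intro unital_star_algebra_hull) blast

lemma hull_mem: "s \<in> unital_star_algebra hull F"
  using s(1) hull_subset[of F] by blast

lemma trace_word2:
  assumes "p \<in> M" "\<tau> p = 0" "a \<in> unital_star_algebra hull F" "\<tau> a = 0"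
  shows "\<tau> (p o\<^sub>L a) = 0"
proof -
  have "\<tau> (foldr (o\<^sub>L) (map snd [(True, p), (False, a)]) id_blinfun) = 0"
    by (rule free_word) (use assms in auto)
  then show ?thesis by simp
qed

lemma trace_word4:
  assumes "p \<in> M" "\<tau> p = 0" "q \<in> M" "\<tau> q = 0"
  shows "\<tau> (q o\<^sub>L (s o\<^sub>L (p o\<^sub>L s))) = 0"
proof -
  have "\<tau> (foldr (o\<^sub>L) (map snd [(True, q), (False, s), (True, p), (False, s)]) id_blinfun) = 0"
    by (rule free_word) (use assms s(2) hull_mem in auto)
  then show ?thesis by simp
qed

lemma trace_free_product:
  assumes p: "p \<in> M" and a: "a \<in> unital_star_algebra hull F" "a \<in> Mt"
  shows "\<tau> (p o\<^sub>L a) = \<tau> p * \<tau> a"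
proof -
  note Ms = unital_star_algebraD[OF Mt_star]
  have pM: "p \<in> Mt" using p M by blast
  have "\<tau> (p o\<^sub>L a) = \<tau> (centre p o\<^sub>L a) + \<tau> p * \<tau> a"
    using trace_split[OF Ms(2) pM a(2)] by simp
  also have "\<tau> (centre p o\<^sub>L a) = \<tau> (centre p o\<^sub>L centre a) + \<tau> a * \<tau> (centre p)"
    using trace_split[OF centre_mem[OF Mt_star pM] a(2) Ms(2)] by simp
  also have "\<tau> (centre p o\<^sub>L centre a) = 0"
    by (intro trace_word2 centre_mem M hull_star p a trace_centre pM)
  finally show ?thesis by (simp add: trace_centre pM)
qed

text \<open>Centring \<open>q\<close> and \<open>p\<close> leaves an alternating centred word, which
  vanishes, and corrections in which the two copies of \<open>s\<close> meet. There
  \<open>s s\<close> is one element of the algebra generated by \<open>F\<close>, and the two-factor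
  rule applies.\<close>

lemma trace_free_quadratic:
  assumes p: "p \<in> M" and q: "q \<in> M"
  shows "\<tau> (q o\<^sub>L (s o\<^sub>L (p o\<^sub>L s))) = \<tau> (s o\<^sub>L s) * (\<tau> p * \<tau> q)"
proof -
  note Ms = unital_star_algebraD[OF Mt_star]
  have m: "p \<in> Mt" "q \<in> Mt" "s \<in> Mt" using p q M F s by blast+
  have ss: "s o\<^sub>L s \<in> unital_star_algebra hull F" "s o\<^sub>L s \<in> Mt"
    using hull_mem m(3) unital_star_algebraD(4)[OF hull_star] Ms(4) by auto
  have "\<tau> (q o\<^sub>L (s o\<^sub>L (p o\<^sub>L s))) = \<tau> (centre q o\<^sub>L (s o\<^sub>L (p o\<^sub>L s))) + \<tau> q * \<tau> (s o\<^sub>L (p o\<^sub>L s))"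
    using trace_split[OF Ms(2) m(2), of "s o\<^sub>L (p o\<^sub>L s)"] m Ms(4) by simp
  also have "\<tau> (s o\<^sub>L (p o\<^sub>L s)) = \<tau> p * \<tau> (s o\<^sub>L s)"
    using trace_commute[of s "p o\<^sub>L s"] trace_free_product[OF p ss] m Ms(4)
    by (simp add: blinfun_compose_assoc)
  also have "\<tau> (centre q o\<^sub>L (s o\<^sub>L (p o\<^sub>L s)))
      = \<tau> ((centre q o\<^sub>L s) o\<^sub>L (centre p o\<^sub>L s)) + \<tau> p * \<tau> ((centre q o\<^sub>L s) o\<^sub>L s)"
    using trace_split[of "centre q o\<^sub>L s" p s] m Ms(4) centre_mem[OF Mt_star m(2)]
    by (simp add: blinfun_compose_assoc)
  also have "\<tau> ((centre q o\<^sub>L s) o\<^sub>L (centre p o\<^sub>L s)) = 0"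
    unfolding blinfun_compose_assoc by (intro trace_word4 centre_mem M p q trace_centre m)
  also have "\<tau> ((centre q o\<^sub>L s) o\<^sub>L s) = 0"
    unfolding blinfun_compose_assoc
    using trace_free_product[OF centre_mem[OF M(1) q] ss] by (simp add: trace_centre m)
  finally show ?thesis by (simp add: mult_ac)
qed

lemma ultrapower_free_orthogonal:
  assumes p: "p \<in> M" and adj: "adj s = s"
  shows "cinner (diagonal \<pi> p \<Omega>) (diagonal \<pi> s \<Omega>) = 0"
proof -
  have m: "p \<in> Mt" "s \<in> Mt" using p M F s by blast+
  have "cinner (diagonal \<pi> p \<Omega>) (diagonal \<pi> s \<Omega>) = cinner (diagonal \<pi> (s o\<^sub>L p) \<Omega>) \<Omega>"
    using cinner_adj[OF bounded[OF diagonal_mem[OF m(2)]]] diagonal_adj[OF m(2)] adj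
    by (simp add: diagonal_mult m)
  also have "\<dots> = \<tau> (p o\<^sub>L s)"
    using m unital_star_algebraD(4)[OF Mt_star] by (simp add: diagonal_trace trace_commute[of s p])
  also have "\<dots> = 0" using trace_free_product[OF p hull_mem m(2)] s(2) by simp
  finally show ?thesis .
qed

text \<open>The moment identity holds at each index, and both sides converge along \<omega> because
  \<tau>(s s) is constant and the rest is a product of traces.\<close>

lemma ultrapower_free_quadratic:
  assumes "p \<in> \<pi> ` linf M" "q \<in> \<pi> ` linf M"
  shows "cinner (q (diagonal \<pi> s (p (diagonal \<pi> s \<Omega>)))) \<Omega>
    = \<tau> (s o\<^sub>L s) * (cinner (p \<Omega>) \<Omega> * cinner (q \<Omega>) \<Omega>)"
proof -
  obtain u v where uv: "u \<in> linf M" "p = \<pi> u" "v \<in> linf M" "q = \<pi> v" using assms by blast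
  have uv': "u \<in> linf Mt" "v \<in> linf Mt" using uv linf_mono[OF M(2)] by blast+
  have s': "(\<lambda>_. s) \<in> linf Mt" using s F by (intro linf_const) blast
  note l = linf_closed(2)[OF Mt_star]
  have "((\<lambda>i. \<tau> (v i o\<^sub>L (s o\<^sub>L (u i o\<^sub>L s)))) \<longlongrightarrow> cinner (q (diagonal \<pi> s (p (diagonal \<pi> s \<Omega>)))) \<Omega>) \<omega>"
    using \<pi>_trace[OF l[OF uv'(2) l[OF s' l[OF uv'(1) s']]]]
    by (simp add: \<pi>_mult uv' s' l uv diagonal_def)
  moreover have "\<tau> (v i o\<^sub>L (s o\<^sub>L (u i o\<^sub>L s))) = \<tau> (s o\<^sub>L s) * (\<tau> (u i) * \<tau> (v i))" for i
    using uv by (intro trace_free_quadratic) (auto simp: linf_iff)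
  moreover have "((\<lambda>i. \<tau> (s o\<^sub>L s) * (\<tau> (u i) * \<tau> (v i))) \<longlongrightarrow> \<tau> (s o\<^sub>L s) * (cinner (p \<Omega>) \<Omega> * cinner (q \<Omega>) \<Omega>)) \<omega>"
    using \<pi>_trace[OF uv'(1)] \<pi>_trace[OF uv'(2)] unfolding uv by (intro tendsto_intros)
  ultimately show ?thesis using tendsto_unique[OF \<omega>] by simp
qed

text \<open>Adjoints and traciality rearrange the inner product as the moment q S p S with p = c* a
  and q = b e*; the two traces obtained are the inner products in the coarse bimodule.\<close>

lemma ultrapower_free_coarse:
  assumes adj: "adj s = s"
    and mem: "a \<in> \<pi> ` linf M" "b \<in> \<pi> ` linf M" "c \<in> \<pi> ` linf M" "e \<in> \<pi> ` linf M"
  shows "cinner (a (diagonal \<pi> s (b \<Omega>))) (c (diagonal \<pi> s (e \<Omega>)))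
    = \<tau> (s o\<^sub>L s) * (cinner (a \<Omega>) (c \<Omega>) * cinner (b \<Omega>) (e \<Omega>))"
proof -
  define S where "S = diagonal \<pi> s"
  have sM: "s \<in> Mt" using s F by blast
  have S: "S \<in> P" "adj S = S" unfolding S_def using diagonal_mem[OF sM] diagonal_adj[OF sM] adj by auto
  note Ns = unital_star_algebraD[OF unital_star_algebra_\<pi>[OF M]]
  have sub: "\<pi> ` linf M \<subseteq> P" using linf_mono[OF M(2)] by blast
  note Ps = unital_star_algebraD[OF star]
  have P: "a \<in> P" "b \<in> P" "c \<in> P" "e \<in> P" "adj c \<in> P" "adj e \<in> P" using mem sub Ps(5) by auto
  note adj_left = cinner_adj[OF bounded]
  define T where "T = adj e o\<^sub>L (S o\<^sub>L ((adj c o\<^sub>L a) o\<^sub>L S))"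
  have T: "T \<in> P" unfolding T_def using P S Ps by auto
  have "cinner (a (S (b \<Omega>))) (c (S (e \<Omega>))) = cinner (T (b \<Omega>)) \<Omega>"
    using P S by (simp add: T_def adj_left adj_adj[OF bounded])
  also have "\<dots> = cinner ((b o\<^sub>L adj e) (S ((adj c o\<^sub>L a) (S \<Omega>)))) \<Omega>"
    using tracial[OF T P(2)] by (simp add: T_def)
  also have "\<dots> = \<tau> (s o\<^sub>L s) * (cinner ((adj c o\<^sub>L a) \<Omega>) \<Omega> * cinner ((b o\<^sub>L adj e) \<Omega>) \<Omega>)"
    unfolding S_def using mem Ns by (intro ultrapower_free_quadratic) auto
  also have "cinner ((adj c o\<^sub>L a) \<Omega>) \<Omega> = cinner (a \<Omega>) (c \<Omega>)"
    using P by (simp add: adj_left adj_adj[OF bounded])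
  also have "cinner ((b o\<^sub>L adj e) \<Omega>) \<Omega> = cinner (b \<Omega>) (e \<Omega>)"
    using tracial[OF P(2,6)] P by (simp add: adj_left adj_adj[OF bounded])
  finally show ?thesis by (simp add: S_def)
qed

end

text \<open>The variance of \<open>s\<close> is not evaluated: if it vanishes then \<open>s = 0\<close> by faithfulness, and otherwise
  only its positivity matters.\<close>

lemma diagonal_mem_vN_gen:
  assumes M: "unital_star_algebra M" "M \<subseteq> Mt" and F: "F \<subseteq> Mt" and free: "free_pair \<tau> M F"
    and N: "unital_star_algebra N" "N \<subseteq> \<pi> ` linf M"
    and C: "coarse_bimodule P \<Omega> N tens C"
    and disj: "disjoint_bimodules N (L2_NYN P \<Omega> N d (\<lambda>i. diagonal \<pi> (x i))) C"
    and x: "\<And>i. i < d \<Longrightarrow> x i \<in> M" and j: "j < d"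
    and s: "s \<in> F" "semicircular \<tau> s"
    and Q: "von_neumann_algebra Q" "N \<subseteq> Q" "diagonal \<pi> (x j) + r *\<^sub>R diagonal \<pi> s \<in> Q"
  shows "diagonal \<pi> (x j) \<in> Q"
proof -
  define y where "y = diagonal \<pi> (x j) + r *\<^sub>R diagonal \<pi> s"
  have sM: "s \<in> Mt" and xM: "\<And>i. i < d \<Longrightarrow> x i \<in> Mt" using s F x M by auto
  have adj: "adj s = s" using s(2) by (simp add: semicircular_def selfadjoint_def)
  have centred: "\<tau> s = 0" using s(2) by (rule semicircular_centred)
  obtain \<kappa> where \<kappa>: "\<tau> (s o\<^sub>L s) = complex_of_real \<kappa>" "\<kappa> \<ge> 0"
    using trace_pos[OF sM] unfolding adj nonneg_Reals_def by auto
  show ?thesis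
  proof (cases "\<kappa> = 0")
    case True
    then have "s = 0" using trace_faithful[OF sM] adj \<kappa> by simp
    then have "diagonal \<pi> s = 0" using diagonal_diff[OF sM sM] by simp
    then show ?thesis using Q by simp
  next
    case False
    have NP: "N \<subseteq> P" using N(2) linf_mono[OF M(2)] by blast
    have mem: "diagonal \<pi> (x j) \<Omega> \<in> bimodule_span \<Omega> N {y}"
      unfolding y_def
    proof (rule mem_bimodule_span_if_disjoint[OF N(1) NP C disj _ j diagonal_mem[OF sM]])
      show "diagonal \<pi> (x i) \<in> P" if "i < d" for i by (rule diagonal_mem[OF xM[OF that]])
      show "inner (diagonal \<pi> (x j) \<Omega>) (diagonal \<pi> s \<Omega>) = 0"
        using ultrapower_free_orthogonal[OF M F free s(1) centred x[OF j] adj]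
        by (simp add: inner_eq_Re_cinner)
      show "cinner (a (diagonal \<pi> s (b \<Omega>))) (c (diagonal \<pi> s (e \<Omega>)))
          = complex_of_real \<kappa> * (cinner (a \<Omega>) (c \<Omega>) * cinner (b \<Omega>) (e \<Omega>))"
        if "a \<in> N" "b \<in> N" "c \<in> N" "e \<in> N" for a b c e
        using ultrapower_free_coarse[OF M F free s(1) centred adj, of a b c e] that N(2) \<kappa>(1) by auto
      show "\<kappa> > 0" using False \<kappa> by simp
    qed
    \<comment> \<open>\<open>mem_double_commutant\<close> concerns subsets of \<open>P\<close>, in
      which \<open>Q\<close> need not lie; the intersection is still a star-algebra and contains
      \<open>N\<close> and \<open>y\<close>.\<close>
    define A where "A = P \<inter> Q"
    have A: "unital_star_algebra A"
      unfolding A_def using unital_star_algebra_Inter[of "{P, Q}"] star von_neumann_algebra_star[OF Q(1)] by auto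
    have "y \<in> A" unfolding A_def y_def
      using Q(3) diagonal_mem[OF sM] diagonal_mem[OF xM[OF j]]
      by (auto intro: unital_star_algebraD(3)[OF star] unital_star_algebra_scaleR[OF star])
    moreover have "N \<subseteq> A" using NP Q(2) by (auto simp: A_def)
    ultimately have "a o\<^sub>L y o\<^sub>L b \<in> A" if "a \<in> N" "b \<in> N" for a b
      using that unital_star_algebraD(4)[OF A] by blast
    then have "bimodule_span \<Omega> N {y} \<subseteq> closure ((\<lambda>a. blinfun_apply a \<Omega>) ` A)"
      unfolding bimodule_span_def
      by (intro closed_cspan_minimal csubspace_closure csubspace_orbit A closed_closure
          subset_trans[OF _ closure_subset]) blast
    then have "diagonal \<pi> (x j) \<in> commutant (commutant A)"
      using mem unital_star_algebraD(5)[OF A] diagonal_mem[OF xM[OF j]]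
      by (intro mem_double_commutant) (auto simp: A_def)
    also have "\<dots> \<subseteq> Q" by (intro double_commutant_minimal Q) (simp add: A_def)
    finally show ?thesis .
  qed
qed

end

theorem theorem2p1:
  fixes Mt M :: "'h::chilbert_space op set"
    and \<tau> :: "'h op \<Rightarrow> complex"
    and d :: nat
    and x s :: "nat \<Rightarrow> 'h op"
    and \<omega> :: "'i filter"
    and \<pi> :: "('i \<Rightarrow> 'h op) \<Rightarrow> 'k::chilbert_space op"
    and \<Omega> :: 'k
    and N :: "'k op set"
    and tens :: "'k \<Rightarrow> 'k \<Rightarrow> 'c::chilbert_space"
    and C :: "('k, 'c) bimodule"
  assumes "tracial_vN_algebra Mt \<tau>"
    and "\<And>i. i < d \<Longrightarrow> selfadjoint (x i)"
    and "M = vN_gen (x ` {..<d})"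
    and "free_semicircular_family \<tau> d s"
    and "free_pair \<tau> M (s ` {..<d})"
    and "Mt = vN_gen (x ` {..<d} \<union> s ` {..<d})"
    and "countable (UNIV :: 'i set)" and "infinite (UNIV :: 'i set)"
    and "free_ultrafilter \<omega>"
    and "tracial_ultrapower \<omega> Mt \<tau> \<pi> \<Omega>"
    and "von_neumann_algebra N" and "N \<subseteq> \<pi> ` linf M"
    and "abelian N" and "diffuse N" and "L2_separable N \<Omega>"
    and "coarse_bimodule (\<pi> ` linf Mt) \<Omega> N tens C"
    and "disjoint_bimodules N (L2_NYN (\<pi> ` linf Mt) \<Omega> N d (\<lambda>i. diagonal \<pi> (x i))) C"
  shows "\<forall>t>0.
    N \<or>\<^sub>v\<^sub>N vN_gen ((\<lambda>i. diagonal \<pi> (x i) + sqrt t *\<^sub>R diagonal \<pi> (s i)) ` {..<d})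
      = vN_gen (N \<union> (\<lambda>i. diagonal \<pi> (x i)) ` {..<d} \<union> (\<lambda>i. diagonal \<pi> (s i)) ` {..<d}) \<and>
    vN_gen (N \<union> (\<lambda>i. diagonal \<pi> (x i)) ` {..<d} \<union> (\<lambda>i. diagonal \<pi> (s i)) ` {..<d})
      = N \<or>\<^sub>v\<^sub>N diagonal \<pi> ` Mt \<and>
    (\<lambda>i. diagonal \<pi> (x i)) ` {..<d}
      \<subseteq> vN_gen (N \<union> (\<lambda>i. diagonal \<pi> (x i) + sqrt t *\<^sub>R diagonal \<pi> (s i)) ` {..<d})"
proof (intro allI impI)
  fix t :: real assume t: "t > 0"
  interpret ultrapower Mt \<tau> \<omega> \<pi> \<Omega>
    using assms(1,9,10) by unfold_locales (simp_all add: free_ultrafilter_def)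
  define X where "X = (\<lambda>i. diagonal \<pi> (x i)) ` {..<d}"
  define S where "S = (\<lambda>i. diagonal \<pi> (s i)) ` {..<d}"
  define Y where "Y = (\<lambda>i. diagonal \<pi> (x i) + sqrt t *\<^sub>R diagonal \<pi> (s i)) ` {..<d}"
  have xb: "x ` {..<d} \<subseteq> bounded_ops" using assms(2) by (auto simp: selfadjoint_def)
  have M: "unital_star_algebra M" "M \<subseteq> Mt"
    unfolding assms(3,6)
    by (intro von_neumann_algebra_star von_neumann_algebra_vN_gen xb) (intro vN_gen_mono Un_upper1)
  have F: "s ` {..<d} \<subseteq> Mt" and xM: "\<And>i. i < d \<Longrightarrow> x i \<in> M"
    using vN_gen_superset[of "x ` {..<d} \<union> s ` {..<d}"] vN_gen_superset[of "x ` {..<d}"] assms(3,6) by auto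
  have sc: "semicircular \<tau> (s i)" if "i < d" for i
    using assms(4) that by (simp add: free_semicircular_family_def)
  note N = von_neumann_algebra_star[OF assms(11)]
  have dM: "diagonal \<pi> ` Mt \<subseteq> bounded_ops" using diagonal_mem bounded by blast
  have Nb: "N \<subseteq> bounded_ops" using unital_star_algebraD(1)[OF N] .
  have Xb: "X \<subseteq> bounded_ops" "S \<subseteq> bounded_ops" using F xM M(2) by (auto simp: X_def S_def intro!: subsetD[OF dM])
  have Yb: "Y \<subseteq> bounded_ops"
    unfolding Y_def using Xb
    by (auto simp: X_def S_def intro!: bounded_ops_add unital_star_algebra_scaleR[OF unital_star_algebra_bounded_ops])
  \<comment> \<open>Stated for an arbitrary \<open>Q\<close> because it serves both the join in the
    first equality and the algebra in the final inclusion.\<close>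
  have X_sub: "X \<subseteq> Q" if "von_neumann_algebra Q" "N \<subseteq> Q" "Y \<subseteq> Q" for Q
  proof -
    have "diagonal \<pi> (x j) \<in> Q" if "j < d" for j
      using \<open>Y \<subseteq> Q\<close> that
      by (intro diagonal_mem_vN_gen[OF M F assms(5) N assms(12,16,17) xM that imageI sc \<open>von_neumann_algebra Q\<close> \<open>N \<subseteq> Q\<close>])
         (auto simp: Y_def)
    then show ?thesis by (auto simp: X_def)
  qed
  have Y_sub: "Y \<subseteq> Q" if "von_neumann_algebra Q" "X \<subseteq> Q" "S \<subseteq> Q" for Q
    unfolding Y_def using that(2,3) von_neumann_algebra_star[OF that(1)]
    by (auto simp: X_def S_def intro!: unital_star_algebraD(3) unital_star_algebra_scaleR)
  \<comment> \<open>Once the \<open>x i\<close> are recovered, each \<open>s i\<close> is a rescaled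
    difference; positivity of \<open>t\<close> permits the division.\<close>
  have S_sub: "S \<subseteq> Q" if Q: "von_neumann_algebra Q" "X \<subseteq> Q" "Y \<subseteq> Q" for Q
  proof -
    have "diagonal \<pi> (s i) \<in> Q" if i: "i < d" for i
    proof -
      have "(1 / sqrt t) *\<^sub>R ((diagonal \<pi> (x i) + sqrt t *\<^sub>R diagonal \<pi> (s i)) - diagonal \<pi> (x i)) \<in> Q"
        using Q(2,3) i by (intro unital_star_algebra_scaleR unital_star_algebra_diff von_neumann_algebra_star[OF Q(1)])
          (auto simp: X_def Y_def)
      then show ?thesis using t by simp
    qed
    then show ?thesis by (auto simp: S_def)
  qed
  have eq1: "N \<or>\<^sub>v\<^sub>N vN_gen Y = vN_gen (N \<union> X \<union> S)"
  proof
    have Q: "von_neumann_algebra (vN_gen (N \<union> X \<union> S))"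
      using Nb Xb by (intro von_neumann_algebra_vN_gen) auto
    have "N \<subseteq> vN_gen (N \<union> X \<union> S)" "X \<subseteq> vN_gen (N \<union> X \<union> S)" "S \<subseteq> vN_gen (N \<union> X \<union> S)"
      using vN_gen_superset[of "N \<union> X \<union> S"] by auto
    then show "N \<or>\<^sub>v\<^sub>N vN_gen Y \<subseteq> vN_gen (N \<union> X \<union> S)"
      unfolding vN_join_def using Y_sub[OF Q] by (intro vN_gen_minimal Un_least Q)
    have "von_neumann_algebra (vN_gen Y)" using Yb by (rule von_neumann_algebra_vN_gen)
    then have R: "von_neumann_algebra (N \<or>\<^sub>v\<^sub>N vN_gen Y)"
      unfolding vN_join_def using Nb unital_star_algebraD(1)[OF von_neumann_algebra_star]
      by (intro von_neumann_algebra_vN_gen) blast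
    have NR: "N \<subseteq> N \<or>\<^sub>v\<^sub>N vN_gen Y" and YR: "Y \<subseteq> N \<or>\<^sub>v\<^sub>N vN_gen Y"
      unfolding vN_join_def using vN_gen_superset[of "N \<union> vN_gen Y"] vN_gen_superset[of Y] by auto
    note XR = X_sub[OF R NR YR]
    show "vN_gen (N \<union> X \<union> S) \<subseteq> N \<or>\<^sub>v\<^sub>N vN_gen Y"
      using NR XR S_sub[OF R XR YR] by (intro vN_gen_minimal R) auto
  qed
  \<comment> \<open>The second inclusion is not formal: the diagonal images of generators must
    generate the diagonal image of all of \<open>Mt\<close>, which rests on normality of the
    trace.\<close>
  have eq2: "vN_gen (N \<union> X \<union> S) = N \<or>\<^sub>v\<^sub>N diagonal \<pi> ` Mt"
    unfolding vN_join_def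
  proof
    show "vN_gen (N \<union> X \<union> S) \<subseteq> vN_gen (N \<union> diagonal \<pi> ` Mt)"
      using F xM M(2) by (intro vN_gen_mono) (auto simp: X_def S_def)
    have Q: "von_neumann_algebra (vN_gen (N \<union> X \<union> S))"
      using Nb Xb by (intro von_neumann_algebra_vN_gen) auto
    have "diagonal \<pi> ` (x ` {..<d} \<union> s ` {..<d}) \<subseteq> vN_gen (N \<union> X \<union> S)"
      using vN_gen_superset[of "N \<union> X \<union> S"] by (auto simp: X_def S_def)
    from diagonal_subset[OF assms(6) Q this]
    show "vN_gen (N \<union> diagonal \<pi> ` Mt) \<subseteq> vN_gen (N \<union> X \<union> S)"
      using vN_gen_superset[of "N \<union> X \<union> S"] by (intro vN_gen_minimal Q) auto
  qed
  have "X \<subseteq> vN_gen (N \<union> Y)"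
    using vN_gen_superset[of "N \<union> Y"] Nb Yb by (intro X_sub von_neumann_algebra_vN_gen) auto
  with eq1 eq2 show "N \<or>\<^sub>v\<^sub>N vN_gen ((\<lambda>i. diagonal \<pi> (x i) + sqrt t *\<^sub>R diagonal \<pi> (s i)) ` {..<d})
      = vN_gen (N \<union> (\<lambda>i. diagonal \<pi> (x i)) ` {..<d} \<union> (\<lambda>i. diagonal \<pi> (s i)) ` {..<d}) \<and>
    vN_gen (N \<union> (\<lambda>i. diagonal \<pi> (x i)) ` {..<d} \<union> (\<lambda>i. diagonal \<pi> (s i)) ` {..<d})
      = N \<or>\<^sub>v\<^sub>N diagonal \<pi> ` Mt \<and>
    (\<lambda>i. diagonal \<pi> (x i)) ` {..<d}
      \<subseteq> vN_gen (N \<union> (\<lambda>i. diagonal \<pi> (x i) + sqrt t *\<^sub>R diagonal \<pi> (s i)) ` {..<d})"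
    unfolding X_def S_def Y_def by blast
qed

end
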